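(* Let $r\in(\frac56,1]$, $\alpha>0$, $s>\frac32$, and $T_*>0$ be fixed. Let $\mathbf u^0\in H^r(\mathbb T^3)$ and, for each $\nu>0$, $\mathbf u^0_\nu\in H^r(\mathbb T^3)$ be divergence-free and mean-free. Let $\mathbf u,\mathbf u_\nu\in C([0,T_*],V^r(\mathbb T^3))\cap L^2(0,T_*;H^s(\mathbb T^3))$ be, respectively, the solution of the fractional Euler--Voigt equations $$(I+\alpha^{2r}A^r)\frac{d}{dt}\mathbf u+B(\mathbf u,\mathbf u)=\mathbf 0,\qquad\mathbf u(0)=\mathbf u^0,$$ and the solution of the fractional Navier--Stokes--Voigt equations with viscosity $\nu>0$ $$(I+\alpha^{2r}A^r)\frac{d}{dt}\mathbf u_\nu+B(\mathbf u_\nu,\mathbf u_\nu)+\nu A\mathbf u_\nu=\mathbf 0,\qquad\mathbf u_\nu(0)=\mathbf u^0_\nu .$$ Let $T\in(0,T_*]$. Then: (i) There is a constant $C>0$, independent of $\nu$ and $t$, such that for all $t\in[0,T_*]$, with $C_T=\frac CT$, $$\|\mathbf u(t)-\mathbf u_\nu(t)\|_{L^2}^2+\alpha^{2r}\|A^{r/2}(\mathbf u(t)-\mathbf u_\nu(t))\|_{L^2}^2\le\left(\|\mathbf u^0-\mathbf u^0_\nu\|_{L^2}^2+\alpha^{2r}\|A^{r/2}(\mathbf u^0-\mathbf u^0_\nu)\|_{L^2}^2\right)e^{C_Tt}+\nu\|A^{1/2}\mathbf u\|_{L^2(0,t;L^2)}^2e^{C_Tt}.$$ (ii) Consequently, if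 $\|\mathbf u^0-\mathbf u^0_\nu\|_{L^2}^2+\alpha^{2r}\|A^{r/2}(\mathbf u^0-\mathbf u^0_\nu)\|_{L^2}^2\to0$ as $\nu\to0$ (in particular, when $\mathbf u^0_\nu=\mathbf u^0$), then $\mathbf u_\nu\to\mathbf u$ in $C([0,T],H^1)$ as $\nu\to0$.
   Context: All functions are $\mathbb R^3$-valued on the three-dimensional torus $\mathbb T^3=\mathbb R^3/\mathbb Z^3$, divergence-free and mean-free. $H$ (resp. $V^r$) is the closure in $L^2$ (resp. $H^r$) of the smooth divergence-free mean-free fields on $\mathbb T^3$, $V=V^1$. $P_\sigma:L^2\to H$ is the Leray--Helmholtz projection, $B(\mathbf u,\mathbf v)=P_\sigma((\mathbf u\cdot\nabla)\mathbf v)$, and $A=-P_\sigma\triangle$ is the Stokes operator with domain $H^2(\mathbb T^3)\cap H$. $A$ is positive self-adjoint on $H$ with orthonormal eigenbasis $A\boldsymbol\varphi_k=\lambda_k\boldsymbol\varphi_k$, and $A^s\sum_ku_k\boldsymbol\varphi_k=\sum_k\lambda_k^su_k\boldsymbol\varphi_k$; on divergence-free mean-free fields $\|\mathbf u\|_{H^s}^2$ is equivalent to $\|A^{s/2}\mathbf u\|_{L^2}^2=\sum_k\lambda_k^s|u_k|^2$. Both equations are understood after integration in time and testing against $\mathbf v\in V\cap V^r$ (in the case $\nu=0$, as an equality in $(V^r)'$), where $B$ extends to a continuous bilinear map $V^r\times V^r\to(V^r)'$ for $r>\frac56$.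
   Formalization: In (ii), false for r<1 (high-frequency shear data), the stated hypothesis gives convergence in C([0,T],H^r); convergence in C([0,T],H^1) is stated when also u^0−u^0_ν lies in H^1 and tends to 0 there (automatic if u^0_ν=u^0). *)

theory Defs
  imports "HOL-Analysis.Analysis"
begin

section \<open>Periodic vector fields on the three-dimensional torus\<close>

text \<open>
  A field on the torus \<open>\<real>\<^sup>3/\<int>\<^sup>3\<close> is a \<open>\<int>\<^sup>3\<close>-periodic function on \<open>\<real>\<^sup>3\<close>; integrals over the torus are
  integrals over the unit cube.  Elements of the function spaces are functions, not classes of
  functions that agree almost everywhere; all norms and pairings below depend only on the class.
\<close>

type_synonym field = "real^3 \<Rightarrow> real^3"

abbreviation unit_cube :: "(real^3) set" where
  "unit_cube \<equiv> cbox 0 (\<chi> i. 1)"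

definition ivec :: "int^3 \<Rightarrow> real^3" where
  "ivec k = (\<chi> i. of_int (k $ i))"

definition periodic :: "field \<Rightarrow> bool" where
  "periodic f \<longleftrightarrow> (\<forall>k x. f (x + ivec k) = f x)"

definition L2_field :: "field \<Rightarrow> bool" where
  "L2_field f \<longleftrightarrow> periodic f \<and> f \<in> borel_measurable borel \<and>
     set_integrable lborel unit_cube (\<lambda>x. (norm (f x))\<^sup>2)"

definition L2_inner :: "field \<Rightarrow> field \<Rightarrow> real" where
  "L2_inner f g = (LINT x:unit_cube|lborel. f x \<bullet> g x)"

definition L2_norm :: "field \<Rightarrow> real" where
  "L2_norm f = sqrt (LINT x:unit_cube|lborel. (norm (f x))\<^sup>2)"

definition fourier :: "field \<Rightarrow> int^3 \<Rightarrow> complex^3" where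
  "fourier f k = (\<chi> j. LINT x:unit_cube|lborel.
     complex_of_real (f x $ j) * exp (- (2 * of_real pi * \<i> * of_real (ivec k \<bullet> x))))"


section \<open>Sobolev spaces\<close>

text \<open>The weight \<open>(1 + 4\<pi>\<^sup>2|k|\<^sup>2)\<^sup>s\<close> is the Fourier symbol of \<open>(I - \<triangle>)\<^sup>s\<close>.  Only \<open>s \<ge> 0\<close> is used.\<close>

definition Hs :: "real \<Rightarrow> field set" where
  "Hs s = {f. L2_field f \<and>
     (\<lambda>k. (1 + (2 * pi * norm (ivec k))\<^sup>2) powr s * (norm (fourier f k))\<^sup>2) summable_on UNIV}"

definition Hs_norm :: "real \<Rightarrow> field \<Rightarrow> real" where
  "Hs_norm s f =
     sqrt (\<Sum>\<^sub>\<infinity>k. (1 + (2 * pi * norm (ivec k))\<^sup>2) powr s * (norm (fourier f k))\<^sup>2)"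

definition partial_deriv :: "3 \<Rightarrow> field \<Rightarrow> field" where
  "partial_deriv i f = (\<lambda>x. frechet_derivative f (at x) (axis i 1))"

primrec Ck_field :: "nat \<Rightarrow> field \<Rightarrow> bool" where
  "Ck_field 0 f \<longleftrightarrow> continuous_on UNIV f"
| "Ck_field (Suc n) f \<longleftrightarrow> f differentiable_on UNIV \<and> (\<forall>i. Ck_field n (partial_deriv i f))"

definition divergence :: "field \<Rightarrow> real^3 \<Rightarrow> real" where
  "divergence f x = (\<Sum>i\<in>UNIV. partial_deriv i f x $ i)"

definition smooth_solenoidal :: "field set" where
  "smooth_solenoidal = {f. periodic f \<and> (\<forall>n. Ck_field n f) \<and>
     (\<forall>x. divergence f x = 0) \<and> (LINT x:unit_cube|lborel. f x) = 0}"

text \<open>\<open>V\<^sup>r\<close>: the closure in \<open>H\<^sup>r\<close> of the smooth divergence-free mean-free fields.\<close>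

definition V :: "real \<Rightarrow> field set" where
  "V r = {f \<in> Hs r. \<forall>\<epsilon>>0. \<exists>\<phi>\<in>smooth_solenoidal. Hs_norm r (f - \<phi>) < \<epsilon>}"


section \<open>Powers of the Stokes operator\<close>

text \<open>
  On the torus the eigenvectors of \<open>A = - P\<^sub>\<sigma> \<triangle>\<close> in \<open>H\<close> are the Fourier modes \<open>a e\<^bsup>2\<pi>ik\<cdot>x\<^esup>\<close> with \<open>k \<noteq> 0\<close> and
  \<open>a \<cdot> k = 0\<close> (in the complexification), with eigenvalue \<open>4\<pi>\<^sup>2|k|\<^sup>2\<close>.  Collecting the (two) modes that
  belong to each \<open>k\<close>, the eigenfunction expansion of a divergence-free mean-free \<open>u\<close> is its Fourier
  series, and the sum of \<open>\<lambda>\<^sub>k\<^sup>s u\<^sub>k v\<^sub>k\<close> over the eigenbasis is the sum below.  It is the duality pairing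
  \<open>\<langle>A\<^sup>s u, v\<rangle>\<close>, meaningful also if \<open>A\<^sup>s u\<close> is not in \<open>L\<^sup>2\<close>.  The inner product of \<open>complex^3\<close> is the real
  part of the Hermitian one; the sum over all \<open>k\<close> of the Hermitian products is real anyway.
\<close>

definition stokes_eigenvalue :: "int^3 \<Rightarrow> real" where
  "stokes_eigenvalue k = (2 * pi * norm (ivec k))\<^sup>2"

definition stokes_pairing :: "real \<Rightarrow> field \<Rightarrow> field \<Rightarrow> real" where
  "stokes_pairing s u v =
     (\<Sum>\<^sub>\<infinity>k. stokes_eigenvalue k powr s * (fourier u k \<bullet> fourier v k))"

text \<open>\<open>stokes_norm s u\<close> is the \<open>L\<^sup>2\<close> norm of \<open>A\<^sup>s u\<close>.\<close>

definition stokes_norm :: "real \<Rightarrow> field \<Rightarrow> real" where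
  "stokes_norm s u =
     sqrt (\<Sum>\<^sub>\<infinity>k. stokes_eigenvalue k powr (2 * s) * (norm (fourier u k))\<^sup>2)"


section \<open>The nonlinearity\<close>

text \<open>
  \<open>\<langle>B(u,v), w\<rangle>\<close> for smooth \<open>u\<close>, \<open>v\<close> and \<open>w\<close> in \<open>H\<close>: since \<open>P\<^sub>\<sigma>\<close> is the orthogonal projection onto \<open>H\<close>,
  it can be dropped against \<open>w\<close>.  Note that \<open>(u \<cdot> \<nabla>)v\<close> at \<open>x\<close> is the derivative of \<open>v\<close> at \<open>x\<close> in the direction \<open>u x\<close>.
\<close>

definition B_smooth :: "field \<Rightarrow> field \<Rightarrow> field \<Rightarrow> real" where
  "B_smooth u v w = L2_inner (\<lambda>x. frechet_derivative v (at x) (u x)) w"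

definition smooth_approx :: "real \<Rightarrow> (nat \<Rightarrow> field) \<Rightarrow> field \<Rightarrow> bool" where
  "smooth_approx r U u \<longleftrightarrow>
     (\<forall>n. U n \<in> smooth_solenoidal) \<and> (\<lambda>n. Hs_norm r (U n - u)) \<longlonglongrightarrow> 0"

text \<open>
  The extension of \<open>\<langle>B(u,v), w\<rangle>\<close> by continuity to \<open>u\<close>, \<open>v\<close>, \<open>w\<close> in \<open>V\<^sup>r\<close>, \<open>r > 5/6\<close>: the common limit of
  the values on smooth approximations.
\<close>

definition B_ext :: "real \<Rightarrow> field \<Rightarrow> field \<Rightarrow> field \<Rightarrow> real" where
  "B_ext r u v w = (THE L. \<forall>U V W.
     smooth_approx r U u \<longrightarrow> smooth_approx r V v \<longrightarrow> smooth_approx r W w \<longrightarrow>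
     (\<lambda>n. B_smooth (U n) (V n) (W n)) \<longlonglongrightarrow> L)"


section \<open>Time-dependent fields and the Voigt equations\<close>

definition C_time :: "real \<Rightarrow> real \<Rightarrow> field set \<Rightarrow> (real \<Rightarrow> field) \<Rightarrow> bool" where
  "C_time T s X u \<longleftrightarrow> (\<forall>t\<in>{0..T}. u t \<in> X) \<and>
     (\<forall>t\<in>{0..T}. ((\<lambda>\<tau>. Hs_norm s (u \<tau> - u t)) \<longlongrightarrow> 0) (at t within {0..T}))"

text \<open>
  \<open>L\<^sup>2(0,T;H\<^sup>s)\<close>.  As \<open>H\<^sup>s\<close> is a separable Hilbert space, strong measurability in time amounts to
  measurability of the Fourier coefficients.
\<close>

definition L2_time :: "real \<Rightarrow> real \<Rightarrow> (real \<Rightarrow> field) \<Rightarrow> bool" where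
  "L2_time T s u \<longleftrightarrow> (AE t in lborel. t \<in> {0..T} \<longrightarrow> u t \<in> Hs s) \<and>
     (\<forall>k. set_borel_measurable lborel {0..T} (\<lambda>t. fourier (u t) k)) \<and>
     set_integrable lborel {0..T} (\<lambda>t. (Hs_norm s (u t))\<^sup>2)"

text \<open>\<open>\<langle>(I + \<alpha>\<^bsup>2r\<^esup> A\<^sup>r) w, v\<rangle>\<close>\<close>

definition voigt_pairing :: "real \<Rightarrow> real \<Rightarrow> field \<Rightarrow> field \<Rightarrow> real" where
  "voigt_pairing \<alpha> r w v = L2_inner w v + \<alpha> powr (2 * r) * stokes_pairing r w v"

definition voigt_energy :: "real \<Rightarrow> real \<Rightarrow> field \<Rightarrow> real" where
  "voigt_energy \<alpha> r w = (L2_norm w)\<^sup>2 + \<alpha> powr (2 * r) * (stokes_norm (r / 2) w)\<^sup>2"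

text \<open>The equations, integrated over \<open>(0,t)\<close> and tested with \<open>v\<close>.\<close>

definition euler_voigt_solution ::
  "real \<Rightarrow> real \<Rightarrow> real \<Rightarrow> field \<Rightarrow> (real \<Rightarrow> field) \<Rightarrow> bool" where
  "euler_voigt_solution \<alpha> r T u0 u \<longleftrightarrow>
     (AE x in lborel. u 0 x = u0 x) \<and>
     (\<forall>v\<in>V r. \<forall>t\<in>{0..T}.
        voigt_pairing \<alpha> r (u t - u 0) v
        + (LINT \<tau>:{0..t}|lborel. B_ext r (u \<tau>) (u \<tau>) v) = 0)"

definition navier_stokes_voigt_solution ::
  "real \<Rightarrow> real \<Rightarrow> real \<Rightarrow> real \<Rightarrow> field \<Rightarrow> (real \<Rightarrow> field) \<Rightarrow> bool" where
  "navier_stokes_voigt_solution \<alpha> r \<nu> T u0 u \<longleftrightarrow>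
     (AE x in lborel. u 0 x = u0 x) \<and>
     (\<forall>v\<in>V 1 \<inter> V r. \<forall>t\<in>{0..T}.
        voigt_pairing \<alpha> r (u t - u 0) v
        + (LINT \<tau>:{0..t}|lborel. B_ext r (u \<tau>) (u \<tau>) v)
        + \<nu> * (LINT \<tau>:{0..t}|lborel. stokes_pairing 1 (u \<tau>) v) = 0)"

text \<open>Convergence of a family in \<open>C([0,T],H\<^sup>s)\<close> (in the sup norm) as \<open>\<nu> \<down> 0\<close>.\<close>

definition converges_in_C ::
  "real \<Rightarrow> real \<Rightarrow> (real \<Rightarrow> real \<Rightarrow> field) \<Rightarrow> (real \<Rightarrow> field) \<Rightarrow> bool" where
  "converges_in_C T s u\<^sub>\<nu> u \<longleftrightarrow>
     C_time T s (Hs s) u \<and> (\<forall>\<nu>>0. C_time T s (Hs s) (u\<^sub>\<nu> \<nu>)) \<and>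
     (\<forall>\<epsilon>>0. \<forall>\<^sub>F \<nu> in at_right 0. \<forall>t\<in>{0..T}. Hs_norm s (u\<^sub>\<nu> \<nu> t - u t) < \<epsilon>)"

end

theory Submission
  imports Defs
begin

text \<open>
  Everything is done on Fourier coefficients.  The pairing \<open>\<langle>B(a,b), c\<rangle>\<close> becomes the lattice sum
  \<open>\<Sum>\<^sub>k\<^sub>,\<^sub>m 2\<pi>i (a\<^sub>k \<cdot> (m - k)) b\<^bsub>m-k\<^esub> \<cdot> c\<^sub>m\<close>, which is bounded by \<open>\<parallel>a\<parallel>\<^bsub>t1\<^esub> \<parallel>b\<parallel>\<^bsub>t2\<^esub> \<parallel>c\<parallel>\<^bsub>t3\<^esub>\<close> whenever
  \<open>t1 \<ge> 0\<close>, \<open>t2, t3 \<ge> 1/2\<close> and \<open>t1 + t2 + t3 > 5/2\<close>: a product of negative powers of the three frequencies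
  is dominated by the sum of the corresponding powers of a single one, so Cauchy--Schwarz suffices and
  no Sobolev embedding is needed.  Testing with a single Fourier mode makes every coefficient of a
  solution continuously differentiable in time.

  For the difference \<open>w\<close> of the two solutions, the energy identity over finitely many modes, the
  antisymmetry of the form, and \<open>2 (u - w) \<cdot> w \<le> |u|\<^sup>2\<close> in the viscous term give (i) by Gronwall, as
  \<open>\<langle>B(w,u), w\<rangle> \<le> C \<parallel>u\<parallel>\<^sub>r \<parallel>w\<parallel>\<^sub>r\<^sup>2\<close> with \<open>u\<close> bounded in \<open>V\<^sup>r\<close>.  For the convergence in \<open>H\<^sup>1\<close>, which (i) does not
  yield when \<open>r < 1\<close>, the same identity is weighted by the symbol of \<open>(I - \<triangle>)\<^bsup>1-r\<^esup>\<close>; no bound on \<open>u\<^sub>\<nu>\<close> in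
  \<open>L\<^sup>2(H\<^sup>s)\<close> that is uniform in \<open>\<nu>\<close> is needed, because \<open>\<langle>B(w,w), (I - \<triangle>)\<^bsup>1-r\<^esup> w\<rangle>\<close> costs only \<open>\<parallel>w\<parallel>\<^sub>1\<^sup>2 \<parallel>w\<parallel>\<^sub>r\<close> and (i)
  makes \<open>\<parallel>w\<parallel>\<^sub>r\<close> small.
\<close>

section \<open>Weighted sequence spaces on the integer lattice\<close>

text \<open>The equations may only be tested with a fixed field, after integration in time, and
  before H^1 regularity is known the difference w need not lie in \<open>V 1\<close>. The energy
  identity is therefore only ever formed for finitely many modes. Truncating w spoils the
  cancellation of B(b,w) against w: it survives for the truncated part, but the tail of w leaves a
  term. This tail is small in V^r and disappears by dominated convergence in time.

  The hypotheses put a solution in H^s only at almost every time, whereas convergence in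
  C([0,T],H^1) asks for continuity in H^1. It is recovered from the smoothing of the equation: one
  good time, plus increments that are finite in H^1.

  Convergence in C([0,T],H^1) contains, at time 0, the convergence of the data in H^1. For r < 1 the
  energy of the difference of the data does not control this. So the formal statement concludes
  convergence in H^r from the energy alone, and convergence in H^1 when the data converge in H^1 as
  well.\<close>

definition wsp :: "('i \<Rightarrow> real) \<Rightarrow> ('i \<Rightarrow> 'b::real_normed_vector) set" where
  "wsp \<mu> = {a. (\<lambda>k. \<mu> k * (norm (a k))\<^sup>2) summable_on UNIV}"

text \<open>The weight is a parameter because the same facts serve the Sobolev weights, the symbol
  of the Voigt operator, the Stokes eigenvalues, and a power of \<open>jw\<close> times the Voigt
  symbol. As \<open>infsum\<close> is 0 for divergent sums, the value has a meaning only together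
  with membership in \<open>wsp\<close>.\<close>

definition wnorm :: "('i \<Rightarrow> real) \<Rightarrow> ('i \<Rightarrow> 'b::real_normed_vector) \<Rightarrow> real" where
  "wnorm \<mu> a = sqrt (\<Sum>\<^sub>\<infinity>k. \<mu> k * (norm (a k))\<^sup>2)"

lemma wnorm_sq:
  assumes "\<And>k. \<mu> k \<ge> 0"
  shows "(wnorm \<mu> a)\<^sup>2 = (\<Sum>\<^sub>\<infinity>k. \<mu> k * (norm (a k))\<^sup>2)"
  unfolding wnorm_def by (simp add: infsum_nonneg assms)

lemma wnorm_nonneg [simp]:
  assumes "\<And>k. \<mu> k \<ge> 0"
  shows "wnorm \<mu> a \<ge> 0"
  unfolding wnorm_def by (simp add: infsum_nonneg assms)

lemma wnorm_finite_le:
  assumes "\<And>k. \<mu> k \<ge> 0" "a \<in> wsp \<mu>" "finite F"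
  shows "(\<Sum>k\<in>F. \<mu> k * (norm (a k))\<^sup>2) \<le> (wnorm \<mu> a)\<^sup>2"
  unfolding wnorm_sq[of \<mu>, OF assms(1)] using assms by (intro finite_sum_le_infsum) (auto simp: wsp_def)

lemma wnorm_component_le:
  assumes "\<And>k. \<mu> k \<ge> 0" "a \<in> wsp \<mu>"
  shows "\<mu> k * (norm (a k))\<^sup>2 \<le> (wnorm \<mu> a)\<^sup>2"
  using wnorm_finite_le[OF assms, of "{k}"] by simp

text \<open>For nonnegative terms, bounds on finite partial sums give both summability and the bound
  on the sum. Norm inequalities are therefore proved on finite sets.\<close>

lemma wspI:
  fixes \<mu> :: "'i \<Rightarrow> real"
  assumes "\<And>k. \<mu> k \<ge> 0" "B \<ge> 0"
    and "\<And>F. finite F \<Longrightarrow> (\<Sum>k\<in>F. \<mu> k * (norm (a k))\<^sup>2) \<le> B\<^sup>2"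
  shows "a \<in> wsp \<mu>" "wnorm \<mu> a \<le> B"
proof -
  show "a \<in> wsp \<mu>" unfolding wsp_def mem_Collect_eq
    by (rule nonneg_bdd_above_summable_on) (use assms in \<open>auto simp: bdd_above_def\<close>)
  then have "(wnorm \<mu> a)\<^sup>2 \<le> B\<^sup>2"
    unfolding wnorm_sq[of \<mu>, OF assms(1)] using assms
    by (intro infsum_le_finite_sums) (auto simp: wsp_def)
  then show "wnorm \<mu> a \<le> B" using assms(2) by (rule power2_le_imp_le)
qed

text \<open>Weight and sequence may both change, so that Fourier multipliers and truncations are
  covered too. \<open>C\<close> enters squared since the weights act on squared norms.\<close>

lemma wnorm_mono:
  assumes "\<And>k. \<mu> k \<ge> 0" "\<And>k. \<nu> k \<ge> 0" "C \<ge> 0"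
    and le: "\<And>k. \<mu> k * (norm (a k))\<^sup>2 \<le> C\<^sup>2 * (\<nu> k * (norm (b k))\<^sup>2)" and "b \<in> wsp \<nu>"
  shows "a \<in> wsp \<mu>" "wnorm \<mu> a \<le> C * wnorm \<nu> b"
proof -
  have *: "(\<Sum>k\<in>F. \<mu> k * (norm (a k))\<^sup>2) \<le> (C * wnorm \<nu> b)\<^sup>2" if "finite F" for F
  proof -
    have "(\<Sum>k\<in>F. \<mu> k * (norm (a k))\<^sup>2) \<le> C\<^sup>2 * (\<Sum>k\<in>F. \<nu> k * (norm (b k))\<^sup>2)"
      unfolding sum_distrib_left by (intro sum_mono le)
    also have "\<dots> \<le> C\<^sup>2 * (wnorm \<nu> b)\<^sup>2"
      using assms that by (intro mult_left_mono wnorm_finite_le) auto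
    finally show ?thesis by (simp add: power_mult_distrib)
  qed
  show "a \<in> wsp \<mu>" "wnorm \<mu> a \<le> C * wnorm \<nu> b"
    using * assms by (auto intro!: wspI[where B="C * wnorm \<nu> b"])
qed

lemma sum_weighted_eq_L2_set:
  assumes "\<And>k. \<mu> k \<ge> 0"
  shows "(\<Sum>k\<in>F. \<mu> k * (norm (a k))\<^sup>2) = (L2_set (\<lambda>k. sqrt (\<mu> k) * norm (a k)) F)\<^sup>2"
  unfolding L2_set_def using assms by (simp add: sum_nonneg power_mult_distrib)

lemma L2_set_le_wnorm:
  assumes "\<And>k. \<mu> k \<ge> 0" "a \<in> wsp \<mu>" "finite F"
  shows "L2_set (\<lambda>k. sqrt (\<mu> k) * norm (a k)) F \<le> wnorm \<mu> a"
  using wnorm_finite_le[OF assms] assms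
  unfolding sum_weighted_eq_L2_set[of \<mu>, OF assms(1)] by (auto intro: power2_le_imp_le)

lemma wnorm_triangle:
  assumes "\<And>k. \<mu> k \<ge> 0" "a \<in> wsp \<mu>" "b \<in> wsp \<mu>"
  shows "(\<lambda>k. a k + b k) \<in> wsp \<mu>" "wnorm \<mu> (\<lambda>k. a k + b k) \<le> wnorm \<mu> a + wnorm \<mu> b"
proof -
  have *: "(\<Sum>k\<in>F. \<mu> k * (norm (a k + b k))\<^sup>2) \<le> (wnorm \<mu> a + wnorm \<mu> b)\<^sup>2" if "finite F" for F
  proof -
    have "L2_set (\<lambda>k. sqrt (\<mu> k) * norm (a k + b k)) F
       \<le> L2_set (\<lambda>k. sqrt (\<mu> k) * norm (a k) + sqrt (\<mu> k) * norm (b k)) F"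
      using assms by (intro L2_set_mono) (auto simp: norm_triangle_ineq mult_left_mono simp flip: distrib_left)
    also have "\<dots> \<le> wnorm \<mu> a + wnorm \<mu> b"
      by (rule order_trans[OF L2_set_triangle_ineq]) (intro add_mono L2_set_le_wnorm assms that)
    finally show ?thesis unfolding sum_weighted_eq_L2_set[of \<mu>, OF assms(1)]
      by (intro power_mono) auto
  qed
  show "(\<lambda>k. a k + b k) \<in> wsp \<mu>" "wnorm \<mu> (\<lambda>k. a k + b k) \<le> wnorm \<mu> a + wnorm \<mu> b"
    using * assms by (auto intro!: wspI[where B="wnorm \<mu> a + wnorm \<mu> b"])
qed

lemma wsp_uminus [simp]: "(\<lambda>k. - a k) \<in> wsp \<mu> \<longleftrightarrow> a \<in> wsp \<mu>"
  and wnorm_uminus [simp]: "wnorm \<mu> (\<lambda>k. - a k) = wnorm \<mu> a"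
  by (simp_all add: wsp_def wnorm_def)

lemma wnorm_minus_commute: "wnorm \<mu> (\<lambda>k. a k - b k) = wnorm \<mu> (\<lambda>k. b k - a k)"
  by (simp add: wnorm_def norm_minus_commute)

lemma wnorm_diff:
  assumes "\<And>k. \<mu> k \<ge> 0" "a \<in> wsp \<mu>" "b \<in> wsp \<mu>"
  shows "(\<lambda>k. a k - b k) \<in> wsp \<mu>" "wnorm \<mu> (\<lambda>k. a k - b k) \<le> wnorm \<mu> a + wnorm \<mu> b"
    "\<bar>wnorm \<mu> a - wnorm \<mu> b\<bar> \<le> wnorm \<mu> (\<lambda>k. a k - b k)"
proof -
  note t = wnorm_triangle[of \<mu>, OF assms(1)]
  show d: "(\<lambda>k. a k - b k) \<in> wsp \<mu>" "wnorm \<mu> (\<lambda>k. a k - b k) \<le> wnorm \<mu> a + wnorm \<mu> b"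
    using t[of a "\<lambda>k. - b k"] assms by simp_all
  have d': "(\<lambda>k. b k - a k) \<in> wsp \<mu>" using d(1) wsp_uminus[of "\<lambda>k. b k - a k"] by simp
  have "wnorm \<mu> a \<le> wnorm \<mu> (\<lambda>k. a k - b k) + wnorm \<mu> b"
    using t(2)[OF d(1) assms(3)] by simp
  moreover have "wnorm \<mu> b \<le> wnorm \<mu> (\<lambda>k. b k - a k) + wnorm \<mu> a"
    using t(2)[OF d' assms(2)] by simp
  ultimately show "\<bar>wnorm \<mu> a - wnorm \<mu> b\<bar> \<le> wnorm \<mu> (\<lambda>k. a k - b k)"
    using wnorm_minus_commute[of \<mu> a b] by linarith
qed

lemma wnorm_scale_weight:
  assumes "\<And>k. \<mu> k * (norm (a k))\<^sup>2 = \<nu> k * (norm (b k))\<^sup>2"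
  shows "wnorm \<mu> a = wnorm \<nu> b" "a \<in> wsp \<mu> \<longleftrightarrow> b \<in> wsp \<nu>"
  using assms by (simp_all add: wnorm_def wsp_def)

lemma wsp_finite_support:
  assumes "finite {k. a k \<noteq> 0}" "\<And>k. \<mu> k \<ge> 0"
  shows "a \<in> wsp \<mu>" "(wnorm \<mu> a)\<^sup>2 = (\<Sum>k | a k \<noteq> 0. \<mu> k * (norm (a k))\<^sup>2)"
proof -
  have "((\<lambda>k. \<mu> k * (norm (a k))\<^sup>2) has_sum (\<Sum>k | a k \<noteq> 0. \<mu> k * (norm (a k))\<^sup>2)) UNIV"
    by (rule has_sum_finite_neutralI) (use assms(1) in auto)
  then show "a \<in> wsp \<mu>" "(wnorm \<mu> a)\<^sup>2 = (\<Sum>k | a k \<noteq> 0. \<mu> k * (norm (a k))\<^sup>2)"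
    using wnorm_sq[of \<mu> a, OF assms(2)] by (auto simp: wsp_def has_sum_iff)
qed

text \<open>\<open>jw\<close> is the symbol of \<open>I - \<triangle>\<close>, as in the definition of \<open>Hs\<close>.\<close>

definition jw :: "int^3 \<Rightarrow> real" where
  "jw k = 1 + (2 * pi * norm (ivec k))\<^sup>2"

abbreviation sob :: "real \<Rightarrow> (int^3 \<Rightarrow> 'b::real_normed_vector) set" where
  "sob \<sigma> \<equiv> wsp (\<lambda>k. jw k powr \<sigma>)"

abbreviation sobn :: "real \<Rightarrow> (int^3 \<Rightarrow> 'b::real_normed_vector) \<Rightarrow> real" where
  "sobn \<sigma> \<equiv> wnorm (\<lambda>k. jw k powr \<sigma>)"

lemma jw_ge1: "jw k \<ge> 1" and jw_pos [simp]: "jw k > 0" and jw_nz [simp]: "jw k \<noteq> 0"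
proof -
  show "jw k \<ge> 1" by (simp add: jw_def)
  then show "jw k > 0" "jw k \<noteq> 0" by linarith+
qed

lemma ivec_add: "ivec (k + l) = ivec k + ivec l"
  and ivec_minus [simp]: "ivec (- k) = - ivec k" and ivec_0 [simp]: "ivec 0 = 0"
  by (simp_all add: ivec_def vec_eq_iff)

lemma ivec_eq_iff [simp]: "ivec k = ivec l \<longleftrightarrow> k = l"
  by (simp add: ivec_def vec_eq_iff)

lemma ivec_eq_0_iff [simp]: "ivec k = 0 \<longleftrightarrow> k = 0"
  using ivec_eq_iff[of k 0] by simp

lemma ivec_nth [simp]: "ivec k $ i = of_int (k $ i)"
  by (simp add: ivec_def)

lemma sob_mono:
  fixes a :: "int^3 \<Rightarrow> 'b::real_normed_vector"
  assumes "\<sigma> \<le> \<tau>" "a \<in> sob \<tau>"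
  shows "a \<in> sob \<sigma>" "sobn \<sigma> a \<le> sobn \<tau> a"
proof -
  have "jw k powr \<sigma> * (norm (a k))\<^sup>2 \<le> 1\<^sup>2 * (jw k powr \<tau> * (norm (a k))\<^sup>2)" for k
    using assms(1) jw_ge1[of k] by (simp add: mult_right_mono powr_mono)
  from wnorm_mono[OF _ _ _ this assms(2)] show "a \<in> sob \<sigma>" "sobn \<sigma> a \<le> sobn \<tau> a" by simp_all
qed

section \<open>Summability of negative powers of the weight over the lattice\<close>

lemma summable_on_int_powr:
  assumes "q > 1/2"
  shows "(\<lambda>n::int. (1 + (real_of_int n)\<^sup>2) powr - q) summable_on UNIV"
proof -
  let ?g = "\<lambda>n::int. (1 + (real_of_int n)\<^sup>2) powr - q"
  have "(\<lambda>n::nat. (1 + (real n)\<^sup>2) powr - q) summable_on UNIV"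
  proof (rule norm_summable_imp_summable_on, rule summable_comparison_test')
    show "summable (\<lambda>n::nat. real n powr (- (2 * q)))"
      using assms by (simp add: summable_real_powr_iff)
    show "norm (norm ((1 + (real n)\<^sup>2) powr - q)) \<le> real n powr (- (2 * q))" if "n \<ge> 1" for n
    proof -
      have "(1 + (real n)\<^sup>2) powr - q \<le> ((real n)\<^sup>2) powr - q"
        using assms that by (intro powr_mono2') auto
      also have "((real n)\<^sup>2) powr - q = real n powr (- (2 * q))"
        using that by (simp add: powr_powr flip: powr_numeral)
      finally show ?thesis by simp
    qed
  qed
  then have "?g summable_on (range int)" "?g summable_on (range (\<lambda>n. - int n))"
    by (subst summable_on_reindex; simp add: inj_on_def o_def)+
  then have "?g summable_on (range int \<union> range (\<lambda>n. - int n))"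
    by (rule summable_on_union)
  moreover have "range int \<union> range (\<lambda>n. - int n) = UNIV"
    by (auto simp: image_iff) (metis int_cases2)
  ultimately show ?thesis by simp
qed

text \<open>Since \<open>jw k\<close> dominates 1 + k_i^2 for each of the three coordinates, its
  power -p is at most a product of one-dimensional powers -p/3, and p/3 > 1/2 makes each factor
  summable over the integers.\<close>

lemma summable_on_jw_powr:
  assumes "p > 3/2"
  shows "(\<lambda>k::int^3. jw k powr - p) summable_on UNIV"
proof -
  define g where "g = (\<lambda>n::int. (1 + (real_of_int n)\<^sup>2) powr - (p/3))"
  have gs: "g summable_on UNIV" unfolding g_def using assms by (intro summable_on_int_powr) simp
  have g0: "g n \<ge> 0" for n by (simp add: g_def)
  have le: "jw k powr - p \<le> (\<Prod>i\<in>UNIV. g (k $ i))" for k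
  proof -
    have "1 + (real_of_int (k $ i))\<^sup>2 \<le> jw k" for i
    proof -
      have "\<bar>real_of_int (k $ i)\<bar> \<le> norm (ivec k)"
        using component_le_norm_cart[of "ivec k" i] by simp
      also have "\<dots> \<le> 2 * pi * norm (ivec k)" using pi_gt3 by (simp add: mult_le_cancel_right1)
      finally show ?thesis unfolding jw_def
        by (metis abs_le_square_iff abs_of_nonneg abs_ge_zero add_left_mono order_trans power2_abs)
    qed
    then have "(jw k powr - (p/3)) \<le> g (k $ i)" for i
      unfolding g_def using assms by (intro powr_mono2') (auto simp: add_pos_nonneg)
    then have "(\<Prod>i\<in>(UNIV::3 set). jw k powr - (p/3)) \<le> (\<Prod>i\<in>UNIV. g (k $ i))"
      by (intro prod_mono) auto
    moreover have "(\<Prod>i\<in>(UNIV::3 set). jw k powr - (p/3)) = jw k powr - p"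
      by (simp add: powr_powr flip: powr_numeral powr_realpow)
    ultimately show ?thesis by simp
  qed
  show ?thesis
  proof (rule nonneg_bdd_above_summable_on)
    show "bdd_above (sum (\<lambda>k::int^3. jw k powr - p) ` {F. F \<subseteq> UNIV \<and> finite F})"
      unfolding bdd_above_def
    proof (intro exI[of _ "(infsum g UNIV)^3"] ballI)
      fix x assume "x \<in> sum (\<lambda>k::int^3. jw k powr - p) ` {F. F \<subseteq> UNIV \<and> finite F}"
      then obtain F :: "(int^3) set" where F: "finite F" "x = (\<Sum>k\<in>F. jw k powr - p)" by auto
      \<comment> \<open>All coordinates of elements of \<open>F\<close> are collected, so that
        \<open>F\<close> lies in the cube of \<open>I\<close>, over which the sum of products
        factors.\<close>
      define I where "I = (\<Union>i. (\<lambda>k. k $ i) ` F)"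
      have I: "finite I" unfolding I_def using F by auto
      have "x \<le> (\<Sum>k\<in>F. \<Prod>i\<in>UNIV. g (k $ i))" unfolding F by (intro sum_mono le)
      also have "\<dots> \<le> (\<Sum>k\<in>vec_lambda ` (PiE UNIV (\<lambda>_::3. I)). \<Prod>i\<in>UNIV. g (k $ i))"
      proof (intro sum_mono2)
        show "F \<subseteq> vec_lambda ` (PiE UNIV (\<lambda>_::3. I))"
        proof
          fix k assume "k \<in> F"
          then have "vec_nth k \<in> PiE UNIV (\<lambda>_. I)" by (auto simp: I_def)
          then have "vec_lambda (vec_nth k) \<in> vec_lambda ` (PiE UNIV (\<lambda>_. I))" by (rule imageI)
          then show "k \<in> vec_lambda ` (PiE UNIV (\<lambda>_. I))" by simp
        qed
        show "finite (vec_lambda ` (PiE UNIV (\<lambda>_::3. I)))" using I by (intro finite_imageI finite_PiE) auto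
      qed (auto intro: prod_nonneg g0)
      also have "\<dots> = (\<Sum>h\<in>PiE UNIV (\<lambda>_::3. I). \<Prod>i\<in>UNIV. g (h i))"
        by (subst sum.reindex) (auto simp: inj_on_def vec_lambda_inject)
      also have "\<dots> = (\<Prod>i\<in>(UNIV::3 set). \<Sum>n\<in>I. g n)"
        using I by (subst prod_sum_PiE) auto
      also have "\<dots> = (\<Sum>n\<in>I. g n)^3" by simp
      also have "\<dots> \<le> (infsum g UNIV)^3"
        using I g0 gs by (intro power_mono finite_sum_le_infsum sum_nonneg) auto
      finally show "x \<le> (infsum g UNIV)^3" .
    qed
  qed auto
qed

section \<open>The trilinear form on Fourier coefficients\<close>

text \<open>Square summability with an explicit bound, stated on finite sets so that it survives
  reindexing by injections; nonnegativity allows index sets to be enlarged.\<close>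

definition l2_bounded :: "('i \<Rightarrow> real) \<Rightarrow> real \<Rightarrow> bool" where
  "l2_bounded X a \<longleftrightarrow> (\<forall>k. X k \<ge> 0) \<and> (\<forall>F. finite F \<longrightarrow> L2_set X F \<le> a)"

lemma l2_bounded_inj:
  assumes "l2_bounded X a" "inj h" "finite F"
  shows "L2_set (\<lambda>k. X (h k)) F \<le> a"
proof -
  have "L2_set (\<lambda>k. X (h k)) F = L2_set X (h ` F)"
    unfolding L2_set_def using assms(2) by (subst sum.reindex) (auto intro: inj_on_subset)
  then show ?thesis using assms by (auto simp: l2_bounded_def)
qed

lemma l2_bounded_sum_mult:
  assumes "l2_bounded X a" "l2_bounded Y b" "inj g" "inj h" "finite F"
  shows "(\<Sum>k\<in>F. X (g k) * Y (h k)) \<le> a * b"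
proof -
  have "(\<Sum>k\<in>F. X (g k) * Y (h k)) \<le> L2_set (\<lambda>k. X (g k)) F * L2_set (\<lambda>k. Y (h k)) F"
    using L2_set_mult_ineq[of "\<lambda>k. X (g k)" "\<lambda>k. Y (h k)" F] assms by (simp add: l2_bounded_def)
  also have "\<dots> \<le> a * b"
    using assms l2_bounded_inj[OF assms(1,3,5)] l2_bounded_inj[OF assms(2,4,5)]
    by (intro mult_mono) (auto intro: order_trans[OF L2_set_nonneg])
  finally show ?thesis .
qed

lemma l2_bounded_nonneg: "l2_bounded X a \<Longrightarrow> a \<ge> 0"
  unfolding l2_bounded_def using L2_set_nonneg[of X "{}"] by force

text \<open>In each of the three terms the index carried by \<open>G\<close> is summed last. The
  sequence with that index times \<open>G\<close> is summable by Cauchy--Schwarz; the other two are,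
  for a fixed value of that index, shifts or reflections of each other's argument, so
  Cauchy--Schwarz bounds their sum uniformly.\<close>

lemma l2_bounded_triple:
  fixes X Y Z G :: "'i::ab_group_add \<Rightarrow> real"
  assumes X: "l2_bounded X a" and Y: "l2_bounded Y b" and Z: "l2_bounded Z c" and G: "l2_bounded G d"
    and "finite A" "finite B"
  shows "(\<Sum>k\<in>A. \<Sum>m\<in>B. X k * Y (m - k) * Z m * (G k + G (m - k) + G m)) \<le> 3 * d * (a * b * c)"
proof -
  note nn = l2_bounded_nonneg[OF X] l2_bounded_nonneg[OF Y] l2_bounded_nonneg[OF Z] l2_bounded_nonneg[OF G]
  have p [simp]: "X k \<ge> 0" "Y k \<ge> 0" "Z k \<ge> 0" "G k \<ge> 0" for k
    using assms by (auto simp: l2_bounded_def)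
  have inj [simp]: "inj (\<lambda>m. m - k)" "inj (\<lambda>m. k - m)" "inj (\<lambda>m. m + k)" "inj (\<lambda>m. k + m)"
    "inj (\<lambda>m. m)" for k :: 'i
    by (auto simp: inj_on_def)
  \<comment> \<open>\<open>L\<close> holds every difference m - k, so that after the substitution l
    = m - k the range of l does not depend on k and the sums can be swapped.\<close>
  define L where "L = (\<lambda>(k, m). m - k) ` (A \<times> B)"
  have L: "finite L" using assms by (auto simp: L_def)
  have outer: "(\<Sum>k\<in>F. (W k * G k) * I k) \<le> d * (w * i)"
    if "finite F" "l2_bounded W w" "\<And>k. I k \<le> i" "i \<ge> 0" for F W w I i
  proof -
    have "(\<Sum>k\<in>F. (W k * G k) * I k) \<le> (\<Sum>k\<in>F. (W k * G k) * i)"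
      using that by (intro sum_mono mult_left_mono) (auto simp: l2_bounded_def)
    also have "\<dots> = (\<Sum>k\<in>F. W k * G k) * i" by (simp add: sum_distrib_right)
    also have "\<dots> \<le> (w * d) * i"
      using l2_bounded_sum_mult[OF that(2) G, of "\<lambda>k. k" "\<lambda>k. k" F] that by (intro mult_right_mono) auto
    finally show ?thesis by (simp add: mult_ac)
  qed
  have 1: "(\<Sum>k\<in>A. \<Sum>m\<in>B. X k * Y (m - k) * Z m * G k) \<le> d * (a * (b * c))"
  proof -
    have "(\<Sum>k\<in>A. \<Sum>m\<in>B. X k * Y (m - k) * Z m * G k)
      = (\<Sum>k\<in>A. (X k * G k) * (\<Sum>m\<in>B. Y (m - k) * Z m))"
      by (simp add: sum_distrib_left mult_ac)
    also have "\<dots> \<le> d * (a * (b * c))"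
      using assms nn by (intro outer l2_bounded_sum_mult) auto
    finally show ?thesis .
  qed
  have 2: "(\<Sum>k\<in>A. \<Sum>m\<in>B. X k * Y (m - k) * Z m * G (m - k)) \<le> d * (b * (a * c))"
  proof -
    have "(\<Sum>k\<in>A. \<Sum>m\<in>B. X k * Y (m - k) * Z m * G (m - k))
      = (\<Sum>k\<in>A. \<Sum>l\<in>(\<lambda>m. m - k) ` B. X k * Y l * Z (l + k) * G l)"
      by (rule sum.cong[OF refl], subst sum.reindex) (auto simp: inj_on_def)
    also have "\<dots> \<le> (\<Sum>k\<in>A. \<Sum>l\<in>L. X k * Y l * Z (l + k) * G l)"
      using L by (intro sum_mono sum_mono2) (auto simp: L_def image_iff intro!: bexI)
    also have "\<dots> = (\<Sum>l\<in>L. (Y l * G l) * (\<Sum>k\<in>A. X k * Z (l + k)))"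
      by (subst sum.swap) (simp add: sum_distrib_left mult_ac)
    also have "\<dots> \<le> d * (b * (a * c))"
      using assms nn L by (intro outer l2_bounded_sum_mult) auto
    finally show ?thesis .
  qed
  have 3: "(\<Sum>k\<in>A. \<Sum>m\<in>B. X k * Y (m - k) * Z m * G m) \<le> d * (c * (a * b))"
  proof -
    have "(\<Sum>k\<in>A. \<Sum>m\<in>B. X k * Y (m - k) * Z m * G m)
      = (\<Sum>m\<in>B. (Z m * G m) * (\<Sum>k\<in>A. X k * Y (m - k)))"
      by (subst sum.swap) (simp add: sum_distrib_left mult_ac)
    also have "\<dots> \<le> d * (c * (a * b))"
      using assms nn by (intro outer l2_bounded_sum_mult) auto
    finally show ?thesis .
  qed
  show ?thesis
    using 1 2 3 by (simp add: distrib_left sum.distrib mult_ac)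
qed

lemma l2_bounded_weighted:
  assumes "x \<in> sob \<sigma>"
  shows "l2_bounded (\<lambda>k. jw k powr (\<sigma> / 2) * norm (x k)) (sobn \<sigma> x)"
  unfolding l2_bounded_def
proof (intro conjI allI impI)
  fix F :: "(int^3) set" assume "finite F"
  have "sqrt (jw k powr \<sigma>) = jw k powr (\<sigma> / 2)" for k
    by (simp add: powr_half_sqrt_powr less_imp_le)
  then show "L2_set (\<lambda>k. jw k powr (\<sigma> / 2) * norm (x k)) F \<le> sobn \<sigma> x"
    using L2_set_le_wnorm[OF _ assms \<open>finite F\<close>] by simp
qed simp

text \<open>Let n be the smallest base. Its power with the total exponent is at most the product in
  front, and its negative power is one of the three summands.\<close>

lemma one_le_three_weights:
  fixes p q t :: real
  assumes "p \<ge> 1" "q \<ge> 1" "t \<ge> 1" "\<alpha> \<ge> 0" "\<beta> \<ge> 0" "\<gamma> \<ge> 0"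
  shows "1 \<le> p powr \<alpha> * q powr \<beta> * t powr \<gamma> *
    (p powr - (\<alpha> + \<beta> + \<gamma>) + q powr - (\<alpha> + \<beta> + \<gamma>) + t powr - (\<alpha> + \<beta> + \<gamma>))"
proof -
  define n where "n = min p (min q t)"
  let ?s = "\<alpha> + \<beta> + \<gamma>"
  have n: "n \<ge> 1" "n \<le> p" "n \<le> q" "n \<le> t" using assms by (auto simp: n_def)
  have "n powr ?s = n powr \<alpha> * n powr \<beta> * n powr \<gamma>" by (simp add: powr_add)
  also have "\<dots> \<le> p powr \<alpha> * q powr \<beta> * t powr \<gamma>"
    using n assms by (intro mult_mono powr_mono2) auto
  finally have a: "n powr ?s \<le> p powr \<alpha> * q powr \<beta> * t powr \<gamma>" .
  have b: "n powr - ?s \<le> p powr - ?s + q powr - ?s + t powr - ?s"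
    unfolding n_def min_def by auto
  have "1 = n powr ?s * n powr - ?s" using n by (simp flip: powr_add)
  also have "\<dots> \<le> (p powr \<alpha> * q powr \<beta> * t powr \<gamma>) * (p powr - ?s + q powr - ?s + t powr - ?s)"
    using a b by (intro mult_mono) auto
  finally show ?thesis .
qed

text \<open>The three Sobolev weights are inserted at the price of the sum of three values of
  \<open>G\<close>. The exponent of \<open>G\<close> is half the total regularity, so
  \<open>G\<close> is square summable because the total exceeds 3/2.\<close>

lemma sobolev_triple_product:
  assumes "\<sigma>1 \<ge> 0" "\<sigma>2 \<ge> 0" "\<sigma>3 \<ge> 0" "\<sigma>1 + \<sigma>2 + \<sigma>3 > 3/2"
  obtains C where "C \<ge> 0"
    "\<And>(x :: int^3 \<Rightarrow> 'a::real_normed_vector) (y :: int^3 \<Rightarrow> 'b::real_normed_vector)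
       (z :: int^3 \<Rightarrow> 'c::real_normed_vector) A B.
       x \<in> sob \<sigma>1 \<Longrightarrow> y \<in> sob \<sigma>2 \<Longrightarrow> z \<in> sob \<sigma>3 \<Longrightarrow> finite A \<Longrightarrow> finite B \<Longrightarrow>
       (\<Sum>k\<in>A. \<Sum>m\<in>B. norm (x k) * norm (y (m - k)) * norm (z m))
         \<le> C * (sobn \<sigma>1 x * sobn \<sigma>2 y * sobn \<sigma>3 z)"
proof -
  define \<sigma> where "\<sigma> = \<sigma>1/2 + \<sigma>2/2 + \<sigma>3/2"
  define G :: "int^3 \<Rightarrow> real" where "G = (\<lambda>k. jw k powr - \<sigma>)"
  have "(\<lambda>k. G k) \<in> sob 0"
  proof -
    have "jw k powr 0 * (norm (G k))\<^sup>2 = jw k powr - (2 * \<sigma>)" for k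
      by (simp add: G_def power2_eq_square flip: powr_add)
    then show ?thesis
      using summable_on_jw_powr[of "2 * \<sigma>"] assms by (simp add: wsp_def \<sigma>_def)
  qed
  from l2_bounded_weighted[OF this] have G: "l2_bounded G (sobn 0 G)" by (simp add: G_def)
  show thesis
  proof (rule that[of "3 * sobn 0 G"])
    fix x :: "int^3 \<Rightarrow> 'a" and y :: "int^3 \<Rightarrow> 'b" and z :: "int^3 \<Rightarrow> 'c" and A B :: "(int^3) set"
    assume *: "x \<in> sob \<sigma>1" "y \<in> sob \<sigma>2" "z \<in> sob \<sigma>3" "finite A" "finite B"
    let ?W = "\<lambda>\<sigma> x (k :: int^3). jw k powr (\<sigma> / 2) * norm (x k)"
    have "norm (x k) * norm (y (m - k)) * norm (z m)
       \<le> ?W \<sigma>1 x k * ?W \<sigma>2 y (m - k) * ?W \<sigma>3 z m * (G k + G (m - k) + G m)" for k m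
    proof -
      have "norm (x k) * norm (y (m - k)) * norm (z m) * 1 \<le> norm (x k) * norm (y (m - k)) * norm (z m) *
        (jw k powr (\<sigma>1/2) * jw (m - k) powr (\<sigma>2/2) * jw m powr (\<sigma>3/2) * (G k + G (m - k) + G m))"
        unfolding G_def \<sigma>_def
        by (intro mult_left_mono one_le_three_weights) (use assms jw_ge1 in auto)
      then show ?thesis by (simp add: mult_ac)
    qed
    then have "(\<Sum>k\<in>A. \<Sum>m\<in>B. norm (x k) * norm (y (m - k)) * norm (z m))
      \<le> (\<Sum>k\<in>A. \<Sum>m\<in>B. ?W \<sigma>1 x k * ?W \<sigma>2 y (m - k) * ?W \<sigma>3 z m * (G k + G (m - k) + G m))"
      by (intro sum_mono) auto
    also have "\<dots> \<le> 3 * sobn 0 G * (sobn \<sigma>1 x * sobn \<sigma>2 y * sobn \<sigma>3 z)"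
      using * by (intro l2_bounded_triple l2_bounded_weighted G)
    finally show "(\<Sum>k\<in>A. \<Sum>m\<in>B. norm (x k) * norm (y (m - k)) * norm (z m))
      \<le> 3 * sobn 0 G * (sobn \<sigma>1 x * sobn \<sigma>2 y * sobn \<sigma>3 z)" .
  qed simp
qed

section \<open>The trilinear form: bound, linearity and antisymmetry\<close>

definition cdot :: "complex^3 \<Rightarrow> int^3 \<Rightarrow> complex" where
  "cdot z k = (\<Sum>j\<in>UNIV. z $ j * of_int (k $ j))"

definition solenoidal :: "(int^3 \<Rightarrow> complex^3) \<Rightarrow> bool" where
  "solenoidal a \<longleftrightarrow> (\<forall>k. cdot (a k) k = 0)"

definition real_coeffs :: "(int^3 \<Rightarrow> complex^3) \<Rightarrow> bool" where
  "real_coeffs a \<longleftrightarrow> (\<forall>k j. a (- k) $ j = cnj (a k $ j))"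

text \<open>The contribution of \<open>a\<^sub>k\<close> to the \<open>m\<close>-th Fourier coefficient of \<open>(a \<cdot> \<nabla>)b\<close>.\<close>

definition advect :: "(int^3 \<Rightarrow> complex^3) \<Rightarrow> (int^3 \<Rightarrow> complex^3) \<Rightarrow> int^3 \<Rightarrow> int^3 \<Rightarrow> complex^3" where
  "advect a b m k = (2 * of_real pi * \<i> * cdot (a k) (m - k)) *s b (m - k)"

definition bterm :: "(int^3 \<Rightarrow> complex^3) \<Rightarrow> (int^3 \<Rightarrow> complex^3) \<Rightarrow> (int^3 \<Rightarrow> complex^3) \<Rightarrow>
    (int^3) \<times> (int^3) \<Rightarrow> real" where
  "bterm a b c = (\<lambda>(k, m). advect a b m k \<bullet> c m)"

definition bform :: "(int^3 \<Rightarrow> complex^3) \<Rightarrow> (int^3 \<Rightarrow> complex^3) \<Rightarrow> (int^3 \<Rightarrow> complex^3) \<Rightarrow> real" where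
  "bform a b c = infsum (bterm a b c) UNIV"

lemma norm_smult_complex: "norm (c *s (x :: complex^'n)) = norm c * norm x"
  by (simp add: norm_vec_def norm_mult L2_set_right_distrib)

lemma norm_cdot_le: "norm (cdot z k) \<le> norm z * norm (ivec k)"
proof -
  have "norm (cdot z k) \<le> (\<Sum>j\<in>UNIV. norm (z $ j) * norm (ivec k $ j))"
    unfolding cdot_def by (intro sum_norm_le) (simp add: norm_mult)
  also have "\<dots> \<le> norm z * norm (ivec k)"
    unfolding norm_vec_def using L2_set_mult_ineq[of "\<lambda>j. norm (z $ j)" "\<lambda>j. norm (ivec k $ j)" UNIV] by simp
  finally show ?thesis .
qed

lemma cdot_diff: "cdot z (k - l) = cdot z k - cdot z l"
  by (simp add: cdot_def ring_distribs sum_subtractf)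

lemma cdot_diff_left: "cdot (y - z) k = cdot y k - cdot z k"
  by (simp add: cdot_def ring_distribs sum_subtractf)

lemma two_pi_norm_le: "2 * pi * norm (ivec k) \<le> jw k powr (1/2)"
proof -
  have "jw k powr (1/2) = sqrt (jw k)" by (simp add: powr_half_sqrt less_imp_le)
  then show ?thesis by (simp add: jw_def real_le_rsqrt)
qed

text \<open>For divergence-free \<open>a\<close> the derivative can be shared between \<open>b\<close> and \<open>c\<close>, as
  \<open>a\<^sub>k \<cdot> (m - k) = a\<^sub>k \<cdot> m\<close>; this is what makes \<open>r > 5/6\<close> sufficient.\<close>

lemma norm_bterm_le:
  assumes "solenoidal a"
  shows "norm (bterm a b c (k, m))
    \<le> norm (a k) * norm (jw (m - k) powr (1/4) *\<^sub>R b (m - k)) * norm (jw m powr (1/4) *\<^sub>R c m)"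
proof -
  let ?d = "2 * pi * norm (cdot (a k) (m - k))"
  have e: "cdot (a k) (m - k) = cdot (a k) m" using assms by (simp add: cdot_diff solenoidal_def)
  have D: "2 * pi * norm (cdot (a k) l) \<le> norm (a k) * jw l powr (1/2)" for l
  proof -
    have "2 * pi * norm (cdot (a k) l) \<le> norm (a k) * (2 * pi * norm (ivec l))"
      using mult_left_mono[OF norm_cdot_le[of "a k" l], of "2 * pi"] by (simp add: mult_ac)
    also have "\<dots> \<le> norm (a k) * jw l powr (1/2)"
      by (intro mult_left_mono two_pi_norm_le) simp
    finally show ?thesis .
  qed
  have 1: "?d \<le> norm (a k) * jw (m - k) powr (1/2)"
    by (rule D)
  have 2: "?d \<le> norm (a k) * jw m powr (1/2)"
    unfolding e by (rule D)
  \<comment> \<open>The geometric mean of the two bounds: b and c receive half a derivative each,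
    which is the power 1/4 of \<open>jw\<close>.\<close>
  have "?d\<^sup>2 \<le> (norm (a k) * jw (m - k) powr (1/2)) * (norm (a k) * jw m powr (1/2))"
    unfolding power2_eq_square by (rule mult_mono[OF 1 2]) auto
  also have "\<dots> = (norm (a k) * jw (m - k) powr (1/4) * jw m powr (1/4))\<^sup>2"
    by (simp add: power2_eq_square mult_ac flip: powr_add)
  finally have d: "?d \<le> norm (a k) * jw (m - k) powr (1/4) * jw m powr (1/4)"
    by (rule power2_le_imp_le) auto
  have "norm (bterm a b c (k, m)) \<le> norm (advect a b m k) * norm (c m)"
    by (simp add: bterm_def Cauchy_Schwarz_ineq2)
  also have "\<dots> = ?d * (norm (b (m - k)) * norm (c m))"
    by (simp add: advect_def norm_smult_complex norm_mult)
  also have "\<dots> \<le> (norm (a k) * jw (m - k) powr (1/4) * jw m powr (1/4)) * (norm (b (m - k)) * norm (c m))"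
    by (intro mult_right_mono d) auto
  finally show ?thesis by (simp add: mult_ac)
qed

lemma sob_shift:
  fixes b :: "int^3 \<Rightarrow> 'a::real_normed_vector"
  shows "(\<lambda>k. jw k powr p *\<^sub>R b k) \<in> sob \<sigma> \<longleftrightarrow> b \<in> sob (\<sigma> + 2 * p)"
    and "sobn \<sigma> (\<lambda>k. jw k powr p *\<^sub>R b k) = sobn (\<sigma> + 2 * p) b"
proof -
  have "jw k powr \<sigma> * (norm (jw k powr p *\<^sub>R b k))\<^sup>2 = jw k powr (\<sigma> + 2 * p) * (norm (b k))\<^sup>2" for k
  proof -
    have "(jw k powr p)\<^sup>2 = jw k powr (2 * p)" by (simp add: power2_eq_square flip: powr_add)
    then show ?thesis by (simp add: power_mult_distrib powr_add)
  qed
  note wnorm_scale_weight[of "\<lambda>k. jw k powr \<sigma>", OF this]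
  then show "(\<lambda>k. jw k powr p *\<^sub>R b k) \<in> sob \<sigma> \<longleftrightarrow> b \<in> sob (\<sigma> + 2 * p)"
    "sobn \<sigma> (\<lambda>k. jw k powr p *\<^sub>R b k) = sobn (\<sigma> + 2 * p) b" by blast+
qed

abbreviation bsummable :: "(int^3 \<Rightarrow> complex^3) \<Rightarrow> (int^3 \<Rightarrow> complex^3) \<Rightarrow> (int^3 \<Rightarrow> complex^3) \<Rightarrow> bool" where
  "bsummable a b c \<equiv> (\<lambda>p. norm (bterm a b c p)) summable_on UNIV"

text \<open>Half a derivative falls on each of b and c and leaves the regularities t2 - 1/2 and t3 -
  1/2 for the triple product. This explains the thresholds 1/2 and the total 3/2 + 1. With three
  equal exponents r the condition reads r > 5/6.\<close>

theorem bform_bound: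
  assumes "t1 \<ge> 0" "t2 \<ge> 1/2" "t3 \<ge> 1/2" "t1 + t2 + t3 > 5/2"
  obtains C where "C \<ge> 0"
    "\<And>a b c. solenoidal a \<Longrightarrow> a \<in> sob t1 \<Longrightarrow> b \<in> sob t2 \<Longrightarrow> c \<in> sob t3 \<Longrightarrow>
       bsummable a b c \<and> \<bar>bform a b c\<bar> \<le> C * (sobn t1 a * sobn t2 b * sobn t3 c)"
proof -
  obtain C where C: "C \<ge> 0"
    "\<And>(x :: int^3 \<Rightarrow> complex^3) (y :: int^3 \<Rightarrow> complex^3) (z :: int^3 \<Rightarrow> complex^3) A B.
       x \<in> sob t1 \<Longrightarrow> y \<in> sob (t2 - 1/2) \<Longrightarrow> z \<in> sob (t3 - 1/2) \<Longrightarrow> finite A \<Longrightarrow> finite B \<Longrightarrow>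
       (\<Sum>k\<in>A. \<Sum>m\<in>B. norm (x k) * norm (y (m - k)) * norm (z m))
         \<le> C * (sobn t1 x * sobn (t2 - 1/2) y * sobn (t3 - 1/2) z)"
    using sobolev_triple_product[of t1 "t2 - 1/2" "t3 - 1/2",
      where 'a="complex^3" and 'b="complex^3" and 'c="complex^3"] assms by auto
  show thesis
  proof (rule that[OF C(1)])
    fix a b c :: "int^3 \<Rightarrow> complex^3"
    assume *: "solenoidal a" "a \<in> sob t1" "b \<in> sob t2" "c \<in> sob t3"
    let ?B = "C * (sobn t1 a * sobn t2 b * sobn t3 c)"
    have fin: "(\<Sum>p\<in>F. norm (bterm a b c p)) \<le> ?B" if "finite F" for F
    proof -
      have "(\<Sum>p\<in>F. norm (bterm a b c p)) \<le> (\<Sum>p\<in>fst ` F \<times> snd ` F. norm (bterm a b c p))"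
        using that by (intro sum_mono2) force+
      also have "\<dots> = (\<Sum>k\<in>fst ` F. \<Sum>m\<in>snd ` F. norm (bterm a b c (k, m)))"
        by (simp add: sum.cartesian_product)
      also have "\<dots> \<le> (\<Sum>k\<in>fst ` F. \<Sum>m\<in>snd ` F. norm (a k) *
          norm (jw (m - k) powr (1/4) *\<^sub>R b (m - k)) * norm (jw m powr (1/4) *\<^sub>R c m))"
        by (intro sum_mono norm_bterm_le *)
      also have "\<dots> \<le> C * (sobn t1 a * sobn (t2 - 1/2) (\<lambda>k. jw k powr (1/4) *\<^sub>R b k)
         * sobn (t3 - 1/2) (\<lambda>k. jw k powr (1/4) *\<^sub>R c k))"
        by (rule C(2)) (use that * in \<open>simp_all add: sob_shift\<close>)
      also have "\<dots> = ?B" by (simp add: sob_shift)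
      finally show ?thesis .
    qed
    have s: "bsummable a b c"
      by (rule nonneg_bdd_above_summable_on) (use fin in \<open>auto simp: bdd_above_def\<close>)
    have "\<bar>bform a b c\<bar> \<le> (\<Sum>\<^sub>\<infinity>p. norm (bterm a b c p))"
      unfolding bform_def using norm_infsum_bound[OF s] by simp
    also have "\<dots> \<le> ?B" using s by (intro infsum_le_finite_sums fin) auto
    finally show "bsummable a b c \<and> \<bar>bform a b c\<bar> \<le> ?B" using s by blast
  qed
qed

lemma bsummable_sob:
  assumes r: "5/6 < r" and "solenoidal a" "a \<in> sob r" "b \<in> sob r" "c \<in> sob r"
  shows "bsummable a b c"
proof (rule bform_bound[of r r r])
  fix C
  assume "\<And>a b c. solenoidal a \<Longrightarrow> a \<in> sob r \<Longrightarrow> b \<in> sob r \<Longrightarrow> c \<in> sob r \<Longrightarrow>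
       bsummable a b c \<and> \<bar>bform a b c\<bar> \<le> C * (sobn r a * sobn r b * sobn r c)"
  then show ?thesis using assms by blast
qed (use r in auto)

lemma bsummableD: "bsummable a b c \<Longrightarrow> bterm a b c summable_on UNIV"
  by (rule abs_summable_summable)

lemma infsum_diff_real:
  fixes f g :: "'i \<Rightarrow> real"
  assumes "f summable_on A" "g summable_on A"
  shows "(\<Sum>\<^sub>\<infinity>x\<in>A. f x - g x) = infsum f A - infsum g A"
proof -
  have "((\<lambda>x. f x + - g x) has_sum (infsum f A + - infsum g A)) A"
    using assms by (intro has_sum_add has_sum_uminusI) auto
  then show ?thesis by (simp add: has_sum_iff)
qed

lemma bform_diff1:
  assumes "bsummable a b c" "bsummable a' b c"
  shows "bform (\<lambda>k. a k - a' k) b c = bform a b c - bform a' b c"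
proof -
  have "bterm (\<lambda>k. a k - a' k) b c = (\<lambda>p. bterm a b c p - bterm a' b c p)"
    by (auto simp: bterm_def advect_def cdot_diff_left ring_distribs inner_diff_left fun_eq_iff
        vector_sub_rdistrib)
  then show ?thesis unfolding bform_def
    using infsum_diff_real[OF bsummableD[OF assms(1)] bsummableD[OF assms(2)]] by simp
qed

lemma bform_diff2:
  assumes "bsummable a b c" "bsummable a b' c"
  shows "bform a (\<lambda>k. b k - b' k) c = bform a b c - bform a b' c"
proof -
  have "bterm a (\<lambda>k. b k - b' k) c = (\<lambda>p. bterm a b c p - bterm a b' c p)"
    by (auto simp: bterm_def advect_def inner_diff_left fun_eq_iff vector_ssub_ldistrib)
  then show ?thesis unfolding bform_def
    using infsum_diff_real[OF bsummableD[OF assms(1)] bsummableD[OF assms(2)]] by simp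
qed

lemma bform_diff3:
  assumes "bsummable a b c" "bsummable a b c'"
  shows "bform a b (\<lambda>k. c k - c' k) = bform a b c - bform a b c'"
proof -
  have "bterm a b (\<lambda>k. c k - c' k) = (\<lambda>p. bterm a b c p - bterm a b c' p)"
    by (auto simp: bterm_def inner_diff_right fun_eq_iff)
  then show ?thesis unfolding bform_def
    using infsum_diff_real[OF bsummableD[OF assms(1)] bsummableD[OF assms(2)]] by simp
qed

lemma inner_smult_complex: "(z *s x) \<bullet> y = Re (z * (\<Sum>j\<in>UNIV. x $ j * cnj (y $ j)))"
  for x y :: "complex^'n"
proof -
  have "(z *s x) \<bullet> y = (\<Sum>j\<in>UNIV. Re (z * (x $ j * cnj (y $ j))))"
    by (simp add: inner_vec_def inner_complex_def algebra_simps)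
  then show ?thesis by (simp add: sum_distrib_left)
qed

text \<open>Exchanging b and c corresponds to the frequency change from (k, m) to (-k, m - k).
  Reality conjugates the coefficient of a, solenoidality replaces m - k by m in \<open>cdot\<close>,
  and the factor i changes sign under conjugation.\<close>

lemma bterm_swap:
  assumes "solenoidal a" "real_coeffs a"
  shows "bterm a c b (- k, m - k) = - bterm a b c (k, m)"
proof -
  define D where "D = cdot (a k) m"
  define H where "H = (\<Sum>j\<in>UNIV. c m $ j * cnj (b (m - k) $ j))"
  have H: "(\<Sum>j\<in>UNIV. b (m - k) $ j * cnj (c m $ j)) = cnj H"
    by (simp add: H_def mult.commute)
  have D: "cdot (a (- k)) m = cnj D"
    using assms(2) by (simp add: D_def cdot_def real_coeffs_def)
  have D': "cdot (a k) (m - k) = D" using assms(1) by (simp add: D_def cdot_diff solenoidal_def)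
  have "bterm a c b (- k, m - k) = Re (2 * of_real pi * \<i> * cnj D * H)"
    by (simp add: bterm_def advect_def inner_smult_complex D H_def)
  also have "\<dots> = Re (cnj (2 * of_real pi * \<i> * cnj D * H))" by (rule cnj.sel(1)[symmetric])
  also have "\<dots> = - Re (2 * of_real pi * \<i> * D * cnj H)" by simp
  also have "\<dots> = - bterm a b c (k, m)"
    unfolding bterm_def advect_def prod.case inner_smult_complex D' H by (rule refl)
  finally show ?thesis .
qed

text \<open>The frequency change is an involution of the index set, so it permutes the terms of the
  sum up to their sign.\<close>

theorem bform_antisym:
  assumes "solenoidal a" "real_coeffs a"
  shows "bform a c b = - bform a b c"
proof -
  have bij: "bij_betw (\<lambda>(k, m). (- k, m - k)) UNIV (UNIV :: ((int^3) \<times> (int^3)) set)"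
    by (rule bij_betwI[where g = "\<lambda>(k, m). (- k, m - k)"]) auto
  have "bform a c b = (\<Sum>\<^sub>\<infinity>p. bterm a c b (case p of (k, m) \<Rightarrow> (- k, m - k)))"
    unfolding bform_def by (rule infsum_reindex_bij_betw[OF bij, symmetric])
  also have "\<dots> = (\<Sum>\<^sub>\<infinity>p. - bterm a b c p)"
    by (intro infsum_cong) (auto simp: bterm_swap[OF assms])
  finally show ?thesis by (simp add: bform_def infsum_uminus)
qed

section \<open>Fourier series on the unit cube\<close>

text \<open>A measure of total mass one in place of set integrals: constants are integrable and can
  serve as dominating functions.\<close>

abbreviation cubeM :: "(real^3) measure" where
  "cubeM \<equiv> restrict_space lborel unit_cube"

lemma space_cubeM [simp]: "space cubeM = unit_cube"
  by (simp add: space_restrict_space)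

lemma set_integral_cube:
  fixes f :: "real^3 \<Rightarrow> 'b::{banach, second_countable_topology}"
  shows "(LINT x:unit_cube|lborel. f x) = (LINT x|cubeM. f x)"
  unfolding set_lebesgue_integral_def by (subst integral_restrict_space) auto

lemma set_integrable_cube:
  fixes f :: "real^3 \<Rightarrow> 'b::{banach, second_countable_topology}"
  shows "set_integrable lborel unit_cube f \<longleftrightarrow> integrable cubeM f"
  unfolding set_integrable_def by (subst integrable_restrict_space) auto

lemma emeasure_cube: "emeasure lborel unit_cube = 1"
proof -
  have "(\<chi> i. 1) \<bullet> b = 1" if "b \<in> Basis" for b :: "real^3"
    using that by (auto simp: Basis_vec_def inner_axis)
  then show ?thesis by (simp add: emeasure_lborel_cbox_eq)
qed

lemma finite_cubeM: "finite_measure cubeM"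
  by (rule finite_measureI) (simp add: emeasure_restrict_space emeasure_cube)

interpretation cubeM: finite_measure cubeM
  by (rule finite_cubeM)

lemma measure_cubeM [simp]: "measure cubeM unit_cube = 1"
  by (simp add: measure_def emeasure_restrict_space emeasure_cube)

lemma continuous_integrable_cubeM:
  fixes f :: "real^3 \<Rightarrow> 'b::{banach, second_countable_topology}"
  assumes "continuous_on unit_cube f"
  shows "integrable cubeM f"
  unfolding set_integrable_cube[symmetric] set_integrable_def
  by (rule borel_integrable_compact) (use assms in auto)

lemma continuous_measurable_cubeM:
  fixes f :: "real^3 \<Rightarrow> 'b::{banach, second_countable_topology}"
  assumes "continuous_on unit_cube f"
  shows "f \<in> borel_measurable cubeM"
  using continuous_integrable_cubeM[OF assms] by (rule borel_measurable_integrable)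

lemma AE_cubeM_iff: "(AE x in cubeM. P x) \<longleftrightarrow> (AE x in lborel. x \<in> unit_cube \<longrightarrow> P x)"
  by (rule AE_restrict_space_iff) simp

lemma AE_lborel_not_negligible:
  assumes "negligible S"
  shows "AE x in lborel. x \<notin> S"
  using AE_not_in[of S lebesgue] assms by (simp add: negligible_iff_null_sets AE_completion_iff)

section \<open>Translation invariance and integration by parts for periodic functions\<close>

lemma integral_lborel_translate:
  fixes f :: "real^3 \<Rightarrow> 'b::{banach, second_countable_topology}"
  assumes "f \<in> borel_measurable borel"
  shows "(LINT x|lborel. f (c + x)) = (LINT x|lborel. f x)"
  using integral_distr[of "(+) c" lborel borel f] assms by (simp add: lborel_distr_plus)

lemma mem_unit_cube: "x \<in> unit_cube \<longleftrightarrow> (\<forall>i. 0 \<le> x $ i \<and> x $ i \<le> 1)"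
  by (simp add: mem_box_cart)

text \<open>Polymorphic in the values, unlike \<open>periodic\<close>, because it is applied to
  complex-valued functions such as \<open>em k\<close>.\<close>

definition lattice_periodic :: "(real^3 \<Rightarrow> 'a) \<Rightarrow> bool" where
  "lattice_periodic f \<longleftrightarrow> (\<forall>k x. f (x + ivec k) = f x)"

lemma ivec_axis: "ivec (axis i 1) = axis i 1"
  by (simp add: vec_eq_iff axis_def)

text \<open>The shifted cube loses the slab \<open>A\<close> and gains the slab \<open>A'\<close>
  moved by one unit, which periodicity moves back. The two slabs differ only in hyperplanes of
  measure zero.\<close>

lemma cube_integral_shift:
  fixes f :: "real^3 \<Rightarrow> 'b::{banach, second_countable_topology}"
  assumes per: "lattice_periodic f" and cont: "continuous_on UNIV f" and h: "0 \<le> h" "h \<le> 1"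
  shows "(LINT x|cubeM. f (x + h *\<^sub>R axis i 1)) = (LINT x|cubeM. f x)"
proof -
  define e where "e = h *\<^sub>R axis i (1::real)"
  \<comment> \<open>The half-open inequalities make the identity \<open>ind\<close> between
    indicators exact at every point, faces included. In exchange \<open>A\<close> and
    \<open>A'\<close> differ where y_i = 0 or y_i = h.\<close>
  define A where "A = unit_cube \<inter> {y. y $ i < h}"
  define A' where "A' = unit_cube \<inter> {y. 0 < y $ i \<and> y $ i \<le> h}"
  have [measurable]: "f \<in> borel_measurable borel" using cont by (rule borel_measurable_continuous_onI)
  have mA [measurable]: "A \<in> sets borel" "A' \<in> sets borel"
    unfolding A_def A'_def by measurable
  have int: "integrable lborel (\<lambda>x. indicator S x *\<^sub>R f x)" if "S \<in> sets borel" "S \<subseteq> unit_cube" for S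
  proof -
    have "integrable lborel (\<lambda>x. indicator unit_cube x *\<^sub>R f x)"
      using cont by (intro borel_integrable_compact) (auto intro: continuous_on_subset)
    then show ?thesis
      by (rule Bochner_Integration.integrable_bound) (use that in \<open>auto simp: indicator_def\<close>)
  qed
  have im: "y \<in> (+) (axis i 1) ` unit_cube" if "y - axis i 1 \<in> A'" for y
    using that imageI[of "y - axis i 1" unit_cube "(+) (axis i 1)"] by (auto simp: A'_def)
  have int': "integrable lborel (\<lambda>x. indicator A' (x - axis i 1) *\<^sub>R f x)"
  proof -
    have "compact ((+) (axis i 1) ` unit_cube)" by (intro compact_translation compact_cbox)
    then have "integrable lborel (\<lambda>x. indicator ((+) (axis i 1) ` unit_cube) x *\<^sub>R f x)"
      using cont by (intro borel_integrable_compact) (auto intro: continuous_on_subset)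
    then show ?thesis
      by (rule Bochner_Integration.integrable_bound)
        (use im in \<open>auto simp: indicator_def\<close>)
  qed
  have ind: "indicator unit_cube (y - e) = (indicator unit_cube y - indicator A y + indicator A' (y - axis i 1) :: real)"
    for y
  proof -
    have o: "j \<noteq> i \<Longrightarrow> (y - e) $ j = y $ j" "j \<noteq> i \<Longrightarrow> (y - axis i 1) $ j = y $ j" for j
      by (auto simp: e_def axis_def)
    have i: "(y - e) $ i = y $ i - h" "(y - axis i 1) $ i = y $ i - 1" by (auto simp: e_def)
    have c: "z \<in> unit_cube \<longleftrightarrow> (0 \<le> z $ i \<and> z $ i \<le> 1) \<and> (\<forall>j. j \<noteq> i \<longrightarrow> 0 \<le> z $ j \<and> z $ j \<le> 1)" for z :: "real^3"
      unfolding mem_unit_cube by metis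
    show ?thesis
      unfolding indicator_def A_def A'_def Int_iff mem_Collect_eq c i using o h by auto
  qed
  have "(LINT x|cubeM. f (x + e)) = (LINT x|lborel. indicator unit_cube ((e + x) - e) *\<^sub>R f (e + x))"
    unfolding set_integral_cube[symmetric] set_lebesgue_integral_def by (simp add: add.commute)
  also have "\<dots> = (LINT y|lborel. indicator unit_cube (y - e) *\<^sub>R f y)"
    by (rule integral_lborel_translate) measurable
  also have "\<dots> = (LINT y|lborel. indicator unit_cube y *\<^sub>R f y - indicator A y *\<^sub>R f y
     + indicator A' (y - axis i 1) *\<^sub>R f y)"
    unfolding ind by (simp add: algebra_simps)
  also have "\<dots> = (LINT y|lborel. indicator unit_cube y *\<^sub>R f y) - (LINT y|lborel. indicator A y *\<^sub>R f y)
     + (LINT y|lborel. indicator A' (y - axis i 1) *\<^sub>R f y)"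
  proof -
    have iA: "integrable lborel (\<lambda>y. indicator A y *\<^sub>R f y)" by (rule int) (auto simp: A_def)
    have iC: "integrable lborel (\<lambda>y. indicator unit_cube y *\<^sub>R f y)" by (rule int) auto
    show ?thesis
      unfolding Bochner_Integration.integral_add[OF Bochner_Integration.integrable_diff[OF iC iA] int']
        Bochner_Integration.integral_diff[OF iC iA] ..
  qed
  also have "(LINT y|lborel. indicator A' (y - axis i 1) *\<^sub>R f y)
    = (LINT y|lborel. indicator A' ((axis i 1 + y) - axis i 1) *\<^sub>R f (axis i 1 + y))"
    by (rule integral_lborel_translate[symmetric]) measurable
  also have "\<dots> = (LINT y|lborel. indicator A' y *\<^sub>R f y)"
    using per unfolding lattice_periodic_def by (simp add: add.commute flip: ivec_axis)
  also have "\<dots> = (LINT y|lborel. indicator A y *\<^sub>R f y)"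
  proof (rule integral_cong_AE)
    have "negligible {y :: real^3. y $ i = c}" for c
    proof -
      have "axis i 1 \<in> (Basis :: (real^3) set)" by (simp add: axis_in_Basis_iff)
      from negligible_standard_hyperplane[OF this, of c] show ?thesis by (simp add: inner_axis)
    qed
    from AE_lborel_not_negligible[OF this[of 0]] AE_lborel_not_negligible[OF this[of h]]
    show "AE y in lborel. indicator A' y *\<^sub>R f y = indicator A y *\<^sub>R f y"
    proof eventually_elim
      case (elim y)
      have "y \<in> unit_cube \<Longrightarrow> 0 \<le> y $ i" by (auto simp: mem_unit_cube)
      then have "y \<in> A' \<longleftrightarrow> y \<in> A"
        using elim unfolding A_def A'_def Int_iff mem_Collect_eq by linarith
      then show ?case by (simp add: indicator_def)
    qed
  qed measurable
  finally show ?thesis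
    unfolding e_def set_integral_cube[symmetric] set_lebesgue_integral_def by simp
qed

text \<open>By shift invariance every difference quotient has integral zero. The quotients converge
  to \<open>D\<close> and are bounded through the mean value inequality, so dominated convergence
  applies.\<close>

lemma cube_integral_partial_derivative:
  fixes f :: "real^3 \<Rightarrow> 'b::euclidean_space"
  assumes per: "lattice_periodic f" and cont: "continuous_on UNIV f" "continuous_on UNIV D"
    and der: "\<And>x. ((\<lambda>t. f (x + t *\<^sub>R axis i 1)) has_vector_derivative D x) (at 0)"
  shows "(LINT x|cubeM. D x) = 0"
proof -
  let ?e = "axis i 1 :: real^3"
  have der': "((\<lambda>s. f (x + s *\<^sub>R ?e)) has_vector_derivative D (x + t *\<^sub>R ?e)) (at t)" for x t
  proof -
    have "((\<lambda>s. s - t) has_vector_derivative 1) (at t)"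
      by (auto intro!: derivative_eq_intros)
    from vector_diff_chain_at[OF this, of "\<lambda>s. f (x + t *\<^sub>R ?e + s *\<^sub>R ?e)" "D (x + t *\<^sub>R ?e)"] der[of "x + t *\<^sub>R ?e"]
    show ?thesis by (simp add: o_def algebra_simps)
  qed
  define h where "h = (\<lambda>n. 1 / real (Suc n))"
  have h: "h n > 0" "h n \<le> 1" for n by (auto simp: h_def)
  have h0: "h \<longlonglongrightarrow> 0" unfolding h_def using LIMSEQ_Suc[OF lim_1_over_n] by simp
  define q where "q = (\<lambda>n x. (1 / h n) *\<^sub>R (f (x + h n *\<^sub>R ?e) - f x))"
  \<comment> \<open>Side 2 because the mean value inequality visits the points x + t e_i with x in
    the unit cube and t between 0 and 1.\<close>
  have comp: "compact (cbox 0 (\<chi> i. 2) :: (real^3) set)" by simp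
  obtain M where M: "norm (D x) \<le> M" if "x \<in> cbox 0 (\<chi> i. 2)" for x
    using compact_imp_bounded[OF compact_continuous_image[OF continuous_on_subset[OF cont(2)] comp]]
    by (auto simp: bounded_iff)
  have qb: "norm (q n x) \<le> M" if x: "x \<in> unit_cube" for n x
  proof -
    have mem: "x + t *\<^sub>R ?e \<in> cbox 0 (\<chi> i. 2)" if "t \<in> {0..h n}" for t
    proof -
      have "0 \<le> (x + t *\<^sub>R ?e) $ j \<and> (x + t *\<^sub>R ?e) $ j \<le> 2" for j
      proof -
        have "0 \<le> x $ j" "x $ j \<le> 1" "0 \<le> t" "t \<le> 1"
          using x that h[of n] by (auto simp: mem_unit_cube)
        then show ?thesis by (auto simp: axis_def)
      qed
      then show ?thesis by (simp add: mem_box_cart)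
    qed
    have "norm (f (x + h n *\<^sub>R ?e) - f (x + 0 *\<^sub>R ?e)) \<le> M * norm (h n - 0)"
    proof (rule differentiable_bound[of "{0..h n}" "\<lambda>s. f (x + s *\<^sub>R ?e)" "\<lambda>t d. d *\<^sub>R D (x + t *\<^sub>R ?e)"])
      fix t assume t: "t \<in> {0..h n}"
      show "((\<lambda>s. f (x + s *\<^sub>R ?e)) has_derivative (\<lambda>d. d *\<^sub>R D (x + t *\<^sub>R ?e))) (at t within {0..h n})"
        using der'[of x t] unfolding has_vector_derivative_def by (rule has_derivative_at_withinI)
      show "onorm (\<lambda>d. d *\<^sub>R D (x + t *\<^sub>R ?e)) \<le> M"
        using M[OF mem[OF t]] by (intro onorm_le) (simp add: mult.commute[of M] mult_left_mono)
    qed (use h[of n] in auto)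
    then show ?thesis using h[of n] unfolding q_def norm_scaleR by (simp add: divide_simps mult.commute)
  qed
  have "(\<lambda>n. LINT x|cubeM. q n x) \<longlonglongrightarrow> (LINT x|cubeM. D x)"
  proof (rule integral_dominated_convergence[where w="\<lambda>_. M"])
    show "AE x in cubeM. (\<lambda>n. q n x) \<longlonglongrightarrow> D x"
    proof (rule AE_I2)
      fix x
      have "((\<lambda>t. (1 / t) *\<^sub>R (f (x + t *\<^sub>R ?e) - f x)) \<longlongrightarrow> D x) (at 0)"
      proof (rule LIM_zero_cancel, rule tendsto_norm_zero_cancel, rule Lim_transform_eventually)
        show "((\<lambda>t. norm (f (x + t *\<^sub>R ?e) - f x - t *\<^sub>R D x) / norm t) \<longlongrightarrow> 0) (at 0)"
          using der[of x] unfolding has_vector_derivative_def has_derivative_iff_norm by simp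
        show "\<forall>\<^sub>F t in at 0. norm (f (x + t *\<^sub>R ?e) - f x - t *\<^sub>R D x) / norm t
          = norm ((1 / t) *\<^sub>R (f (x + t *\<^sub>R ?e) - f x) - D x)"
        proof (rule eventually_mono[OF eventually_neq_at_within[of 0 0 UNIV]])
          fix t :: real assume t: "t \<noteq> 0"
          have "(1 / t) *\<^sub>R (f (x + t *\<^sub>R ?e) - f x) - D x = (1 / t) *\<^sub>R (f (x + t *\<^sub>R ?e) - f x - t *\<^sub>R D x)"
            using t by (simp add: scaleR_diff_right)
          then show "norm (f (x + t *\<^sub>R ?e) - f x - t *\<^sub>R D x) / norm t
            = norm ((1 / t) *\<^sub>R (f (x + t *\<^sub>R ?e) - f x) - D x)" by simp
        qed
      qed
      moreover have "filterlim h (at 0) sequentially"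
        using h0 h by (auto simp: filterlim_at less_imp_neq[symmetric])
      ultimately show "(\<lambda>n. q n x) \<longlonglongrightarrow> D x"
        unfolding q_def by (rule filterlim_compose)
    qed
    show "D \<in> borel_measurable cubeM" by (intro continuous_measurable_cubeM continuous_on_subset[OF cont(2)]) simp
    show "q n \<in> borel_measurable cubeM" for n
      unfolding q_def by (intro continuous_measurable_cubeM continuous_intros continuous_on_compose2[OF cont(1)]) auto
  qed (auto intro!: AE_I2 qb)
  moreover have "(LINT x|cubeM. q n x) = 0" for n
  proof -
    have "(LINT x|cubeM. q n x) = (1 / h n) *\<^sub>R ((LINT x|cubeM. f (x + h n *\<^sub>R ?e)) - (LINT x|cubeM. f x))"
      unfolding q_def
      by (subst Bochner_Integration.integral_diff[symmetric])
         (auto intro!: continuous_integrable_cubeM continuous_intros continuous_on_compose2[OF cont(1)])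
    then show ?thesis using cube_integral_shift[OF per cont(1), of "h n" i] h[of n] by simp
  qed
  ultimately show ?thesis by (simp add: LIMSEQ_const_iff)
qed

section \<open>The exponentials and the complex inner product on the cube\<close>

definition em :: "int^3 \<Rightarrow> real^3 \<Rightarrow> complex" where
  "em k x = exp (2 * of_real pi * \<i> * of_real (ivec k \<bullet> x))"

lemma em_add: "em (k + l) x = em k x * em l x"
  by (simp add: em_def ivec_add inner_add_left ring_distribs exp_add)

lemma em_0 [simp]: "em 0 x = 1" by (simp add: em_def)

lemma em_eq_cis: "em k x = cis (2 * pi * (ivec k \<bullet> x))"
  by (simp add: em_def cis_conv_exp mult_ac)

lemma em_minus: "em (- k) x = cnj (em k x)"
  by (simp add: em_eq_cis cis_cnj)

lemma norm_em [simp]: "norm (em k x) = 1" by (simp add: em_eq_cis)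

lemma em_mult_cnj: "em k x * cnj (em l x) = em (k - l) x"
  using em_add[of k "- l" x] by (simp add: em_minus)

lemma em_mult_cnj_self [simp]: "em k x * cnj (em k x) = 1" "cnj (em k x) * em k x = 1"
  using em_mult_cnj[of k x k] by (simp_all add: mult.commute)

lemma continuous_em: "continuous_on S (em k)"
  unfolding em_def by (intro continuous_intros)

lemma em_periodic: "lattice_periodic (em k)"
  unfolding lattice_periodic_def
proof (intro allI)
  fix l x
  have "(ivec k \<bullet> ivec l) = of_int (\<Sum>i\<in>UNIV. k $ i * l $ i)"
    by (simp add: inner_vec_def)
  then have "cis (2 * pi * (ivec k \<bullet> ivec l)) = 1"
    using cis_multiple_2pi[of "of_int (\<Sum>i\<in>UNIV. k $ i * l $ i)"] by (simp only: Ints_of_int)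
  then show "em k (x + ivec l) = em k x"
    by (simp add: em_eq_cis inner_add_right ring_distribs flip: cis_mult)
qed

lemma em_deriv:
  "((\<lambda>t. em k (x + t *\<^sub>R axis i 1)) has_vector_derivative 2 * of_real pi * \<i> * of_int (k $ i) * em k x) (at 0)"
proof -
  have "em k (x + t *\<^sub>R axis i 1) = em k x * exp (t *\<^sub>R (2 * of_real pi * \<i> * of_int (k $ i)))" for t
    by (simp add: em_def inner_add_right inner_axis ring_distribs exp_add mult_ac scaleR_conv_of_real[of t "_ :: complex"])
  then show ?thesis
    by (auto intro!: derivative_eq_intros exp_scaleR_has_vector_derivative_right[THEN has_vector_derivative_eq_rhs]
      simp: mult_ac)
qed

text \<open>If a component of k is nonzero, \<open>em k\<close> is a multiple of its own derivative
  in that direction, which integrates to zero.\<close>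

lemma integral_em: "(LINT x|cubeM. em k x) = (if k = 0 then 1 else 0)"
proof (cases "k = 0")
  case False
  then obtain i where i: "k $ i \<noteq> 0" by (auto simp: vec_eq_iff)
  have "(LINT x|cubeM. 2 * of_real pi * \<i> * of_int (k $ i) * em k x) = 0"
    by (rule cube_integral_partial_derivative[OF em_periodic _ _ em_deriv])
       (auto intro!: continuous_intros continuous_em)
  then show ?thesis using False i by simp
qed simp

definition sq_integrable :: "(real^3 \<Rightarrow> complex) \<Rightarrow> bool" where
  "sq_integrable g \<longleftrightarrow> g \<in> borel_measurable cubeM \<and> integrable cubeM (\<lambda>x. (norm (g x))\<^sup>2)"

lemma sq_integrable_mult:
  assumes "sq_integrable f" "sq_integrable g"
  shows "integrable cubeM (\<lambda>x. f x * g x)" "integrable cubeM (\<lambda>x. f x * cnj (g x))"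
proof -
  note [measurable] = assms[unfolded sq_integrable_def, THEN conjunct1]
  have i: "integrable cubeM (\<lambda>x. (norm (f x))\<^sup>2 + (norm (g x))\<^sup>2)"
    using assms by (intro Bochner_Integration.integrable_add) (auto simp: sq_integrable_def)
  have "cmod (f x) * cmod (g x) \<le> (norm (f x))\<^sup>2 + (norm (g x))\<^sup>2" for x
    using sum_squares_bound[of "cmod (f x)" "cmod (g x)"]
      mult_nonneg_nonneg[OF norm_ge_zero[of "f x"] norm_ge_zero[of "g x"]] by linarith
  then have b: "norm (f x * g x) \<le> norm ((norm (f x))\<^sup>2 + (norm (g x))\<^sup>2)"
     "norm (f x * cnj (g x)) \<le> norm ((norm (f x))\<^sup>2 + (norm (g x))\<^sup>2)" for x
    by (simp_all add: norm_mult)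
  show "integrable cubeM (\<lambda>x. f x * g x)"
    by (rule Bochner_Integration.integrable_bound[OF i]) (use b in auto)
  have "(\<lambda>x. cnj (g x)) \<in> borel_measurable cubeM"
    using assms(2) by (auto simp: sq_integrable_def intro!: borel_measurable_continuous_on[OF continuous_on_cnj[OF continuous_on_id]])
  then have "(\<lambda>x. f x * cnj (g x)) \<in> borel_measurable cubeM"
    by measurable
  then show "integrable cubeM (\<lambda>x. f x * cnj (g x))"
    by (rule Bochner_Integration.integrable_bound[OF i]) (use b in auto)
qed

lemma sq_integrable_add:
  assumes "sq_integrable f" "sq_integrable g"
  shows "sq_integrable (\<lambda>x. f x + g x)"
proof -
  note [measurable] = assms[unfolded sq_integrable_def, THEN conjunct1]
  have i: "integrable cubeM (\<lambda>x. 2 * (norm (f x))\<^sup>2 + 2 * (norm (g x))\<^sup>2)"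
    using assms by (intro Bochner_Integration.integrable_add integrable_mult_right) (auto simp: sq_integrable_def)
  have "(norm (f x + g x))\<^sup>2 \<le> 2 * (norm (f x))\<^sup>2 + 2 * (norm (g x))\<^sup>2" for x
  proof -
    have "(norm (f x + g x))\<^sup>2 \<le> (norm (f x) + norm (g x))\<^sup>2"
      by (intro power_mono norm_triangle_ineq) auto
    then show ?thesis using sum_squares_bound[of "cmod (f x)" "cmod (g x)"] by (simp add: power2_sum)
  qed
  then have "integrable cubeM (\<lambda>x. (norm (f x + g x))\<^sup>2)"
    by (intro Bochner_Integration.integrable_bound[OF i]) auto
  then show ?thesis by (simp add: sq_integrable_def)
qed

lemma sq_integrable_cmult:
  assumes "sq_integrable f"
  shows "sq_integrable (\<lambda>x. c * f x)"
  using assms by (auto simp: sq_integrable_def norm_mult power_mult_distrib)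

lemma sq_integrable_uminus: "sq_integrable f \<Longrightarrow> sq_integrable (\<lambda>x. - f x)"
  using sq_integrable_cmult[of f "-1"] by simp

lemma sq_integrable_diff:
  assumes "sq_integrable f" "sq_integrable g"
  shows "sq_integrable (\<lambda>x. f x - g x)"
  using sq_integrable_add[OF assms(1) sq_integrable_uminus[OF assms(2)]] by simp

lemma sq_integrable_continuous:
  assumes "continuous_on unit_cube f"
  shows "sq_integrable f"
  unfolding sq_integrable_def
  by (intro conjI continuous_measurable_cubeM continuous_integrable_cubeM continuous_intros assms)

lemma sq_integrable_em_mult:
  assumes "sq_integrable f"
  shows "sq_integrable (\<lambda>x. f x * em k x)"
proof -
  note [measurable] = assms[unfolded sq_integrable_def, THEN conjunct1]
  have [measurable]: "em k \<in> borel_measurable cubeM" by (intro continuous_measurable_cubeM continuous_em)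
  show ?thesis using assms by (auto simp: sq_integrable_def norm_mult)
qed

lemma sq_integrable_em: "sq_integrable (em k)"
  by (intro sq_integrable_continuous continuous_em)

lemma sq_integrable_sum:
  assumes "\<And>k. k \<in> F \<Longrightarrow> sq_integrable (f k)"
  shows "sq_integrable (\<lambda>x. \<Sum>k\<in>F. f k x)"
  using assms
proof (induction F rule: infinite_finite_induct)
  case (insert k F)
  then show ?case by (simp add: sq_integrable_add)
qed (auto intro: sq_integrable_continuous)

text \<open>Conjugation in the second argument makes \<open>cip g (em k)\<close> the Fourier
  coefficient of g at k.\<close>

definition cip :: "(real^3 \<Rightarrow> complex) \<Rightarrow> (real^3 \<Rightarrow> complex) \<Rightarrow> complex" where
  "cip f g = (LINT x|cubeM. f x * cnj (g x))"

lemma cip_diff_left: "sq_integrable f \<Longrightarrow> sq_integrable g \<Longrightarrow> sq_integrable h \<Longrightarrow>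
    cip (\<lambda>x. f x - g x) h = cip f h - cip g h"
  unfolding cip_def ring_distribs by (intro Bochner_Integration.integral_diff sq_integrable_mult)

lemma cip_cnj: "cip f g = cnj (cip g f)"
  unfolding cip_def by (subst Bochner_Integration.integral_cnj[symmetric]) (simp add: mult.commute)

lemma cip_sum_left: "(\<And>k. k \<in> F \<Longrightarrow> sq_integrable (f k)) \<Longrightarrow> sq_integrable h \<Longrightarrow>
    cip (\<lambda>x. \<Sum>k\<in>F. c k * f k x) h = (\<Sum>k\<in>F. c k * cip (f k) h)"
  unfolding cip_def sum_distrib_right mult.assoc
  by (subst Bochner_Integration.integral_sum) (auto intro!: integrable_mult_right sq_integrable_mult)

lemma cip_self: "cip f f = of_real (LINT x|cubeM. (norm (f x))\<^sup>2)"
  unfolding cip_def complex_norm_square[symmetric] by (rule integral_complex_of_real)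

lemma cip_em: "cip (em k) (em l) = (if k = l then 1 else 0)"
  unfolding cip_def em_mult_cnj integral_em by simp

text \<open>Completing the square over an orthonormal system. If c consists of the coefficients of
  g, this contains Bessel's inequality; for general c the last sum is the excess over the best
  approximation.\<close>

lemma norm_diff_trig_sum:
  assumes g: "sq_integrable g" and F: "finite F"
  shows "(LINT x|cubeM. (norm (g x - (\<Sum>k\<in>F. c k * em k x)))\<^sup>2)
    = (LINT x|cubeM. (norm (g x))\<^sup>2) - (\<Sum>k\<in>F. (norm (cip g (em k)))\<^sup>2)
      + (\<Sum>k\<in>F. (norm (cip g (em k) - c k))\<^sup>2)"
proof -
  define p where "p = (\<lambda>x. \<Sum>k\<in>F. c k * em k x)"
  have p: "sq_integrable p" unfolding p_def by (intro sq_integrable_sum sq_integrable_cmult sq_integrable_em)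
  have pe: "cip p h = (\<Sum>k\<in>F. c k * cnj (cip h (em k)))" if "sq_integrable h" for h
    unfolding p_def by (subst cip_sum_left) (auto intro: that sq_integrable_em simp flip: cip_cnj)
  have pem: "cip p (em k) = c k" if "k \<in> F" for k
    unfolding p_def using F that
    by (subst cip_sum_left) (auto intro: sq_integrable_em simp: cip_em if_distrib cong: if_cong)
  have "cip (\<lambda>x. g x - p x) (\<lambda>x. g x - p x) = (cip g g - cnj (cip p g)) - (cip p g - cip p p)"
  proof -
    have "cip (\<lambda>x. g x - p x) (\<lambda>x. g x - p x) = cip g (\<lambda>x. g x - p x) - cip p (\<lambda>x. g x - p x)"
      using g p by (intro cip_diff_left sq_integrable_diff)
    moreover have "cip f (\<lambda>x. g x - p x) = cnj (cip g f) - cnj (cip p f)" if "sq_integrable f" for f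
      using g p that by (subst cip_cnj, subst cip_diff_left) auto
    ultimately show ?thesis using g p cip_cnj[of g g] cip_cnj[of p p] cip_cnj[of p g] by simp
  qed
  also have "\<dots> = cip g g - (\<Sum>k\<in>F. cnj (c k) * cip g (em k) + c k * cnj (cip g (em k)) - c k * cnj (c k))"
    using pe[OF g] pe[OF p] by (simp add: pem sum.distrib sum_subtractf)
  also have "\<dots> = cip g g - (\<Sum>k\<in>F. of_real ((norm (cip g (em k)))\<^sup>2 - (norm (cip g (em k) - c k))\<^sup>2))"
    by (intro arg_cong2[where f="(-)"] sum.cong refl)
       (simp only: of_real_diff complex_norm_square complex_cnj_diff, simp add: algebra_simps)
  also have "\<dots> = of_real ((LINT x|cubeM. (norm (g x))\<^sup>2) - (\<Sum>k\<in>F. (norm (cip g (em k)))\<^sup>2 - (norm (cip g (em k) - c k))\<^sup>2))"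
    by (simp add: cip_self)
  finally show ?thesis unfolding cip_self of_real_eq_iff by (simp add: p_def sum_subtractf)
qed

section \<open>Trigonometric polynomials\<close>

definition trig :: "(real^3 \<Rightarrow> complex) \<Rightarrow> bool" where
  "trig p \<longleftrightarrow> (\<exists>F c. finite F \<and> p = (\<lambda>x. \<Sum>k\<in>F. c k * em k x))"

lemma trig_em: "trig (\<lambda>x. c * em k x)"
  unfolding trig_def by (intro exI[of _ "{k}"] exI[of _ "\<lambda>_. c"]) simp

lemma trig_const: "trig (\<lambda>x. c)"
  using trig_em[of c 0] by simp

lemma trig_add:
  assumes "trig p" "trig q"
  shows "trig (\<lambda>x. p x + q x)"
proof -
  obtain F c G d where *: "finite F" "p = (\<lambda>x. \<Sum>k\<in>F. c k * em k x)" "finite G" "q = (\<lambda>x. \<Sum>k\<in>G. d k * em k x)"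
    using assms unfolding trig_def by blast
  have "p x = (\<Sum>k\<in>F \<union> G. (if k \<in> F then c k else 0) * em k x)"
    "q x = (\<Sum>k\<in>F \<union> G. (if k \<in> G then d k else 0) * em k x)" for x
    unfolding * using *(1,3) by (auto intro!: sum.mono_neutral_cong_left)
  then have e: "(\<lambda>x. p x + q x) = (\<lambda>x. \<Sum>k\<in>F \<union> G. ((if k \<in> F then c k else 0) + (if k \<in> G then d k else 0)) * em k x)"
    by (simp add: ring_distribs sum.distrib)
  show ?thesis unfolding trig_def
    by (rule exI, rule exI, rule conjI[rotated], rule e) (use *(1,3) in simp)
qed

lemma trig_sum: "(\<And>i. i \<in> I \<Longrightarrow> trig (p i)) \<Longrightarrow> trig (\<lambda>x. \<Sum>i\<in>I. p i x)"
  by (induction I rule: infinite_finite_induct) (auto intro: trig_add trig_const)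

lemma trig_mult:
  assumes "trig p" "trig q"
  shows "trig (\<lambda>x. p x * q x)"
proof -
  obtain F c G d where *: "finite F" "p = (\<lambda>x. \<Sum>k\<in>F. c k * em k x)" "finite G" "q = (\<lambda>x. \<Sum>k\<in>G. d k * em k x)"
    using assms unfolding trig_def by blast
  have e: "(\<lambda>x. p x * q x) = (\<lambda>x. \<Sum>k\<in>F. \<Sum>l\<in>G. (c k * d l) * em (k + l) x)"
    unfolding * by (simp add: sum_product em_add mult_ac)
  show ?thesis unfolding e by (intro trig_sum trig_em)
qed

text \<open>The embedding of the torus into complex 3-space. Polynomials in the real coordinates of
  its values are trigonometric polynomials, which makes Stone--Weierstrass applicable.\<close>

definition torus_map :: "real^3 \<Rightarrow> complex^3" where
  "torus_map x = (\<chi> j. em (axis j 1) x)"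

lemma continuous_torus_map: "continuous_on S torus_map"
  unfolding torus_map_def by (intro continuous_on_vec_lambda continuous_em)

lemma trig_real_polynomial:
  assumes "real_polynomial_function p"
  shows "trig (\<lambda>x. of_real (p (torus_map x)))"
  using assms
proof induction
  case (linear f)
  interpret f: bounded_linear f by fact
  \<comment> \<open>Euler's formulas: a linear functional is a combination of real and imaginary
    parts of coordinates, and each of these is a combination of \<open>em k\<close> and
    \<open>em (- k)\<close>.\<close>
  have re: "of_real (Re (em k x)) = (1/2) * em k x + (1/2) * em (- k) x" for k x
    using complex_add_cnj[of "em k x"] by (simp add: em_minus field_simps)
  have im: "of_real (Im (em k x)) = (- \<i>/2) * em k x + (\<i>/2) * em (- k) x" for k x
    using complex_diff_cnj[of "em k x"] by (simp add: em_minus field_simps complex_eq_iff)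
  have fz: "f z = (\<Sum>j\<in>UNIV. Re (z $ j) * f (axis j 1) + Im (z $ j) * f (axis j \<i>))" for z
  proof -
    have "z = (\<Sum>j\<in>UNIV. Re (z $ j) *\<^sub>R axis j 1 + Im (z $ j) *\<^sub>R axis j \<i>)"
      by (simp add: vec_eq_iff axis_def complex_eq_iff if_distrib sum.distrib cong: if_cong)
    then have "f z = f (\<Sum>j\<in>UNIV. Re (z $ j) *\<^sub>R axis j 1 + Im (z $ j) *\<^sub>R axis j \<i>)" by simp
    also have "\<dots> = (\<Sum>j\<in>UNIV. Re (z $ j) * f (axis j 1) + Im (z $ j) * f (axis j \<i>))"
      by (simp only: f.sum f.add f.scaleR real_scaleR_def)
    finally show ?thesis .
  qed
  have e: "(\<lambda>x. of_real (f (torus_map x))) = (\<lambda>x. \<Sum>j\<in>UNIV.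
      of_real (Re (em (axis j 1) x)) * of_real (f (axis j 1)) + of_real (Im (em (axis j 1) x)) * of_real (f (axis j \<i>)))"
    by (subst fz) (simp add: torus_map_def)
  show ?case
    unfolding e re im by (intro trig_sum trig_add trig_mult trig_const trig_em)
next
  case (const c)
  then show ?case by (rule trig_const)
qed (simp_all add: trig_add trig_mult)

lemma trig_polynomial:
  fixes P :: "complex^3 \<Rightarrow> complex"
  assumes "polynomial_function P"
  shows "trig (\<lambda>x. P (torus_map x))"
proof -
  have "trig (\<lambda>x. of_real (Re (P (torus_map x))) + \<i> * of_real (Im (P (torus_map x))))"
    using trig_real_polynomial[of "Re \<circ> P"] trig_real_polynomial[of "Im \<circ> P"] assms bounded_linear_Re bounded_linear_Im
    unfolding polynomial_function_def by (intro trig_add trig_mult trig_const) (auto simp: o_def)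
  then show ?thesis by (simp flip: complex_eq)
qed

section \<open>Completeness of the trigonometric system\<close>

text \<open>Equal exponentials mean that the coordinates differ by an integer, and two distinct
  numbers in [0,1] with this property are 0 and 1.\<close>

lemma em_axis_eq_imp:
  assumes "em (axis i 1) x = em (axis i 1) y" "x \<in> unit_cube" "y \<in> unit_cube" "x $ i \<noteq> y $ i"
  shows "x $ i = 0 \<or> x $ i = 1"
proof -
  have "em (axis i 1) z = cis (2 * pi * z $ i)" for z
    by (simp add: em_eq_cis ivec_axis inner_axis')
  then have "sin (2 * pi * x $ i) = sin (2 * pi * y $ i)" "cos (2 * pi * x $ i) = cos (2 * pi * y $ i)"
    using assms(1) by (auto simp: complex_eq_iff)
  then obtain n where n: "2 * pi * x $ i = 2 * pi * y $ i + 2 * pi * of_int n"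
    using sin_cos_eq_iff[of "2 * pi * x $ i" "2 * pi * y $ i"] by auto
  then have "2 * pi * (x $ i) = 2 * pi * (y $ i + of_int n)" by (simp add: algebra_simps)
  then have n: "x $ i = y $ i + of_int n" by simp
  have "0 \<le> x $ i" "x $ i \<le> 1" "0 \<le> y $ i" "y $ i \<le> 1" using assms by (auto simp: mem_unit_cube)
  then have "real_of_int n \<le> 1" "- 1 \<le> real_of_int n" using n by linarith+
  then have "n \<le> 1" "- 1 \<le> n" by linarith+
  moreover have "n \<noteq> 0" using n assms(4) by auto
  ultimately have "n = 1 \<or> n = - 1" by linarith
  with n \<open>0 \<le> x $ i\<close> \<open>x $ i \<le> 1\<close> \<open>0 \<le> y $ i\<close> \<open>y $ i \<le> 1\<close> show ?thesis by auto
qed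

text \<open>Distinct points of the cube with the same image lie on the boundary, where
  \<open>G\<close> vanishes; hence \<open>G\<close> factors through \<open>torus_map\<close>. The
  factor \<open>H\<close> is continuous because a continuous map from the compact cube onto its
  image is a quotient map.\<close>

lemma uniform_trig_approx:
  fixes G :: "real^3 \<Rightarrow> complex"
  assumes cont: "continuous_on unit_cube G" and e: "e > 0"
    and bd: "\<And>x. x \<in> unit_cube \<Longrightarrow> x \<notin> box 0 (\<chi> i. 1) \<Longrightarrow> G x = 0"
  obtains p where "trig p" "\<And>x. x \<in> unit_cube \<Longrightarrow> norm (G x - p x) < e"
proof -
  let ?K = "torus_map ` unit_cube"
  have fib: "G x = G y" if "x \<in> unit_cube" "y \<in> unit_cube" "torus_map x = torus_map y" for x y
  proof (cases "x = y")
    case False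
    then obtain i where i: "x $ i \<noteq> y $ i" by (auto simp: vec_eq_iff)
    have eq: "em (axis i 1) x = em (axis i 1) y"
      using that(3) by (simp add: torus_map_def vec_eq_iff)
    have "x $ i = 0 \<or> x $ i = 1" "y $ i = 0 \<or> y $ i = 1"
      using em_axis_eq_imp[OF eq that(1,2) i] em_axis_eq_imp[OF eq[symmetric] that(2,1)] i by auto
    then have "x \<notin> box 0 (\<chi> i. 1)" "y \<notin> box 0 (\<chi> i. 1)" by (auto simp: mem_box_cart intro!: exI[of _ i])
    then show ?thesis using bd that by metis
  qed simp
  define H where "H = (\<lambda>z. G (SOME x. x \<in> unit_cube \<and> torus_map x = z))"
  have H: "H (torus_map x) = G x" if "x \<in> unit_cube" for x
  proof -
    have "(SOME y. y \<in> unit_cube \<and> torus_map y = torus_map x) \<in> unit_cube \<and>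
      torus_map (SOME y. y \<in> unit_cube \<and> torus_map y = torus_map x) = torus_map x"
      by (rule someI) (use that in blast)
    then show ?thesis unfolding H_def using that fib by blast
  qed
  have "openin (top_of_set ?K) (?K \<inter> H -` U)" if U: "openin (top_of_set UNIV) U" for U
  proof -
    have "unit_cube \<inter> torus_map -` (?K \<inter> H -` U) = unit_cube \<inter> G -` U"
      using H by (auto, metis)
    moreover have "openin (top_of_set unit_cube) (unit_cube \<inter> G -` U)"
      using cont U by (auto simp: continuous_on_open_gen[of G unit_cube UNIV])
    ultimately have "openin (top_of_set unit_cube) (unit_cube \<inter> torus_map -` (?K \<inter> H -` U))" by simp
    then show ?thesis
      by (subst (asm) Abstract_Topology_2.continuous_imp_quotient_map[OF continuous_torus_map refl compact_cbox]) auto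
  qed
  then have "continuous_on ?K H" by (subst continuous_on_open_gen[of H ?K UNIV]) auto
  moreover have "compact ?K" by (intro compact_continuous_image continuous_torus_map compact_cbox)
  ultimately obtain P where P: "polynomial_function P" "\<And>z. z \<in> ?K \<Longrightarrow> norm (H z - P z) < e"
    using Stone_Weierstrass_polynomial_function[of ?K H e] e by blast
  show thesis
  proof (rule that[of "\<lambda>x. P (torus_map x)"])
    show "trig (\<lambda>x. P (torus_map x))" by (rule trig_polynomial) fact
    show "norm (G x - P (torus_map x)) < e" if "x \<in> unit_cube" for x
      using P(2)[of "torus_map x"] H that by auto
  qed
qed

text \<open>The approximants vanish on the boundary so that they are well defined on the torus. As
  the boundary has measure zero, this costs nothing in L2.\<close>

lemma L2_approx_continuous:
  fixes g :: "real^3 \<Rightarrow> complex"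
  assumes meas: "g \<in> borel_measurable borel" and M: "M > 0" "\<And>x. norm (g x) \<le> M" and e: "e > 0"
  obtains G where "continuous_on unit_cube G"
    "\<And>x. x \<in> unit_cube \<Longrightarrow> x \<notin> box 0 (\<chi> i. 1) \<Longrightarrow> G x = 0"
    "(LINT x|cubeM. (norm (g x - G x))\<^sup>2) < e"
proof -
  have "g \<in> borel_measurable (lebesgue_on UNIV)"
    using meas by (intro measurable_restrict_space1 measurable_completion) simp
  then have "g measurable_on UNIV" by (simp add: measurable_on_iff_borel_measurable)
  then obtain N h where N: "negligible N" and hc: "\<And>n. continuous_on UNIV (h n)"
    and hl: "\<And>x. x \<notin> N \<Longrightarrow> (\<lambda>n. h n x) \<longlonglongrightarrow> g x"
    unfolding measurable_on_def by auto
  \<comment> \<open>The radial retraction onto the ball of radius \<open>M\<close>. It fixes all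
    values of \<open>g\<close>, so the approximants become bounded without losing
    convergence.\<close>
  define cl where "cl = (\<lambda>z :: complex. (M / max M (norm z)) *\<^sub>R z)"
  have cl_id: "cl z = z" if "norm z \<le> M" for z using that M by (simp add: cl_def max_def)
  have cl_le: "norm (cl z) \<le> M" for z using M by (simp add: cl_def max_def divide_simps)
  have cl_cont: "continuous_on UNIV cl"
    unfolding cl_def using M by (intro continuous_intros) (auto simp: max_def)
  \<comment> \<open>A continuous cut-off that vanishes on the boundary and at every fixed interior
    point equals 1 for large n.\<close>
  define X where "X = (\<lambda>n (x :: real^3). \<Prod>i\<in>UNIV. min 1 (real n * (x $ i * (1 - x $ i))))"
  have X01: "0 \<le> X n x \<and> X n x \<le> 1" if "x \<in> unit_cube" for n x
    unfolding X_def using that by (intro conjI prod_nonneg prod_le_1) (auto simp: mem_unit_cube)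
  have X0: "X n x = 0" if x: "x \<in> unit_cube" "x \<notin> box 0 (\<chi> i. 1)" for n x
  proof -
    obtain i where "\<not> (0 < x $ i \<and> x $ i < 1)" using x by (auto simp: mem_box_cart)
    moreover have "0 \<le> x $ i \<and> x $ i \<le> 1" using x by (auto simp: mem_unit_cube)
    ultimately have "x $ i = 0 \<or> x $ i = 1" by linarith
    then show ?thesis unfolding X_def by (intro prod_zero bexI[of _ i]) auto
  qed
  have X1: "(\<lambda>n. X n x) \<longlonglongrightarrow> 1" if "x \<in> box 0 (\<chi> i. 1)" for x
  proof -
    have "(\<lambda>n. min 1 (real n * (x $ i * (1 - x $ i)))) \<longlonglongrightarrow> 1" for i
    proof (rule tendsto_eventually)
      have "x $ i * (1 - x $ i) > 0" using that by (auto simp: mem_box_cart)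
      then obtain n0 where "1 < real n0 * (x $ i * (1 - x $ i))" using reals_Archimedean3 by blast
      then show "\<forall>\<^sub>F n in sequentially. min 1 (real n * (x $ i * (1 - x $ i))) = 1"
      proof (intro eventually_sequentiallyI[of n0])
        fix n assume "n0 \<le> n"
        then have "real n0 * (x $ i * (1 - x $ i)) \<le> real n * (x $ i * (1 - x $ i))"
          using \<open>x $ i * (1 - x $ i) > 0\<close> by (intro mult_right_mono) auto
        with \<open>1 < real n0 * (x $ i * (1 - x $ i))\<close>
        show "min 1 (real n * (x $ i * (1 - x $ i))) = 1" by simp
      qed
    qed
    then have "(\<lambda>n. X n x) \<longlonglongrightarrow> (\<Prod>i\<in>(UNIV::3 set). 1)" unfolding X_def by (intro tendsto_prod) auto
    then show ?thesis by simp
  qed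
  define G where "G = (\<lambda>n x. X n x *\<^sub>R cl (h n x))"
  have Gc: "continuous_on unit_cube (G n)" for n
    unfolding G_def X_def
    by (intro continuous_intros continuous_on_compose2[OF cl_cont] continuous_on_subset[OF hc]) auto
  have Gb: "norm (G n x) \<le> M" if "x \<in> unit_cube" for n x
  proof -
    have "norm (G n x) \<le> 1 * M"
      unfolding G_def norm_scaleR using X01[OF that, of n] cl_le M by (intro mult_mono) auto
    then show ?thesis by simp
  qed
  have "(\<lambda>n. LINT x|cubeM. (norm (g x - G n x))\<^sup>2) \<longlonglongrightarrow> (LINT x|cubeM. 0)"
  proof (rule integral_dominated_convergence[where w="\<lambda>_. (2 * M)\<^sup>2"])
    note [measurable] = continuous_measurable_cubeM[OF Gc]
    have [measurable]: "g \<in> borel_measurable cubeM" using meas by (intro measurable_restrict_space1) simp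
    show "(\<lambda>x. (norm (g x - G n x))\<^sup>2) \<in> borel_measurable cubeM" for n by measurable
    show "AE x in cubeM. norm ((norm (g x - G n x))\<^sup>2) \<le> (2 * M)\<^sup>2" for n
    proof (rule AE_I2)
      fix x assume "x \<in> space cubeM"
      then have "norm (g x - G n x) \<le> 2 * M"
        using norm_triangle_ineq4[of "g x" "G n x"] Gb[of x n] M(2)[of x] by simp
      from power_mono[OF this norm_ge_zero, of 2]
      show "norm ((norm (g x - G n x))\<^sup>2) \<le> (2 * M)\<^sup>2" by simp
    qed
    have "AE x in cubeM. x \<notin> N \<and> x \<notin> unit_cube - box 0 (\<chi> i. 1)"
      unfolding AE_cubeM_iff
      using AE_lborel_not_negligible[OF N] AE_lborel_not_negligible[OF negligible_frontier_interval[of 0 "\<chi> i. 1"]]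
      by eventually_elim auto
    then show "AE x in cubeM. (\<lambda>n. (norm (g x - G n x))\<^sup>2) \<longlonglongrightarrow> 0"
      unfolding AE_cubeM_iff
    proof eventually_elim
      case (elim x)
      show ?case
      proof
        assume "x \<in> unit_cube"
        then have x: "x \<in> box 0 (\<chi> i. 1)" "x \<notin> N" using elim by auto
        have "(\<lambda>n. cl (h n x)) \<longlonglongrightarrow> cl (g x)"
          using cl_cont hl[OF x(2)] by (rule continuous_on_tendsto_compose) auto
        then have "(\<lambda>n. G n x) \<longlonglongrightarrow> 1 *\<^sub>R g x"
          unfolding G_def using tendsto_scaleR[OF X1[OF x(1)]] cl_id[OF M(2)] by fastforce
        then have "(\<lambda>n. (norm (g x - G n x))\<^sup>2) \<longlonglongrightarrow> (norm (g x - 1 *\<^sub>R g x))\<^sup>2"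
          by (intro tendsto_intros)
        then show "(\<lambda>n. (norm (g x - G n x))\<^sup>2) \<longlonglongrightarrow> 0" by simp
      qed
    qed
  qed auto
  then have "(\<lambda>n. LINT x|cubeM. (norm (g x - G n x))\<^sup>2) \<longlonglongrightarrow> 0" by simp
  from order_tendstoD(2)[OF this e] obtain n where "(LINT x|cubeM. (norm (g x - G n x))\<^sup>2) < e"
    by (auto simp: eventually_sequentially)
  then show thesis using Gc X0 by (intro that[of "G n"]) (auto simp: G_def)
qed

lemma L2_truncation:
  fixes g :: "real^3 \<Rightarrow> complex"
  assumes meas: "g \<in> borel_measurable borel" and sq: "sq_integrable g" and e: "e > 0"
  obtains M where "M > 0" "(LINT x|cubeM. (norm (g x - (if norm (g x) \<le> M then g x else 0)))\<^sup>2) < e"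
proof -
  let ?g = "\<lambda>n x. if norm (g x) \<le> real (Suc n) then g x else 0"
  note [measurable] = meas
  have [measurable]: "g \<in> borel_measurable cubeM" using meas by (intro measurable_restrict_space1) simp
  have "(\<lambda>n. LINT x|cubeM. (norm (g x - ?g n x))\<^sup>2) \<longlonglongrightarrow> (LINT x|cubeM. 0)"
  proof (rule integral_dominated_convergence[where w="\<lambda>x. (norm (g x))\<^sup>2"])
    show "AE x in cubeM. (\<lambda>n. (norm (g x - ?g n x))\<^sup>2) \<longlonglongrightarrow> 0"
    proof (rule AE_I2, rule tendsto_eventually)
      fix x
      obtain n0 where "norm (g x) \<le> real n0" using real_arch_simple by blast
      then show "\<forall>\<^sub>F n in sequentially. (norm (g x - ?g n x))\<^sup>2 = 0"
        by (intro eventually_sequentiallyI[of n0]) auto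
    qed
  qed (use sq in \<open>auto simp: sq_integrable_def\<close>)
  then have "(\<lambda>n. LINT x|cubeM. (norm (g x - ?g n x))\<^sup>2) \<longlonglongrightarrow> 0" by simp
  from order_tendstoD(2)[OF this e] obtain n where "(LINT x|cubeM. (norm (g x - ?g n x))\<^sup>2) < e"
    by (auto simp: eventually_sequentially)
  then show thesis by (intro that[of "real (Suc n)"]) auto
qed

lemma integral_norm_sq_triangle:
  assumes "sq_integrable f" "sq_integrable g" "sq_integrable h"
  shows "(LINT x|cubeM. (norm (f x - h x))\<^sup>2)
    \<le> 2 * (LINT x|cubeM. (norm (f x - g x))\<^sup>2) + 2 * (LINT x|cubeM. (norm (g x - h x))\<^sup>2)"
proof -
  have i: "integrable cubeM (\<lambda>x. (norm (f x - h x))\<^sup>2)" "integrable cubeM (\<lambda>x. (norm (f x - g x))\<^sup>2)"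
    "integrable cubeM (\<lambda>x. (norm (g x - h x))\<^sup>2)"
    using assms sq_integrable_diff unfolding sq_integrable_def by blast+
  have "(norm (f x - h x))\<^sup>2 \<le> 2 * (norm (f x - g x))\<^sup>2 + 2 * (norm (g x - h x))\<^sup>2" for x
  proof -
    have "(norm (f x - h x))\<^sup>2 \<le> (norm (f x - g x) + norm (g x - h x))\<^sup>2"
      using norm_triangle_ineq[of "f x - g x" "g x - h x"] by (intro power_mono) auto
    then show ?thesis using sum_squares_bound[of "norm (f x - g x)" "norm (g x - h x)"] by (simp add: power2_sum)
  qed
  then have "(LINT x|cubeM. (norm (f x - h x))\<^sup>2) \<le> (LINT x|cubeM. 2 * (norm (f x - g x))\<^sup>2 + 2 * (norm (g x - h x))\<^sup>2)"
    using i by (intro integral_mono) auto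
  then show ?thesis using i by simp
qed

lemma sq_integrable_trig: "trig p \<Longrightarrow> sq_integrable p"
  unfolding trig_def by (auto intro!: sq_integrable_sum sq_integrable_cmult sq_integrable_em)

lemma trig_dense_L2:
  fixes g :: "real^3 \<Rightarrow> complex"
  assumes meas: "g \<in> borel_measurable borel" and sq: "sq_integrable g" and e: "e > 0"
  obtains p where "trig p" "(LINT x|cubeM. (norm (g x - p x))\<^sup>2) < e"
proof -
  \<comment> \<open>Two applications of the quadratic triangle inequality give 2d + 2(2d + 2d) =
    10d, which is less than e.\<close>
  define d where "d = e / 16"
  have d: "d > 0" using e by (simp add: d_def)
  obtain M where M: "M > 0" "(LINT x|cubeM. (norm (g x - (if norm (g x) \<le> M then g x else 0)))\<^sup>2) < d"
    using L2_truncation[OF meas sq d] by blast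
  define g' where "g' = (\<lambda>x. if norm (g x) \<le> M then g x else 0)"
  have g'm: "g' \<in> borel_measurable borel" unfolding g'_def using meas by measurable
  have g'b: "norm (g' x) \<le> M" for x using M by (simp add: g'_def)
  have g'i: "sq_integrable g'"
    unfolding sq_integrable_def
  proof
    show m [measurable]: "g' \<in> borel_measurable cubeM" using g'm by (intro measurable_restrict_space1) simp
    show "integrable cubeM (\<lambda>x. (norm (g' x))\<^sup>2)"
      by (rule cubeM.integrable_const_bound[where B="M\<^sup>2"]) (use g'b in \<open>auto intro!: power_mono\<close>)
  qed
  obtain G where G: "continuous_on unit_cube G"
    "\<And>x. x \<in> unit_cube \<Longrightarrow> x \<notin> box 0 (\<chi> i. 1) \<Longrightarrow> G x = 0" "(LINT x|cubeM. (norm (g' x - G x))\<^sup>2) < d"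
    using L2_approx_continuous[OF g'm M(1) g'b d] by blast
  obtain p where p: "trig p" "\<And>x. x \<in> unit_cube \<Longrightarrow> norm (G x - p x) < sqrt d"
    using uniform_trig_approx[OF G(1) _ G(2), of "sqrt d"] d by auto
  note si = sq g'i sq_integrable_continuous[OF G(1)] sq_integrable_trig[OF p(1)]
  have "(LINT x|cubeM. (norm (G x - p x))\<^sup>2) \<le> (LINT x|cubeM. d)"
  proof (rule integral_mono)
    show "integrable cubeM (\<lambda>x. (norm (G x - p x))\<^sup>2)"
      using sq_integrable_diff[OF si(3,4)] by (simp add: sq_integrable_def)
    fix x assume "x \<in> space cubeM"
    then have "(norm (G x - p x))\<^sup>2 \<le> (sqrt d)\<^sup>2" using p(2)[of x] by (intro power_mono) auto
    then show "(norm (G x - p x))\<^sup>2 \<le> d" using d by simp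
  qed auto
  then have "(LINT x|cubeM. (norm (G x - p x))\<^sup>2) \<le> d" by simp
  with integral_norm_sq_triangle[OF si(1,2,4)] integral_norm_sq_triangle[OF si(2,3,4)] M(2) G(3)
  have "(LINT x|cubeM. (norm (g x - p x))\<^sup>2) < e" using d unfolding d_def g'_def by linarith
  then show thesis using p(1) by (rule that[rotated])
qed

text \<open>Bessel's inequality bounds the sum by the integral. Conversely, a trigonometric
  polynomial close to g shows through the completed square that already a finite partial sum is
  close to the integral.\<close>

theorem parseval:
  assumes meas: "g \<in> borel_measurable borel" and sq: "sq_integrable g"
  shows "((\<lambda>k. (norm (cip g (em k)))\<^sup>2) has_sum (LINT x|cubeM. (norm (g x))\<^sup>2)) UNIV"
proof -
  let ?I = "LINT x|cubeM. (norm (g x))\<^sup>2"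
  let ?f = "\<lambda>k. (norm (cip g (em k)))\<^sup>2"
  have bessel: "sum ?f F \<le> ?I" if "finite F" for F
  proof -
    have "0 \<le> (LINT x|cubeM. (norm (g x - (\<Sum>k\<in>F. cip g (em k) * em k x)))\<^sup>2)" by simp
    then show ?thesis unfolding norm_diff_trig_sum[OF sq that] by simp
  qed
  have s: "?f summable_on UNIV"
    by (rule nonneg_bdd_above_summable_on) (use bessel in \<open>auto simp: bdd_above_def\<close>)
  have "infsum ?f UNIV \<le> ?I" by (rule infsum_le_finite_sums[OF s]) (use bessel in auto)
  moreover have "?I \<le> infsum ?f UNIV + e" if e: "e > 0" for e
  proof -
    obtain p where p: "trig p" "(LINT x|cubeM. (norm (g x - p x))\<^sup>2) < e"
      using trig_dense_L2[OF meas sq e] by blast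
    then obtain F c where F: "finite F" "p = (\<lambda>x. \<Sum>k\<in>F. c k * em k x)" unfolding trig_def by blast
    have "?I - sum ?f F \<le> (LINT x|cubeM. (norm (g x - p x))\<^sup>2)"
      unfolding F(2) norm_diff_trig_sum[OF sq F(1)] by (simp add: sum_nonneg)
    moreover have "sum ?f F \<le> infsum ?f UNIV" using s F by (intro finite_sum_le_infsum) auto
    ultimately show ?thesis using p(2) by linarith
  qed
  then have "?I \<le> infsum ?f UNIV" by (rule field_le_epsilon)
  ultimately show ?thesis using s by (simp add: has_sum_iff)
qed

lemma has_sum_diff_real:
  fixes f g :: "'i \<Rightarrow> real"
  assumes "(f has_sum a) A" "(g has_sum b) A"
  shows "((\<lambda>x. f x - g x) has_sum (a - b)) A"
  using has_sum_add[OF assms(1) has_sum_uminusI[OF assms(2)]] by simp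

lemma has_sum_complexI:
  assumes "((\<lambda>k. Re (f k)) has_sum Re z) A" "((\<lambda>k. Im (f k)) has_sum Im z) A"
  shows "(f has_sum z) A"
proof -
  have "((\<lambda>k. of_real (Re (f k)) + \<i> * of_real (Im (f k))) has_sum (of_real (Re z) + \<i> * of_real (Im z))) A"
    by (intro has_sum_add has_sum_cmult_right has_sum_of_real assms)
  then show ?thesis by (simp flip: complex_eq)
qed

text \<open>Polarisation gives the real parts; the imaginary parts are the real parts for -i f in
  place of f.\<close>

lemma parseval_inner:
  assumes "f \<in> borel_measurable borel" "sq_integrable f" "g \<in> borel_measurable borel" "sq_integrable g"
  shows "((\<lambda>k. cip f (em k) * cnj (cip g (em k))) has_sum cip f g) UNIV"
proof -
  have re: "((\<lambda>k. Re (cip f (em k) * cnj (cip g (em k)))) has_sum Re (cip f g)) UNIV"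
    if "f \<in> borel_measurable borel" "sq_integrable f" for f
  proof -
    have pol: "Re (x * cnj y) = (1/4) * ((norm (x + y))\<^sup>2 - (norm (x - y))\<^sup>2)" for x y :: complex
      unfolding cmod_power2 by (simp add: power2_eq_square algebra_simps)
    have *: "cip (\<lambda>x. f x + g x) h = cip f h + cip g h" "cip (\<lambda>x. f x - g x) h = cip f h - cip g h"
      if "sq_integrable h" for h
      unfolding cip_def ring_distribs using \<open>sq_integrable f\<close> assms that
      by (simp_all add: sq_integrable_mult)
    have "((\<lambda>k. (1/4) * ((norm (cip f (em k) + cip g (em k)))\<^sup>2 - (norm (cip f (em k) - cip g (em k)))\<^sup>2)) has_sum
       (1/4) * ((LINT x|cubeM. (norm (f x + g x))\<^sup>2) - (LINT x|cubeM. (norm (f x - g x))\<^sup>2))) UNIV"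
      using parseval[of "\<lambda>x. f x + g x"] parseval[of "\<lambda>x. f x - g x"] that assms
      by (intro has_sum_cmult_right has_sum_diff_real)
         (simp_all add: sq_integrable_add sq_integrable_diff * sq_integrable_em)
    moreover have "(1/4) * ((LINT x|cubeM. (norm (f x + g x))\<^sup>2) - (LINT x|cubeM. (norm (f x - g x))\<^sup>2)) = Re (cip f g)"
    proof -
      have "(LINT x|cubeM. (norm (f x + g x))\<^sup>2) - (LINT x|cubeM. (norm (f x - g x))\<^sup>2)
        = (LINT x|cubeM. (norm (f x + g x))\<^sup>2 - (norm (f x - g x))\<^sup>2)"
        using sq_integrable_add[of f g] sq_integrable_diff[of f g] that assms
        by (subst Bochner_Integration.integral_diff) (auto simp: sq_integrable_def)
      also have "\<dots> = (LINT x|cubeM. 4 * Re (f x * cnj (g x)))"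
      proof -
        have "(norm (f x + g x))\<^sup>2 - (norm (f x - g x))\<^sup>2 = 4 * Re (f x * cnj (g x))" for x
          unfolding pol by simp
        then show ?thesis by simp
      qed
      also have "\<dots> = 4 * Re (cip f g)"
        unfolding cip_def Bochner_Integration.integral_mult_right_zero
        by (simp only: integral_Re[OF sq_integrable_mult(2)[OF that(2) assms(4)]])
      finally show ?thesis by simp
    qed
    ultimately show ?thesis unfolding pol by simp
  qed
  have "((\<lambda>k. Re (cip (\<lambda>x. - \<i> * f x) (em k) * cnj (cip g (em k)))) has_sum Re (cip (\<lambda>x. - \<i> * f x) g)) UNIV"
    using assms by (intro re sq_integrable_cmult) auto
  moreover have "cip (\<lambda>x. - \<i> * f x) h = - \<i> * cip f h" for h
    unfolding cip_def mult.assoc by simp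
  ultimately have im: "((\<lambda>k. Im (cip f (em k) * cnj (cip g (em k)))) has_sum Im (cip f g)) UNIV" by simp
  show ?thesis using re[OF assms(1,2)] im by (rule has_sum_complexI)
qed

section \<open>Fourier coefficients of vector fields\<close>

lemma has_sum_finite_sum:
  fixes f :: "'i \<Rightarrow> 'k \<Rightarrow> 'b::topological_comm_monoid_add"
  assumes "\<And>i. i \<in> I \<Longrightarrow> (f i has_sum s i) A"
  shows "((\<lambda>k. \<Sum>i\<in>I. f i k) has_sum (\<Sum>i\<in>I. s i)) A"
  using assms
proof (induction I rule: infinite_finite_induct)
  case (insert i I)
  then show ?case by (simp add: has_sum_add)
qed (auto intro: has_sum_0)

abbreviation coord :: "field \<Rightarrow> 3 \<Rightarrow> real^3 \<Rightarrow> complex" where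
  "coord f j \<equiv> \<lambda>x. complex_of_real (f x $ j)"

lemma exp_minus_em: "exp (- (2 * of_real pi * \<i> * of_real (ivec k \<bullet> x))) = cnj (em k x)"
  by (simp add: em_def exp_cnj)

lemma fourier_nth: "fourier f k $ j = cip (coord f j) (em k)"
  unfolding fourier_def vec_lambda_beta exp_minus_em set_integral_cube cip_def ..

lemma L2_field_comp:
  assumes "L2_field f"
  shows "coord f j \<in> borel_measurable borel" "sq_integrable (coord f j)"
proof -
  have m [measurable]: "f \<in> borel_measurable borel" using assms by (simp add: L2_field_def)
  have i: "integrable cubeM (\<lambda>x. (norm (f x))\<^sup>2)"
    using assms by (simp add: L2_field_def set_integrable_cube)
  have "(\<lambda>x. f x $ j) \<in> borel_measurable borel"
    using measurable_compose[OF m borel_measurable_continuous_onI[OF linear_continuous_on[OF bounded_linear_vec_nth]]] .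
  then show b [measurable]: "coord f j \<in> borel_measurable borel" by measurable
  have c: "coord f j \<in> borel_measurable cubeM" by (intro measurable_restrict_space1) simp
  then have "(\<lambda>x. (norm (coord f j x))\<^sup>2) \<in> borel_measurable cubeM" by measurable
  moreover have "norm ((norm (coord f j x))\<^sup>2) \<le> norm ((norm (f x))\<^sup>2)" for x
    using power_mono[OF component_le_norm_cart[of "f x" j], of 2] by simp
  ultimately have "integrable cubeM (\<lambda>x. (norm (coord f j x))\<^sup>2)"
    by (intro Bochner_Integration.integrable_bound[OF i]) auto
  with c show "sq_integrable (coord f j)" by (simp add: sq_integrable_def)
qed

lemma L2_fieldI_continuous:
  assumes "periodic f" "continuous_on UNIV f"
  shows "L2_field f"
  unfolding L2_field_def set_integrable_cube using assms
  by (auto intro!: borel_measurable_continuous_onI continuous_integrable_cubeM continuous_intros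
      intro: continuous_on_subset)

lemma L2_field_diff:
  assumes "L2_field f" "L2_field g"
  shows "L2_field (f - g)"
proof -
  have [measurable]: "f \<in> borel_measurable borel" "g \<in> borel_measurable borel" using assms by (auto simp: L2_field_def)
  have m: "f - g \<in> borel_measurable borel" unfolding fun_diff_def by measurable
  have i: "integrable cubeM (\<lambda>x. 2 * (norm (f x))\<^sup>2 + 2 * (norm (g x))\<^sup>2)"
    using assms by (auto simp: L2_field_def set_integrable_cube)
  have m2: "(\<lambda>x. (norm ((f - g) x))\<^sup>2) \<in> borel_measurable cubeM"
    using m by (intro measurable_restrict_space1) simp
  have "norm ((norm ((f - g) x))\<^sup>2) \<le> norm (2 * (norm (f x))\<^sup>2 + 2 * (norm (g x))\<^sup>2)" for x
  proof -
    have "(norm (f x - g x))\<^sup>2 \<le> (norm (f x) + norm (g x))\<^sup>2"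
      by (intro power_mono norm_triangle_ineq4) auto
    then show ?thesis using sum_squares_bound[of "norm (f x)" "norm (g x)"] by (simp add: power2_sum)
  qed
  then have "integrable cubeM (\<lambda>x. (norm ((f - g) x))\<^sup>2)"
    by (intro Bochner_Integration.integrable_bound[OF i m2]) auto
  with m assms show ?thesis by (auto simp: L2_field_def set_integrable_cube periodic_def)
qed

lemma fourier_diff:
  assumes "L2_field f" "L2_field g"
  shows "fourier (f - g) k = fourier f k - fourier g k"
proof -
  have "cip (coord (f - g) j) (em k) = cip (coord f j) (em k) - cip (coord g j) (em k)" for j
    using cip_diff_left[of "coord f j" "coord g j" "em k"] L2_field_comp[OF assms(1)] L2_field_comp[OF assms(2)]
    by (simp add: sq_integrable_em)
  then show ?thesis by (simp add: vec_eq_iff fourier_nth)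
qed

lemma parseval_field:
  assumes "L2_field f" "L2_field g"
  shows "((\<lambda>k. fourier f k \<bullet> fourier g k) has_sum L2_inner f g) UNIV"
proof -
  have c: "x \<bullet> y = Re (x * cnj y)" for x y :: complex by (simp add: inner_complex_def)
  have "((\<lambda>k. \<Sum>j\<in>UNIV. Re (fourier f k $ j * cnj (fourier g k $ j))) has_sum
      (\<Sum>j\<in>UNIV. Re (cip (coord f j) (coord g j)))) UNIV"
    unfolding fourier_nth
    by (intro has_sum_finite_sum has_sum_Re parseval_inner L2_field_comp assms)
  moreover have "(\<Sum>j\<in>UNIV. Re (cip (coord f j) (coord g j))) = L2_inner f g"
  proof -
    have "Re (cip (coord f j) (coord g j)) = (LINT x|cubeM. f x $ j * g x $ j)"
      and "integrable cubeM (\<lambda>x. f x $ j * g x $ j)" for j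
    proof -
      have i: "integrable cubeM (\<lambda>x. coord f j x * cnj (coord g j x))"
        by (intro sq_integrable_mult L2_field_comp assms)
      show "Re (cip (coord f j) (coord g j)) = (LINT x|cubeM. f x $ j * g x $ j)"
        unfolding cip_def by (subst integral_Re[OF i, symmetric]) simp
      show "integrable cubeM (\<lambda>x. f x $ j * g x $ j)"
        using integrable_Re[OF i] by simp
    qed
    then show ?thesis
      unfolding L2_inner_def set_integral_cube inner_vec_def by (simp add: Bochner_Integration.integral_sum)
  qed
  ultimately show ?thesis by (simp add: inner_vec_def c)
qed

lemma L2_norm_has_sum:
  assumes "L2_field f"
  shows "((\<lambda>k. (norm (fourier f k))\<^sup>2) has_sum (L2_norm f)\<^sup>2) UNIV"
proof -
  have "L2_inner f f = (L2_norm f)\<^sup>2"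
    unfolding L2_inner_def L2_norm_def set_integral_cube by (simp add: power2_norm_eq_inner)
  then show ?thesis using parseval_field[OF assms assms] by (simp add: power2_norm_eq_inner)
qed

lemma Hs_iff: "f \<in> Hs s \<longleftrightarrow> L2_field f \<and> fourier f \<in> sob s"
  by (simp add: Hs_def wsp_def jw_def)

lemma Hs_norm_eq: "Hs_norm s f = sobn s (fourier f)"
  by (simp add: Hs_norm_def wnorm_def jw_def)

lemma real_coeffs_fourier: "real_coeffs (fourier f)"
proof -
  have "cip (coord f j) (em (- k)) = cnj (cip (coord f j) (em k))" for j k
    unfolding cip_def by (subst Bochner_Integration.integral_cnj[symmetric]) (simp add: em_minus)
  then show ?thesis by (simp add: real_coeffs_def fourier_nth)
qed

section \<open>Smooth solenoidal fields and their Fourier coefficients\<close>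

lemma smoothD:
  assumes "\<phi> \<in> smooth_solenoidal"
  shows "periodic \<phi>" "continuous_on UNIV \<phi>" "\<And>x. \<phi> differentiable (at x)"
    "continuous_on UNIV (partial_deriv i \<phi>)"
    "\<And>x. (\<Sum>i\<in>UNIV. partial_deriv i \<phi> x $ i) = 0" "(LINT x|cubeM. \<phi> x) = 0"
proof -
  have C: "Ck_field n \<phi>" for n using assms by (simp add: smooth_solenoidal_def)
  show "periodic \<phi>" "\<And>x. (\<Sum>i\<in>UNIV. partial_deriv i \<phi> x $ i) = 0" "(LINT x|cubeM. \<phi> x) = 0"
    using assms by (auto simp: smooth_solenoidal_def divergence_def set_integral_cube)
  show "continuous_on UNIV \<phi>" using C[of 0] by simp
  show "\<phi> differentiable (at x)" for x using C[of "Suc 0"] by (simp add: differentiable_on_def)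
  show "continuous_on UNIV (partial_deriv i \<phi>)" using C[of "Suc 0"] by simp
qed

text \<open>\<open>frechet_derivative\<close> is a choice from the predicate
  \<open>has_derivative\<close>. Translation shows that the predicates at x and at x + k coincide,
  so the choices coincide, even where f is not differentiable.\<close>

lemma partial_deriv_periodic:
  assumes "periodic f"
  shows "periodic (partial_deriv i f)"
proof -
  have "frechet_derivative f (at (x + ivec k)) = frechet_derivative f (at x)" for k x
  proof -
    have "(f has_derivative D) (at (x + ivec k)) \<longleftrightarrow> (f has_derivative D) (at x)" for D
    proof -
      have "(f has_derivative D) (at (x + c))" if "(f has_derivative D) (at x)" "\<And>x. f (x + c) = f x" for f :: field and x c D
      proof -
        have "((\<lambda>y. f (y + (- c))) has_derivative D) (at (x + c))"
        proof -
          have "((\<lambda>y. y + (- c)) has_derivative (\<lambda>h. h)) (at (x + c))" by (auto intro!: derivative_eq_intros)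
          from has_derivative_compose[OF this, of f D] that(1) show ?thesis by simp
        qed
        moreover have "f (y + (- c)) = f y" for y using that(2)[of "y - c"] by simp
        ultimately show ?thesis by simp
      qed
      note t = this
      have p: "f (y + ivec k) = f y" for y k using assms by (simp add: periodic_def)
      show ?thesis
        using t[of f D x "ivec k"] t[of f D "x + ivec k" "ivec (- k)"] p[of _ k] p[of _ "- k"] by (auto simp del: ivec_minus simp flip: ivec_add add.assoc) (simp add: ivec_add add.assoc)
    qed
    then show ?thesis by (simp add: frechet_derivative_def)
  qed
  then show ?thesis by (simp add: periodic_def partial_deriv_def)
qed

lemma smooth_L2:
  assumes "\<phi> \<in> smooth_solenoidal"
  shows "L2_field \<phi>" "L2_field (partial_deriv i \<phi>)"
  using smoothD[OF assms] partial_deriv_periodic by (auto intro!: L2_fieldI_continuous)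

lemma frechet_derivative_partials:
  assumes "g differentiable (at x)"
  shows "frechet_derivative g (at x) y = (\<Sum>i\<in>UNIV. y $ i *\<^sub>R partial_deriv i g x)"
proof -
  interpret D: bounded_linear "frechet_derivative g (at x)"
    using assms by (simp add: frechet_derivative_works has_derivative_bounded_linear)
  have "y = (\<Sum>i\<in>UNIV. y $ i *\<^sub>R axis i 1)"
    by (simp add: vec_eq_iff axis_def if_distrib cong: if_cong)
  then have "frechet_derivative g (at x) y = frechet_derivative g (at x) (\<Sum>i\<in>UNIV. y $ i *\<^sub>R axis i 1)" by simp
  then show ?thesis by (simp only: D.sum D.scaleR partial_deriv_def)
qed

text \<open>Integration by parts: a component times \<open>em (- k)\<close> is periodic, so the
  derivative of the product integrates to zero.\<close>

lemma fourier_partial_deriv: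
  assumes "\<phi> \<in> smooth_solenoidal"
  shows "fourier (partial_deriv i \<phi>) k = (2 * of_real pi * \<i> * of_int (k $ i)) *s fourier \<phi> k"
proof -
  note sm = smoothD[OF assms]
  define c where "c = 2 * of_real pi * \<i> * (of_int (k $ i) :: complex)"
  have "cip (coord (partial_deriv i \<phi>) j) (em k) = c * cip (coord \<phi> j) (em k)" for j
  proof -
    let ?f = "\<lambda>x. em (- k) x * coord \<phi> j x"
    let ?D = "\<lambda>x. em (- k) x * coord (partial_deriv i \<phi>) j x + (- c * em (- k) x) * coord \<phi> j x"
    have int: "integrable cubeM (\<lambda>x. em (- k) x * coord (partial_deriv i \<phi>) j x)"
       "integrable cubeM (\<lambda>x. em (- k) x * coord \<phi> j x)"
      by (intro sq_integrable_mult sq_integrable_em L2_field_comp smooth_L2 assms)+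
    have "(LINT x|cubeM. ?D x) = 0"
    proof (rule cube_integral_partial_derivative[where f="?f"])
      show "lattice_periodic ?f"
        using sm(1) em_periodic[of "- k"] by (simp add: lattice_periodic_def periodic_def)
      show "continuous_on UNIV ?f" "continuous_on UNIV ?D"
        by (intro continuous_intros continuous_em sm)+
      fix x :: "real^3"
      have a: "((\<lambda>t. x + t *\<^sub>R axis i 1) has_vector_derivative axis i 1) (at 0)"
        by (auto intro!: derivative_eq_intros)
      have b: "(\<phi> has_derivative frechet_derivative \<phi> (at x)) (at (x + 0 *\<^sub>R axis i 1))"
        using sm(3)[of x] by (simp add: frechet_derivative_works)
      have "((\<phi> \<circ> (\<lambda>t. x + t *\<^sub>R axis i 1)) has_vector_derivative partial_deriv i \<phi> x) (at 0)"
        unfolding partial_deriv_def by (rule vector_derivative_diff_chain_within[OF a has_derivative_at_withinI[OF b]])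
      then have "((\<lambda>t. \<phi> (x + t *\<^sub>R axis i 1)) has_vector_derivative partial_deriv i \<phi> x) (at 0)"
        by (simp add: o_def)
      from bounded_linear.has_vector_derivative[OF bounded_linear_compose[OF bounded_linear_of_real bounded_linear_vec_nth] this]
      have "((\<lambda>t. coord \<phi> j (x + t *\<^sub>R axis i 1)) has_vector_derivative coord (partial_deriv i \<phi>) j x) (at 0)" .
      from has_vector_derivative_mult[OF em_deriv[of "- k" x i] this]
      show "((\<lambda>t. ?f (x + t *\<^sub>R axis i 1)) has_vector_derivative ?D x) (at 0)"
        by (simp add: c_def)
    qed
    also have "(LINT x|cubeM. ?D x) = (LINT x|cubeM. em (- k) x * coord (partial_deriv i \<phi>) j x)
       - c * (LINT x|cubeM. em (- k) x * coord \<phi> j x)"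
      using int by (simp add: mult.assoc)
    finally show ?thesis by (simp add: cip_def em_minus mult.commute)
  qed
  then show ?thesis by (simp add: vec_eq_iff fourier_nth c_def)
qed

lemma smooth_fourier:
  assumes "\<phi> \<in> smooth_solenoidal"
  shows "solenoidal (fourier \<phi>)" "fourier \<phi> 0 = 0" "fourier \<phi> \<in> sob 1"
proof -
  note sm = smoothD[OF assms]
  have "2 * of_real pi * \<i> * cdot (fourier \<phi> k) k = 0" for k
  proof -
    have "2 * of_real pi * \<i> * cdot (fourier \<phi> k) k = (\<Sum>j\<in>UNIV. fourier (partial_deriv j \<phi>) k $ j)"
      by (simp add: fourier_partial_deriv[OF assms] cdot_def sum_distrib_left mult_ac)
    also have "\<dots> = cip (\<lambda>x. \<Sum>j\<in>UNIV. 1 * coord (partial_deriv j \<phi>) j x) (em k)"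
      unfolding fourier_nth
      by (subst cip_sum_left) (auto intro: L2_field_comp smooth_L2 assms sq_integrable_em)
    also have "\<dots> = 0"
      using sm(5) by (simp add: cip_def flip: of_real_sum)
    finally show ?thesis .
  qed
  then show "solenoidal (fourier \<phi>)" by (simp add: solenoidal_def)
  have "integrable cubeM \<phi>" using sm(2) by (intro continuous_integrable_cubeM) (auto intro: continuous_on_subset)
  from integral_bounded_linear[OF bounded_linear_vec_nth this]
  have "(LINT x|cubeM. \<phi> x $ j) = 0" for j using sm(6) by simp
  then show "fourier \<phi> 0 = 0" by (simp add: vec_eq_iff fourier_nth cip_def)
  \<comment> \<open>Parseval's identities for the field and for its three partial derivatives add up
    to the weight \<open>jw k\<close> of order one, which suffices since r is at most 1.\<close>
  have "((\<lambda>k. (norm (fourier \<phi> k))\<^sup>2 + (\<Sum>i\<in>UNIV. (norm (fourier (partial_deriv i \<phi>) k))\<^sup>2)) has_sum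
     ((L2_norm \<phi>)\<^sup>2 + (\<Sum>i\<in>UNIV. (L2_norm (partial_deriv i \<phi>))\<^sup>2))) UNIV"
    by (intro has_sum_add has_sum_finite_sum L2_norm_has_sum smooth_L2 assms)
  moreover have "(norm (fourier \<phi> k))\<^sup>2 + (\<Sum>i\<in>UNIV. (norm (fourier (partial_deriv i \<phi>) k))\<^sup>2)
    = jw k powr 1 * (norm (fourier \<phi> k))\<^sup>2" for k
  proof -
    have "(norm (ivec k))\<^sup>2 = (\<Sum>i\<in>UNIV. (real_of_int (k $ i))\<^sup>2)"
      by (simp add: norm_vec_def L2_set_def sum_nonneg)
    then show ?thesis
      using jw_pos[of k]
      by (simp add: fourier_partial_deriv[OF assms] norm_smult_complex norm_mult power_mult_distrib jw_def less_imp_le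
        ring_distribs sum_distrib_left sum_distrib_right powr_one)
  qed
  ultimately show "fourier \<phi> \<in> sob 1" by (auto simp: wsp_def has_sum_iff)
qed

text \<open>The convolution theorem: Parseval's identity for f against g times \<open>em m\<close>,
  where the conjugate of g disappears because g is real.\<close>

lemma cip_real_mult_em:
  assumes "f \<in> borel_measurable borel" "sq_integrable f" "g \<in> borel_measurable borel" "sq_integrable g"
    and real: "\<And>x. cnj (g x) = g x"
  shows "((\<lambda>k. cip f (em k) * cip g (em (m - k))) has_sum cip (\<lambda>x. f x * g x) (em m)) UNIV"
proof -
  have 1: "cip f (\<lambda>x. g x * em m x) = cip (\<lambda>x. f x * g x) (em m)"
    by (simp add: cip_def real mult.assoc)
  have 2: "cnj (cip (\<lambda>x. g x * em m x) (em k)) = cip g (em (m - k))" for k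
  proof -
    have "cnj (cip (\<lambda>x. g x * em m x) (em k)) = cip (em k) (\<lambda>x. g x * em m x)"
      by (rule cip_cnj[symmetric])
    also have "\<dots> = cip g (em (m - k))"
      unfolding cip_def by (simp add: real mult_ac flip: em_mult_cnj)
    finally show ?thesis .
  qed
  have "em m \<in> borel_measurable borel"
    by (intro borel_measurable_continuous_onI continuous_em)
  then have "(\<lambda>x. g x * em m x) \<in> borel_measurable borel" using assms(3) by measurable
  from parseval_inner[OF assms(1,2) this sq_integrable_em_mult[OF assms(4)]]
  show ?thesis by (simp add: 1 2)
qed

lemma bsummable_smooth:
  assumes u: "u \<in> smooth_solenoidal" and v: "v \<in> smooth_solenoidal" and w: "w \<in> smooth_solenoidal"
  shows "bsummable (fourier u) (fourier v) (fourier w)"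
  by (rule bsummable_sob[of 1, OF _ smooth_fourier(1,3)[OF u] smooth_fourier(3)[OF v] smooth_fourier(3)[OF w]]) simp

text \<open>Summability over pairs allows summing over the frequency k of a first; the inner sums
  are then Fourier coefficients of the advection term tested with c.\<close>

lemma bform_has_sum_iterated:
  assumes "bsummable a b c" "\<And>m. ((\<lambda>k. advect a b m k \<bullet> c m) has_sum g m) UNIV"
  shows "(g has_sum bform a b c) UNIV"
proof -
  have "(bterm a b c has_sum bform a b c) (UNIV \<times> UNIV)"
    using bsummableD[OF assms(1)] by (simp add: bform_def)
  then have "((\<lambda>(m, k). bterm a b c (k, m)) has_sum bform a b c) (UNIV \<times> UNIV)"
    by (subst (asm) has_sum_swap)
  from has_sum_SigmaD[OF this] assms(2) show ?thesis by (simp add: bterm_def)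
qed

lemma fourier_diff_fun:
  assumes "L2_field f" "L2_field g"
  shows "fourier (f - g) = (\<lambda>k. fourier f k - fourier g k)"
  using fourier_diff[OF assms] by auto

text \<open>The advection term is a sum of products of components of u with derivatives of v. The
  convolution theorem gives its coefficients, and Parseval's identity pairs them with those of
  w.\<close>

theorem B_smooth_eq_bform:
  assumes u: "u \<in> smooth_solenoidal" and v: "v \<in> smooth_solenoidal" and w: "w \<in> smooth_solenoidal"
  shows "B_smooth u v w = bform (fourier u) (fourier v) (fourier w)"
proof -
  define h where "h = (\<lambda>x. frechet_derivative v (at x) (u x))"
  have h: "h = (\<lambda>x. \<Sum>i\<in>UNIV. u x $ i *\<^sub>R partial_deriv i v x)"
    unfolding h_def using smoothD(3)[OF v] by (simp add: frechet_derivative_partials)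
  have hL2: "L2_field h"
  proof (rule L2_fieldI_continuous)
    show "periodic h"
      using smoothD(1)[OF u] partial_deriv_periodic[OF smoothD(1)[OF v]] by (simp add: h periodic_def)
    show "continuous_on UNIV h"
      unfolding h by (intro continuous_intros smoothD[OF u] smoothD[OF v])
  qed
  have fh: "((\<lambda>k. advect (fourier u) (fourier v) m k $ j) has_sum fourier h m $ j) UNIV" for m j
  proof -
    have "((\<lambda>k. \<Sum>i\<in>UNIV. cip (coord u i) (em k) * cip (coord (partial_deriv i v) j) (em (m - k))) has_sum
       (\<Sum>i\<in>UNIV. cip (\<lambda>x. coord u i x * coord (partial_deriv i v) j x) (em m))) UNIV"
      by (intro has_sum_finite_sum cip_real_mult_em L2_field_comp smooth_L2 u v) simp
    moreover have "(\<Sum>i\<in>UNIV. cip (\<lambda>x. coord u i x * coord (partial_deriv i v) j x) (em m)) = fourier h m $ j"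
    proof -
      have "integrable cubeM (\<lambda>x. (coord u i x * coord (partial_deriv i v) j x) * cnj (em m x))" for i
        by (intro continuous_integrable_cubeM continuous_intros continuous_em
           continuous_on_subset[OF smoothD(2)[OF u]] continuous_on_subset[OF smoothD(4)[OF v]]) auto
      then show ?thesis
        unfolding fourier_nth cip_def h by (subst Bochner_Integration.integral_sum[symmetric]) (auto simp: sum_distrib_right)
    qed
    moreover have "(\<Sum>i\<in>UNIV. cip (coord u i) (em k) * cip (coord (partial_deriv i v) j) (em (m - k)))
      = advect (fourier u) (fourier v) m k $ j" for k
      unfolding fourier_nth[symmetric] fourier_partial_deriv[OF v] advect_def cdot_def
      by (simp add: sum_distrib_left sum_distrib_right mult_ac)
    ultimately show ?thesis by simp
  qed
  have "((\<lambda>k. advect (fourier u) (fourier v) m k \<bullet> fourier w m) has_sum (fourier h m \<bullet> fourier w m)) UNIV" for m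
    unfolding inner_vec_def
    by (intro has_sum_finite_sum has_sum_bounded_linear[OF bounded_linear_inner_left] fh)
  from bform_has_sum_iterated[OF bsummable_smooth[OF u v w] this]
  have "bform (fourier u) (fourier v) (fourier w) = L2_inner h w"
    using parseval_field[OF hL2 smooth_L2(1)[OF w]] has_sum_unique by blast
  then show ?thesis by (simp add: B_smooth_def h_def)
qed

section \<open>Extension from smooth fields to \<open>V r\<close>\<close>

lemma smooth_in_sob:
  assumes "\<phi> \<in> smooth_solenoidal" "r \<le> 1"
  shows "fourier \<phi> \<in> sob r"
  using sob_mono(1)[OF assms(2) smooth_fourier(3)[OF assms(1)]] .

lemma V_basic:
  assumes "u \<in> V r"
  shows "L2_field u" "fourier u \<in> sob r"
  using assms by (auto simp: V_def Hs_iff)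

lemma V_smooth_approx:
  assumes "u \<in> V r"
  obtains U where "smooth_approx r U u"
proof -
  have "\<exists>\<phi>\<in>smooth_solenoidal. Hs_norm r (u - \<phi>) < inverse (Suc n)" for n
    using assms unfolding V_def by auto
  then obtain U where U: "\<And>n. U n \<in> smooth_solenoidal" "\<And>n. Hs_norm r (u - U n) < inverse (Suc n)" by metis
  have "Hs_norm r (U n - u) = Hs_norm r (u - U n)" for n
    unfolding Hs_norm_eq fourier_diff_fun[OF V_basic(1)[OF assms] smooth_L2(1)[OF U(1)]]
      fourier_diff_fun[OF smooth_L2(1)[OF U(1)] V_basic(1)[OF assms]]
    by (rule wnorm_minus_commute)
  then have "(\<lambda>n. Hs_norm r (U n - u)) \<longlonglongrightarrow> 0"
    using U(2) by (intro real_tendsto_sandwich[OF _ _ tendsto_const LIMSEQ_inverse_real_of_nat])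
       (auto simp: Hs_norm_eq less_imp_le)
  then show thesis using U(1) by (intro that[of U]) (simp add: smooth_approx_def)
qed

lemma smooth_approxD:
  assumes "smooth_approx r U u" "u \<in> V r" "r \<le> 1"
  shows "\<And>n. U n \<in> smooth_solenoidal" "\<And>n. fourier (U n) \<in> sob r"
    "(\<lambda>n. sobn r (\<lambda>k. fourier (U n) k - fourier u k)) \<longlonglongrightarrow> 0"
    "(\<lambda>n. sobn r (fourier (U n))) \<longlonglongrightarrow> sobn r (fourier u)"
    "\<And>n. (\<lambda>k. fourier (U n) k - fourier u k) \<in> sob r"
    "(\<lambda>n. fourier (U n) k) \<longlonglongrightarrow> fourier u k"
proof -
  show U: "\<And>n. U n \<in> smooth_solenoidal" using assms by (simp add: smooth_approx_def)
  show S: "\<And>n. fourier (U n) \<in> sob r" using U assms smooth_in_sob by blast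
  have e: "fourier (U n - u) = (\<lambda>k. fourier (U n) k - fourier u k)" for n
    using fourier_diff[OF smooth_L2(1)[OF U] V_basic(1)[OF assms(2)]] by auto
  show lim: "(\<lambda>n. sobn r (\<lambda>k. fourier (U n) k - fourier u k)) \<longlonglongrightarrow> 0"
    using assms(1) by (simp add: smooth_approx_def Hs_norm_eq e)
  note d = wnorm_diff[where \<mu>="\<lambda>k. jw k powr r", OF _ S V_basic(2)[OF assms(2)]]
  show D: "\<And>n. (\<lambda>k. fourier (U n) k - fourier u k) \<in> sob r" using d(1) by simp
  have "(\<lambda>n. sobn r (fourier (U n)) - sobn r (fourier u)) \<longlonglongrightarrow> 0"
    by (rule Lim_null_comparison[OF _ lim]) (use d(3) in auto)
  then show "(\<lambda>n. sobn r (fourier (U n))) \<longlonglongrightarrow> sobn r (fourier u)" by (rule LIM_zero_cancel)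
  have "jw k powr r * (norm (fourier (U n) k - fourier u k))\<^sup>2 \<le> (sobn r (\<lambda>k. fourier (U n) k - fourier u k))\<^sup>2" for n
    using wnorm_component_le[where \<mu>="\<lambda>k. jw k powr r", OF _ D] by simp
  then have le: "(norm (fourier (U n) k - fourier u k))\<^sup>2 \<le> (sobn r (\<lambda>k. fourier (U n) k - fourier u k))\<^sup>2 / jw k powr r" for n
    by (simp add: field_simps)
  have "(\<lambda>n. (sobn r (\<lambda>k. fourier (U n) k - fourier u k))\<^sup>2 / jw k powr r) \<longlonglongrightarrow> 0\<^sup>2 / jw k powr r"
    by (intro tendsto_intros lim) simp
  then have l0: "(\<lambda>n. (sobn r (\<lambda>k. fourier (U n) k - fourier u k))\<^sup>2 / jw k powr r) \<longlonglongrightarrow> 0" by simp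
  have "(\<lambda>n. (norm (fourier (U n) k - fourier u k))\<^sup>2) \<longlonglongrightarrow> 0"
    by (rule tendsto_sandwich[OF always_eventually[OF allI] always_eventually[OF allI] tendsto_const l0]) (simp, rule le)
  then have "(\<lambda>n. sqrt ((norm (fourier (U n) k - fourier u k))\<^sup>2)) \<longlonglongrightarrow> sqrt 0" by (rule tendsto_real_sqrt)
  then have "(\<lambda>n. norm (fourier (U n) k - fourier u k)) \<longlonglongrightarrow> 0" by simp
  then show "(\<lambda>n. fourier (U n) k) \<longlonglongrightarrow> fourier u k"
    by (rule LIM_zero_cancel[OF tendsto_norm_zero_cancel])
qed

text \<open>Both properties are linear conditions on single coefficients, and these converge along a
  smooth approximation.\<close>

lemma V_fourier:
  assumes "u \<in> V r" "r \<le> 1"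
  shows "solenoidal (fourier u)" "fourier u 0 = 0"
proof -
  obtain U where U: "smooth_approx r U u" using V_smooth_approx[OF assms(1)] .
  note a = smooth_approxD[OF U assms]
  have "(\<lambda>n. cdot (fourier (U n) k) k) \<longlonglongrightarrow> cdot (fourier u k) k" for k
    unfolding cdot_def by (intro tendsto_intros a(6))
  moreover have "cdot (fourier (U n) k) k = 0" for n k
    using smooth_fourier(1)[OF a(1)] by (simp add: solenoidal_def)
  ultimately show "solenoidal (fourier u)" by (simp add: solenoidal_def LIMSEQ_const_iff)
  show "fourier u 0 = 0" using a(6)[of 0] smooth_fourier(2)[OF a(1)] by (simp add: LIMSEQ_const_iff)
qed

text \<open>The trilinear bound makes \<open>bform\<close> continuous, so its value is the limit
  along all approximations. Since approximations exist, no other number has this property, which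
  determines the \<open>THE\<close> in \<open>B_ext\<close>.\<close>

theorem B_ext_eq_bform:
  assumes r: "5/6 < r" "r \<le> 1" and V: "u \<in> V r" "v \<in> V r" "w \<in> V r"
  shows "B_ext r u v w = bform (fourier u) (fourier v) (fourier w)"
proof -
  obtain C where C: "C \<ge> 0"
    "\<And>a b c. solenoidal a \<Longrightarrow> a \<in> sob r \<Longrightarrow> b \<in> sob r \<Longrightarrow> c \<in> sob r \<Longrightarrow>
       bsummable a b c \<and> \<bar>bform a b c\<bar> \<le> C * (sobn r a * sobn r b * sobn r c)"
    using bform_bound[of r r r] r by auto
  note C1 = C(2)[THEN conjunct1] and C2 = C(2)[THEN conjunct2]
  let ?u = "fourier u" and ?v = "fourier v" and ?w = "fourier w"
  have lim: "(\<lambda>n. B_smooth (U n) (W n) (Z n)) \<longlonglongrightarrow> bform ?u ?v ?w"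
    if *: "smooth_approx r U u" "smooth_approx r W v" "smooth_approx r Z w" for U W Z
  proof -
    note u = smooth_approxD[OF *(1) V(1) r(2)] and v = smooth_approxD[OF *(2) V(2) r(2)]
      and w = smooth_approxD[OF *(3) V(3) r(2)]
    note u' = V_basic[OF V(1)] V_fourier[OF V(1) r(2)] and v' = V_basic[OF V(2)] V_fourier[OF V(2) r(2)]
      and w' = V_basic[OF V(3)] V_fourier[OF V(3) r(2)]
    let ?U = "\<lambda>n. fourier (U n)" and ?W = "\<lambda>n. fourier (W n)" and ?Z = "\<lambda>n. fourier (Z n)"
    have sU: "solenoidal (?U n)" "solenoidal (\<lambda>k. ?U n k - ?u k)" for n
      using smooth_fourier(1)[OF u(1)] u'(3) by (auto simp: solenoidal_def cdot_diff_left)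
    \<comment> \<open>Telescoping: one argument is replaced at a time, so that every term has a
      factor that tends to zero in \<open>sob r\<close>.\<close>
    have "bform (?U n) (?W n) (?Z n) - bform ?u ?v ?w
      = bform (\<lambda>k. ?U n k - ?u k) (?W n) (?Z n) + bform ?u (\<lambda>k. ?W n k - ?v k) (?Z n) + bform ?u ?v (\<lambda>k. ?Z n k - ?w k)" for n
    proof -
      have s: "bsummable (?U n) (?W n) (?Z n)" "bsummable ?u (?W n) (?Z n)" "bsummable ?u ?v (?Z n)" "bsummable ?u ?v ?w"
        by (intro C1 sU u(2) v(2) w(2) u'(2,3) v'(2) w'(2))+
      show ?thesis using bform_diff1[OF s(1,2)] bform_diff2[OF s(2,3)] bform_diff3[OF s(3,4)] by simp
    qed
    moreover have "(\<lambda>n. bform (\<lambda>k. ?U n k - ?u k) (?W n) (?Z n) + bform ?u (\<lambda>k. ?W n k - ?v k) (?Z n)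
       + bform ?u ?v (\<lambda>k. ?Z n k - ?w k)) \<longlonglongrightarrow> 0"
    proof (rule Lim_null_comparison)
      show "\<forall>\<^sub>F n in sequentially. norm (bform (\<lambda>k. ?U n k - ?u k) (?W n) (?Z n) + bform ?u (\<lambda>k. ?W n k - ?v k) (?Z n)
         + bform ?u ?v (\<lambda>k. ?Z n k - ?w k)) \<le>
         C * (sobn r (\<lambda>k. ?U n k - ?u k) * sobn r (?W n) * sobn r (?Z n))
         + C * (sobn r ?u * sobn r (\<lambda>k. ?W n k - ?v k) * sobn r (?Z n))
         + C * (sobn r ?u * sobn r ?v * sobn r (\<lambda>k. ?Z n k - ?w k))"
      proof (intro always_eventually allI)
        fix n
        have "\<bar>bform (\<lambda>k. ?U n k - ?u k) (?W n) (?Z n)\<bar> \<le> C * (sobn r (\<lambda>k. ?U n k - ?u k) * sobn r (?W n) * sobn r (?Z n))"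
          "\<bar>bform ?u (\<lambda>k. ?W n k - ?v k) (?Z n)\<bar> \<le> C * (sobn r ?u * sobn r (\<lambda>k. ?W n k - ?v k) * sobn r (?Z n))"
          "\<bar>bform ?u ?v (\<lambda>k. ?Z n k - ?w k)\<bar> \<le> C * (sobn r ?u * sobn r ?v * sobn r (\<lambda>k. ?Z n k - ?w k))"
          by (intro C2 sU u(2,5) v(2,5) w(2,5) u'(2,3) v'(2) w'(2))+
        then show "norm (bform (\<lambda>k. ?U n k - ?u k) (?W n) (?Z n) + bform ?u (\<lambda>k. ?W n k - ?v k) (?Z n)
         + bform ?u ?v (\<lambda>k. ?Z n k - ?w k)) \<le>
         C * (sobn r (\<lambda>k. ?U n k - ?u k) * sobn r (?W n) * sobn r (?Z n))
         + C * (sobn r ?u * sobn r (\<lambda>k. ?W n k - ?v k) * sobn r (?Z n))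
         + C * (sobn r ?u * sobn r ?v * sobn r (\<lambda>k. ?Z n k - ?w k))"
          unfolding real_norm_def by linarith
      qed
      have "(\<lambda>n. C * (sobn r (\<lambda>k. ?U n k - ?u k) * sobn r (?W n) * sobn r (?Z n))
         + C * (sobn r ?u * sobn r (\<lambda>k. ?W n k - ?v k) * sobn r (?Z n))
         + C * (sobn r ?u * sobn r ?v * sobn r (\<lambda>k. ?Z n k - ?w k)))
        \<longlonglongrightarrow> C * (0 * sobn r ?v * sobn r ?w) + C * (sobn r ?u * 0 * sobn r ?w) + C * (sobn r ?u * sobn r ?v * 0)"
        by (intro tendsto_intros u v w)
      then show "(\<lambda>n. C * (sobn r (\<lambda>k. ?U n k - ?u k) * sobn r (?W n) * sobn r (?Z n))
         + C * (sobn r ?u * sobn r (\<lambda>k. ?W n k - ?v k) * sobn r (?Z n))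
         + C * (sobn r ?u * sobn r ?v * sobn r (\<lambda>k. ?Z n k - ?w k))) \<longlonglongrightarrow> 0" by simp
    qed
    ultimately have "(\<lambda>n. bform (?U n) (?W n) (?Z n) - bform ?u ?v ?w) \<longlonglongrightarrow> 0" by simp
    then have "(\<lambda>n. bform (?U n) (?W n) (?Z n)) \<longlonglongrightarrow> bform ?u ?v ?w" by (rule LIM_zero_cancel)
    then show ?thesis by (simp add: B_smooth_eq_bform u v w)
  qed
  obtain U W Z where UWZ: "smooth_approx r U u" "smooth_approx r W v" "smooth_approx r Z w"
    using V_smooth_approx V by metis
  show ?thesis unfolding B_ext_def
  proof (rule the_equality)
    show "\<forall>U V W. smooth_approx r U u \<longrightarrow> smooth_approx r V v \<longrightarrow> smooth_approx r W w \<longrightarrow>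
      (\<lambda>n. B_smooth (U n) (V n) (W n)) \<longlonglongrightarrow> bform ?u ?v ?w" using lim by blast
    fix L assume "\<forall>U V W. smooth_approx r U u \<longrightarrow> smooth_approx r V v \<longrightarrow> smooth_approx r W w \<longrightarrow>
      (\<lambda>n. B_smooth (U n) (V n) (W n)) \<longlonglongrightarrow> L"
    then have "(\<lambda>n. B_smooth (U n) (W n) (Z n)) \<longlonglongrightarrow> L" using UWZ by blast
    then show "L = bform ?u ?v ?w" using lim[OF UWZ] LIMSEQ_unique by blast
  qed
qed

section \<open>Solutions in Fourier coefficients\<close>

text \<open>The Fourier coefficients of (a . nabla) b, before the projection onto divergence-free
  fields.\<close>

definition nlin :: "(int^3 \<Rightarrow> complex^3) \<Rightarrow> (int^3 \<Rightarrow> complex^3) \<Rightarrow> int^3 \<Rightarrow> complex^3" where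
  "nlin a b m = (\<Sum>\<^sub>\<infinity>k. advect a b m k)"

definition vcnj :: "complex^3 \<Rightarrow> complex^3" where
  "vcnj z = (\<chi> j. cnj (z $ j))"

lemma vcnj_inner: "vcnj x \<bullet> vcnj y = x \<bullet> y"
  by (simp add: vcnj_def inner_vec_def inner_complex_def)

lemma real_coeffs_iff: "real_coeffs a \<longleftrightarrow> (\<forall>k. a (- k) = vcnj (a k))"
  by (auto simp: real_coeffs_def vcnj_def vec_eq_iff)

lemma bounded_linear_vcnj: "bounded_linear vcnj"
  unfolding linear_conv_bounded_linear[symmetric]
  by (rule linearI) (simp_all add: vcnj_def vec_eq_iff)

text \<open>A slice of the double summability: a third argument supported at the single frequency m
  gives absolute convergence of every component.\<close>

lemma advect_summable:
  assumes "5/6 < r" "solenoidal a" "a \<in> sob r" "b \<in> sob r"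
  shows "advect a b m summable_on UNIV"
proof -
  have comp: "(\<lambda>k. \<bar>advect a b m k \<bullet> z\<bar>) summable_on UNIV" for z
  proof -
    let ?c = "\<lambda>k. if k = m then z else 0"
    have "?c \<in> sob r" by (rule wsp_finite_support) (auto intro: finite_subset[of _ "{m}"])
    then have "bsummable a b ?c" by (rule bsummable_sob[OF assms])
    then have "(\<lambda>p. norm (bterm a b ?c p)) summable_on ((\<lambda>k. (k, m)) ` UNIV)"
      by (rule summable_on_subset_banach) auto
    then show ?thesis by (subst (asm) summable_on_reindex) (auto simp: inj_on_def o_def bterm_def)
  qed
  have "(\<lambda>k. \<Sum>e\<in>Basis. \<bar>advect a b m k \<bullet> e\<bar>) summable_on UNIV"
    using has_sum_finite_sum[OF has_sum_infsum[OF comp]] by (rule has_sum_imp_summable)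
  then have "(\<lambda>k. norm (advect a b m k)) summable_on UNIV"
    by (rule summable_on_comparison_test) (auto simp: norm_le_l1)
  then show ?thesis by (rule abs_summable_summable)
qed

lemma bform_finite_support:
  assumes "bsummable a b c" "\<And>m. advect a b m summable_on UNIV" "finite F" "\<And>m. m \<notin> F \<Longrightarrow> c m = 0"
  shows "bform a b c = (\<Sum>m\<in>F. nlin a b m \<bullet> c m)"
proof -
  have "((\<lambda>k. advect a b m k \<bullet> c m) has_sum (nlin a b m \<bullet> c m)) UNIV" for m
    unfolding nlin_def by (intro has_sum_bounded_linear[OF bounded_linear_inner_left] has_sum_infsum assms)
  from bform_has_sum_iterated[OF assms(1) this]
  have "((\<lambda>m. nlin a b m \<bullet> c m) has_sum bform a b c) UNIV" .
  moreover have "((\<lambda>m. nlin a b m \<bullet> c m) has_sum (\<Sum>m\<in>F. nlin a b m \<bullet> c m)) UNIV"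
    by (rule has_sum_finite_neutralI) (use assms in auto)
  ultimately show ?thesis using has_sum_unique by blast
qed

text \<open>Duality: the form is tested with the sequence whose only entry, at m, is the coefficient
  to be bounded. The constant depends on m, which is enough for the continuity of single
  coefficients in time.\<close>

lemma nlin_bound:
  assumes r: "5/6 < r"
  obtains C where "C \<ge> 0" "\<And>a b. solenoidal a \<Longrightarrow> a \<in> sob r \<Longrightarrow> b \<in> sob r \<Longrightarrow>
    norm (nlin a b m) \<le> C * (sobn r a * sobn r b)"
proof -
  obtain C where C: "C \<ge> 0"
    "\<And>a b c. solenoidal a \<Longrightarrow> a \<in> sob r \<Longrightarrow> b \<in> sob r \<Longrightarrow> c \<in> sob r \<Longrightarrow>
       bsummable a b c \<and> \<bar>bform a b c\<bar> \<le> C * (sobn r a * sobn r b * sobn r c)"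
    using bform_bound[of r r r] r by auto
  let ?D = "C * jw m powr (r / 2)"
  show thesis
  proof (rule that[of ?D])
    fix a b :: "int^3 \<Rightarrow> complex^3" assume *: "solenoidal a" "a \<in> sob r" "b \<in> sob r"
    define n where "n = nlin a b m"
    let ?c = "\<lambda>k. if k = m then n else 0"
    have f: "finite {k. ?c k \<noteq> 0}" by (auto intro: finite_subset[of _ "{m}"])
    have c: "?c \<in> sob r" by (rule wsp_finite_support[OF f]) auto
    have "(sobn r ?c)\<^sup>2 \<le> (jw m powr (r / 2) * norm n)\<^sup>2"
    proof -
      have "(sobn r ?c)\<^sup>2 = (\<Sum>k | ?c k \<noteq> 0. jw k powr r * (norm (?c k))\<^sup>2)"
        by (rule wsp_finite_support(2)[OF f]) auto
      also have "\<dots> \<le> (\<Sum>k\<in>{m}. jw k powr r * (norm (?c k))\<^sup>2)" by (intro sum_mono2) auto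
      finally have "(sobn r ?c)\<^sup>2 \<le> jw m powr r * (norm n)\<^sup>2" by simp
      moreover have "(jw m powr (r / 2))\<^sup>2 = jw m powr r" by (simp add: power2_eq_square flip: powr_add)
      ultimately show ?thesis by (simp add: power_mult_distrib)
    qed
    then have cn: "sobn r ?c \<le> jw m powr (r / 2) * norm n" by (rule power2_le_imp_le) auto
    note bs = C(2)[OF * c]
    have "bform a b ?c = (\<Sum>k\<in>{m}. nlin a b k \<bullet> ?c k)"
      by (rule bform_finite_support[OF bs[THEN conjunct1] advect_summable[OF r *]]) auto
    then have "(norm n)\<^sup>2 \<le> C * (sobn r a * sobn r b * sobn r ?c)"
      using bs by (simp add: n_def power2_norm_eq_inner)
    also have "\<dots> \<le> C * (sobn r a * sobn r b * (jw m powr (r / 2) * norm n))"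
      using C(1) by (intro mult_left_mono cn) auto
    finally have "norm n * norm n \<le> (?D * (sobn r a * sobn r b)) * norm n"
      by (simp add: power2_eq_square mult_ac)
    then show "norm (nlin a b m) \<le> ?D * (sobn r a * sobn r b)"
      using C(1) by (cases "n = 0") (auto simp: n_def)
  qed (use C in auto)
qed

lemma nlin_diff:
  assumes "advect a b m summable_on UNIV" "advect a' b' m summable_on UNIV" "advect a' b m summable_on UNIV"
  shows "nlin a b m - nlin a' b' m = nlin (\<lambda>k. a k - a' k) b m + nlin a' (\<lambda>k. b k - b' k) m"
proof -
  have *: "(\<Sum>\<^sub>\<infinity>k. f k - g k) = infsum f UNIV - infsum g UNIV"
    if "f summable_on UNIV" "g summable_on UNIV" for f g :: "int^3 \<Rightarrow> complex^3"
    using infsum_add[of f UNIV "\<lambda>k. - g k"] that by (simp add: infsum_uminus summable_on_uminus)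
  have "nlin (\<lambda>k. a k - a' k) b m = (\<Sum>\<^sub>\<infinity>k. advect a b m k - advect a' b m k)"
    unfolding nlin_def advect_def
    by (intro infsum_cong) (simp add: cdot_diff_left ring_distribs vector_sub_rdistrib)
  moreover have "nlin a' (\<lambda>k. b k - b' k) m = (\<Sum>\<^sub>\<infinity>k. advect a' b m k - advect a' b' m k)"
    unfolding nlin_def advect_def
    by (intro infsum_cong) (simp add: vector_ssub_ldistrib)
  ultimately show ?thesis using *[OF assms(1,3)] *[OF assms(3,2)] by (simp add: nlin_def)
qed

lemma real_coeffs_nlin:
  assumes "real_coeffs a" "real_coeffs b" "\<And>m. advect a b m summable_on UNIV"
  shows "real_coeffs (nlin a b)"
  unfolding real_coeffs_iff
proof
  fix m
  have adv: "advect a b (- m) (- k) = vcnj (advect a b m k)" for k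
  proof -
    have "b (- m - - k) = vcnj (b (m - k))" using assms(2) real_coeffs_iff[of b] by (metis minus_diff_minus)
    moreover have "cdot (a (- k)) (- m - - k) = - cnj (cdot (a k) (m - k))"
      using assms(1) by (simp add: cdot_def real_coeffs_def minus_diff_minus[symmetric] sum_negf[symmetric] del: minus_diff_minus) (simp add: algebra_simps)
    ultimately show ?thesis by (simp add: advect_def vcnj_def vec_eq_iff)
  qed
  have "(advect a b m has_sum nlin a b m) UNIV" unfolding nlin_def using assms(3) by simp
  from has_sum_bounded_linear[OF bounded_linear_vcnj this]
  have "((\<lambda>k. advect a b (- m) (- k)) has_sum vcnj (nlin a b m)) UNIV" by (simp add: adv)
  moreover have "bij_betw uminus UNIV (UNIV :: (int^3) set)" by (rule bij_uminus)
  ultimately have "(advect a b (- m) has_sum vcnj (nlin a b m)) UNIV"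
    using has_sum_reindex_bij_betw by blast
  then show "nlin a b (- m) = vcnj (nlin a b m)" unfolding nlin_def by (rule infsumI)
qed

lemma nlin_0:
  assumes "solenoidal a"
  shows "nlin a b 0 = 0"
proof -
  have "advect a b 0 k = 0" for k
    using assms cdot_diff[of "a k" 0 k] by (simp add: advect_def solenoidal_def cdot_def)
  then show ?thesis by (simp add: nlin_def)
qed

section \<open>Real single-mode test fields\<close>

definition mode :: "int^3 \<Rightarrow> complex^3 \<Rightarrow> field" where
  "mode m a x = (\<chi> j. Re (a $ j * em m x))"

lemma fourier_mode:
  assumes "m \<noteq> 0"
  shows "fourier (mode m a) k = (if k = m then (1/2) *\<^sub>R a else if k = - m then (1/2) *\<^sub>R vcnj a else 0)"
proof -
  have ne: "m \<noteq> - m" using assms by (auto simp: vec_eq_iff)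
  have "cip (coord (mode m a) j) (em k) = (a $ j / 2) * cip (em m) (em k) + (cnj (a $ j) / 2) * cip (em (- m)) (em k)" for j
  proof -
    have "coord (mode m a) j = (\<lambda>x. (a $ j / 2) * em m x + (cnj (a $ j) / 2) * em (- m) x)"
      by (rule ext) (simp add: mode_def em_minus complex_eq_iff diff_divide_distrib add_divide_distrib)
    moreover have "integrable cubeM (\<lambda>x. em l x * cnj (em k x))" for l
      by (intro sq_integrable_mult sq_integrable_em)
    ultimately show ?thesis
      by (simp add: cip_def ring_distribs mult.assoc)
  qed
  then show ?thesis using ne by (auto simp: vec_eq_iff fourier_nth cip_em vcnj_def scaleR_conv_of_real[of _ "_ :: complex"])
qed

lemma mode_has_derivative:
  "(mode m a has_derivative (\<lambda>h. mode m ((2 * of_real pi * \<i> * of_real (ivec m \<bullet> h)) *s a) x)) (at x)"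
proof -
  have L: "bounded_linear (\<lambda>z. (\<chi> j. Re (a $ j * z)))"
    unfolding linear_conv_bounded_linear[symmetric]
    by (rule linearI) (simp_all add: vec_eq_iff ring_distribs)
  have "(em m has_derivative (\<lambda>h. em m x * (2 * of_real pi * \<i> * of_real (ivec m \<bullet> h)))) (at x)"
  proof -
    have "bounded_linear (\<lambda>h. 2 * of_real pi * \<i> * complex_of_real (ivec m \<bullet> h))"
      by (intro bounded_linear_const_mult bounded_linear_compose[OF bounded_linear_of_real] bounded_linear_inner_right)
    from has_derivative_compose[OF bounded_linear_imp_has_derivative[OF this] DERIV_exp[unfolded has_field_derivative_def]]
    show ?thesis unfolding em_def .
  qed
  from bounded_linear.has_derivative[OF L this]
  show ?thesis unfolding mode_def[abs_def] by (simp add: mult_ac)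
qed

lemma partial_deriv_mode: "partial_deriv i (mode m a) = mode m ((2 * of_real pi * \<i> * of_int (m $ i)) *s a)"
  unfolding partial_deriv_def frechet_derivative_at[OF mode_has_derivative, symmetric]
  by (simp add: inner_axis)

lemma Ck_mode: "Ck_field n (mode m a)"
proof (induction n arbitrary: a)
  case 0
  show ?case unfolding Ck_field.simps mode_def[abs_def]
    by (intro continuous_on_vec_lambda continuous_intros continuous_em)
next
  case (Suc n)
  have "mode m a differentiable_on UNIV"
    unfolding differentiable_on_def using mode_has_derivative by (auto simp: differentiable_def)
  then show ?case by (simp add: partial_deriv_mode Suc)
qed

lemma mode_smooth:
  assumes "m \<noteq> 0" "cdot a m = 0"
  shows "mode m a \<in> smooth_solenoidal"
proof -
  have "periodic (mode m a)"
    using em_periodic[of m] by (simp add: periodic_def lattice_periodic_def mode_def)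
  moreover have "divergence (mode m a) x = 0" for x
  proof -
    have "divergence (mode m a) x = Re (2 * of_real pi * \<i> * em m x * cdot a m)"
      unfolding divergence_def partial_deriv_mode cdot_def sum_distrib_left Re_sum
      by (intro sum.cong refl) (simp only: mode_def vec_lambda_beta vector_smult_component, simp only: mult_ac)
    then show ?thesis using assms by simp
  qed
  moreover have "(LINT x:unit_cube|lborel. mode m a x) = 0"
  proof -
    have L: "bounded_linear (\<lambda>z. (\<chi> j. Re (a $ j * z)) :: real^3)"
      unfolding linear_conv_bounded_linear[symmetric]
      by (rule linearI) (simp_all add: vec_eq_iff ring_distribs)
    have "integrable cubeM (em m)" by (intro continuous_integrable_cubeM continuous_em)
    from integral_bounded_linear[OF L this]
    have "(LINT x|cubeM. mode m a x) = (\<chi> j. Re (a $ j * (LINT x|cubeM. em m x)))"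
      unfolding mode_def .
    moreover have "(LINT x|cubeM. em m x) = 0" using assms(1) by (simp only: integral_em if_False)
    ultimately show ?thesis by (simp add: set_integral_cube vec_eq_iff)
  qed
  ultimately show ?thesis by (simp add: smooth_solenoidal_def Ck_mode)
qed

lemma smooth_in_V:
  assumes "\<phi> \<in> smooth_solenoidal" "r \<le> 1"
  shows "\<phi> \<in> V r"
proof -
  have "fourier (\<phi> - \<phi>) = (\<lambda>k. 0)" using fourier_diff_fun[of \<phi> \<phi>] smooth_L2[OF assms(1)] by simp
  then have "Hs_norm r (\<phi> - \<phi>) = 0" by (simp add: Hs_norm_eq wnorm_def)
  then show ?thesis using assms smooth_in_sob[OF assms] smooth_L2[OF assms(1)]
    unfolding V_def Hs_iff by (auto intro!: bexI[of _ \<phi>])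
qed

text \<open>The coefficients of \<open>mode m a\<close> are half of a at m and half of its conjugate
  at -m. By reality of c and evenness of q both frequencies contribute the same, which removes the
  factor 1/2.\<close>

lemma mode_pairing:
  assumes "real_coeffs c" "m \<noteq> 0" "q (- m) = q m"
  shows "((\<lambda>k. q k * (c k \<bullet> fourier (mode m a) k)) has_sum (q m * (c m \<bullet> a))) UNIV"
proof (rule has_sum_finite_neutralI[of "{m, - m}"])
  have ne: "m \<noteq> - m" using assms by (auto simp: vec_eq_iff)
  have "c (- m) \<bullet> vcnj a = c m \<bullet> a" using assms(1) by (simp add: real_coeffs_iff vcnj_inner)
  then show "q m * (c m \<bullet> a) = (\<Sum>k\<in>{m, - m}. q k * (c k \<bullet> fourier (mode m a) k))"
    using ne assms(2,3) by (simp add: fourier_mode)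
qed (use assms in \<open>auto simp: fourier_mode\<close>)

text \<open>The symbol of the Leray projection, which removes the component along m. Testing only
  sees directions with \<open>cdot a m = 0\<close>; this map turns the tested identity into a
  formula for the coefficient itself.\<close>

definition leray :: "int^3 \<Rightarrow> complex^3 \<Rightarrow> complex^3" where
  "leray m z = z - (cdot z m / of_real ((norm (ivec m))\<^sup>2)) *s (\<chi> j. of_int (m $ j))"

lemma bounded_linear_leray: "bounded_linear (leray m)"
proof -
  have "cdot (x + y) m = cdot x m + cdot y m" "cdot (c *\<^sub>R x) m = of_real c * cdot x m" for x y c
    by (simp_all add: cdot_def ring_distribs sum.distrib sum_distrib_left scaleR_conv_of_real[of _ "_ :: complex"] mult_ac)
  then show ?thesis
    unfolding linear_conv_bounded_linear[symmetric]
    by (intro linearI)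
       (simp_all add: leray_def vec_eq_iff add_divide_distrib ring_distribs scaleR_conv_of_real[of _ "_ :: complex"])
qed

lemma cdot_leray:
  assumes "m \<noteq> 0"
  shows "cdot (leray m z) m = 0"
proof -
  let ?N = "complex_of_real ((norm (ivec m))\<^sup>2)"
  define q where "q = cdot z m / ?N"
  have N: "?N = (\<Sum>j\<in>UNIV. of_int (m $ j) * of_int (m $ j))"
    by (simp add: norm_vec_def L2_set_def sum_nonneg power2_eq_square)
  have "cdot (leray m z) m = cdot z m - q * (\<Sum>j\<in>UNIV. of_int (m $ j) * of_int (m $ j))"
    unfolding leray_def q_def[symmetric]
    by (simp add: cdot_def ring_distribs sum_subtractf sum_distrib_left mult_ac)
  then show ?thesis using assms unfolding N[symmetric] by (simp add: q_def)
qed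

lemma inner_leray:
  assumes "cdot w m = 0"
  shows "leray m z \<bullet> w = z \<bullet> w"
proof -
  have "(\<Sum>j\<in>UNIV. of_int (m $ j) * cnj (w $ j)) = cnj (cdot w m)" by (simp add: cdot_def mult.commute)
  then show ?thesis using assms by (simp add: leray_def inner_diff_left inner_smult_complex)
qed

text \<open>What a continuous curve in \<open>V r\<close> says about its Fourier coefficients. The
  equation is kept out so that the difference of two solutions is again such a curve.\<close>

definition vflow :: "real \<Rightarrow> real \<Rightarrow> (real \<Rightarrow> int^3 \<Rightarrow> complex^3) \<Rightarrow> bool" where
  "vflow r T a \<longleftrightarrow> (\<forall>t\<in>{0..T}. a t \<in> sob r \<and> solenoidal (a t) \<and> real_coeffs (a t) \<and> a t 0 = 0) \<and>
     (\<forall>t\<in>{0..T}. ((\<lambda>\<tau>. sobn r (\<lambda>k. a \<tau> k - a t k)) \<longlongrightarrow> 0) (at t within {0..T}))"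

text \<open>Testing only with \<open>w \<cdot> m = 0\<close> takes the place of the Leray projection.\<close>

definition voigt_flow :: "real \<Rightarrow> real \<Rightarrow> real \<Rightarrow> real \<Rightarrow> (real \<Rightarrow> int^3 \<Rightarrow> complex^3) \<Rightarrow> bool" where
  "voigt_flow \<alpha> \<nu> r T a \<longleftrightarrow> vflow r T a \<and>
     (\<forall>m. \<exists>D. continuous_on {0..T} D \<and> (\<forall>t\<in>{0..T}. ((\<lambda>\<tau>. a \<tau> m) has_vector_derivative D t) (at t within {0..T}) \<and>
       (\<forall>w. cdot w m = 0 \<longrightarrow> (1 + \<alpha> powr (2 * r) * stokes_eigenvalue m powr r) * (D t \<bullet> w)
          = - ((nlin (a t) (a t) m + (\<nu> * stokes_eigenvalue m) *\<^sub>R a t m) \<bullet> w))))"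

lemma vflow_continuous:
  assumes "vflow r T a"
  shows "continuous_on {0..T} (\<lambda>t. a t m)"
  unfolding continuous_on_def
proof
  fix t assume t: "t \<in> {0..T}"
  have S: "a \<tau> \<in> sob r" if "\<tau> \<in> {0..T}" for \<tau> using assms that by (simp add: vflow_def)
  have le: "norm (a \<tau> m - a t m) \<le> sobn r (\<lambda>k. a \<tau> k - a t k) / jw m powr (r / 2)" if "\<tau> \<in> {0..T}" for \<tau>
  proof -
    have "(\<lambda>k. a \<tau> k - a t k) \<in> sob r" using S[OF t] S[OF that] by (intro wnorm_diff) auto
    from wnorm_component_le[OF _ this, of m]
    have "jw m powr r * (norm (a \<tau> m - a t m))\<^sup>2 \<le> (sobn r (\<lambda>k. a \<tau> k - a t k))\<^sup>2" by simp
    moreover have "(jw m powr (r / 2))\<^sup>2 = jw m powr r" by (simp add: power2_eq_square flip: powr_add)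
    ultimately have "(jw m powr (r / 2) * norm (a \<tau> m - a t m))\<^sup>2 \<le> (sobn r (\<lambda>k. a \<tau> k - a t k))\<^sup>2"
      by (simp add: power_mult_distrib)
    then have "jw m powr (r / 2) * norm (a \<tau> m - a t m) \<le> sobn r (\<lambda>k. a \<tau> k - a t k)"
      by (rule power2_le_imp_le) auto
    then show ?thesis by (simp add: field_simps)
  qed
  have "((\<lambda>\<tau>. sobn r (\<lambda>k. a \<tau> k - a t k) / jw m powr (r / 2)) \<longlongrightarrow> 0 / jw m powr (r / 2)) (at t within {0..T})"
    using assms t by (intro tendsto_intros) (auto simp: vflow_def)
  then have "((\<lambda>\<tau>. sobn r (\<lambda>k. a \<tau> k - a t k) / jw m powr (r / 2)) \<longlongrightarrow> 0) (at t within {0..T})" by simp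
  moreover have "\<forall>\<^sub>F \<tau> in at t within {0..T}. norm (a \<tau> m - a t m) \<le> sobn r (\<lambda>k. a \<tau> k - a t k) / jw m powr (r / 2)"
    using le by (auto simp: eventually_at_filter)
  ultimately have "((\<lambda>\<tau>. a \<tau> m - a t m) \<longlongrightarrow> 0) (at t within {0..T})"
    by (rule Lim_null_comparison[rotated])
  then show "((\<lambda>\<tau>. a \<tau> m) \<longlongrightarrow> a t m) (at t within {0..T})" by (rule LIM_zero_cancel)
qed

lemma vflow_norm_continuous:
  assumes "vflow r T a"
  shows "continuous_on {0..T} (\<lambda>t. sobn r (a t))"
  unfolding continuous_on_def
proof
  fix t assume t: "t \<in> {0..T}"
  have S: "a \<tau> \<in> sob r" if "\<tau> \<in> {0..T}" for \<tau> using assms that by (simp add: vflow_def)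
  have "((\<lambda>\<tau>. sobn r (\<lambda>k. a \<tau> k - a t k)) \<longlongrightarrow> 0) (at t within {0..T})"
    using assms t by (auto simp: vflow_def)
  moreover have "\<forall>\<^sub>F \<tau> in at t within {0..T}. norm (sobn r (a \<tau>) - sobn r (a t)) \<le> sobn r (\<lambda>k. a \<tau> k - a t k)"
    using wnorm_diff(3)[OF _ S S[OF t], of _] by (auto simp: eventually_at_filter)
  ultimately have "((\<lambda>\<tau>. sobn r (a \<tau>) - sobn r (a t)) \<longlongrightarrow> 0) (at t within {0..T})"
    by (rule Lim_null_comparison[rotated])
  then show "((\<lambda>\<tau>. sobn r (a \<tau>)) \<longlongrightarrow> sobn r (a t)) (at t within {0..T})" by (rule LIM_zero_cancel)
qed

lemma nlin_continuous:
  assumes r: "5/6 < r" and a: "vflow r T a"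
  shows "continuous_on {0..T} (\<lambda>t. nlin (a t) (a t) m)"
  unfolding continuous_on_def
proof
  fix t assume t: "t \<in> {0..T}"
  obtain C where C: "C \<ge> 0" "\<And>a b. solenoidal a \<Longrightarrow> a \<in> sob r \<Longrightarrow> b \<in> sob r \<Longrightarrow>
      norm (nlin a b m) \<le> C * (sobn r a * sobn r b)"
    using nlin_bound[OF r] by blast
  have S: "a \<tau> \<in> sob r" "solenoidal (a \<tau>)" if "\<tau> \<in> {0..T}" for \<tau> using a that by (auto simp: vflow_def)
  let ?d = "\<lambda>\<tau> k. a \<tau> k - a t k"
  have le: "norm (nlin (a \<tau>) (a \<tau>) m - nlin (a t) (a t) m)
    \<le> C * (sobn r (?d \<tau>) * sobn r (a \<tau>)) + C * (sobn r (a t) * sobn r (?d \<tau>))" if \<tau>: "\<tau> \<in> {0..T}" for \<tau>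
  proof -
    have d: "?d \<tau> \<in> sob r" "solenoidal (?d \<tau>)"
      using S[OF t] S[OF \<tau>] by (auto intro: wnorm_diff simp: solenoidal_def cdot_diff_left)
    have "nlin (a \<tau>) (a \<tau>) m - nlin (a t) (a t) m = nlin (?d \<tau>) (a \<tau>) m + nlin (a t) (?d \<tau>) m"
      by (intro nlin_diff advect_summable[OF r] S t \<tau>)
    also have "norm \<dots> \<le> norm (nlin (?d \<tau>) (a \<tau>) m) + norm (nlin (a t) (?d \<tau>) m)" by (rule norm_triangle_ineq)
    also have "\<dots> \<le> C * (sobn r (?d \<tau>) * sobn r (a \<tau>)) + C * (sobn r (a t) * sobn r (?d \<tau>))"
      by (intro add_mono C(2) S t \<tau> d)
    finally show ?thesis .
  qed
  have "((\<lambda>\<tau>. sobn r (?d \<tau>)) \<longlongrightarrow> 0) (at t within {0..T})" "((\<lambda>\<tau>. sobn r (a \<tau>)) \<longlongrightarrow> sobn r (a t)) (at t within {0..T})"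
    using a t vflow_norm_continuous[OF a] by (auto simp: vflow_def continuous_on_def)
  then have "((\<lambda>\<tau>. C * (sobn r (?d \<tau>) * sobn r (a \<tau>)) + C * (sobn r (a t) * sobn r (?d \<tau>))) \<longlongrightarrow>
     C * (0 * sobn r (a t)) + C * (sobn r (a t) * 0)) (at t within {0..T})"
    by (intro tendsto_intros)
  then have "((\<lambda>\<tau>. C * (sobn r (?d \<tau>) * sobn r (a \<tau>)) + C * (sobn r (a t) * sobn r (?d \<tau>))) \<longlongrightarrow> 0) (at t within {0..T})"
    by simp
  moreover have "\<forall>\<^sub>F \<tau> in at t within {0..T}. norm (nlin (a \<tau>) (a \<tau>) m - nlin (a t) (a t) m)
    \<le> C * (sobn r (?d \<tau>) * sobn r (a \<tau>)) + C * (sobn r (a t) * sobn r (?d \<tau>))"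
    using le by (auto simp: eventually_at_filter)
  ultimately have "((\<lambda>\<tau>. nlin (a \<tau>) (a \<tau>) m - nlin (a t) (a t) m) \<longlongrightarrow> 0) (at t within {0..T})"
    by (rule Lim_null_comparison[rotated])
  then show "((\<lambda>\<tau>. nlin (a \<tau>) (a \<tau>) m) \<longlongrightarrow> nlin (a t) (a t) m) (at t within {0..T})" by (rule LIM_zero_cancel)
qed

lemma vflow_fourier:
  assumes "C_time T r (V r) u" "r \<le> 1"
  shows "vflow r T (\<lambda>t. fourier (u t))"
proof -
  have V: "u t \<in> V r" if "t \<in> {0..T}" for t using assms that by (auto simp: C_time_def)
  have "((\<lambda>\<tau>. sobn r (\<lambda>k. fourier (u \<tau>) k - fourier (u t) k)) \<longlongrightarrow> 0) (at t within {0..T})" if t: "t \<in> {0..T}" for t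
  proof -
    have "((\<lambda>\<tau>. Hs_norm r (u \<tau> - u t)) \<longlongrightarrow> 0) (at t within {0..T})" using assms t by (auto simp: C_time_def)
    moreover have "\<forall>\<^sub>F \<tau> in at t within {0..T}. Hs_norm r (u \<tau> - u t) = sobn r (\<lambda>k. fourier (u \<tau>) k - fourier (u t) k)"
      using fourier_diff_fun[OF V_basic(1)[OF V] V_basic(1)[OF V[OF t]]]
      by (auto simp: eventually_at_filter Hs_norm_eq)
    ultimately show ?thesis by (rule Lim_transform_eventually)
  qed
  then show ?thesis using V V_basic(2) V_fourier[OF V assms(2)] real_coeffs_fourier
    unfolding vflow_def by blast
qed

text \<open>Tested with a single mode, every pairing collapses to the frequency m. The increment of
  the coefficient, multiplied by the symbol, is then minus a time integral in all directions
  orthogonal to m. The integrand is continuous, so the fundamental theorem of calculus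
  applies.\<close>

theorem voigt_flow_fourier:
  assumes r: "5/6 < r" "r \<le> 1" and \<alpha>: "\<alpha> > 0" and u: "C_time T r (V r) u"
    and eq: "\<And>v t. v \<in> V 1 \<inter> V r \<Longrightarrow> t \<in> {0..T} \<Longrightarrow>
        voigt_pairing \<alpha> r (u t - u 0) v + (LINT \<tau>:{0..t}|lborel. B_ext r (u \<tau>) (u \<tau>) v)
        + \<nu> * (LINT \<tau>:{0..t}|lborel. stokes_pairing 1 (u \<tau>) v) = 0"
  shows "voigt_flow \<alpha> \<nu> r T (\<lambda>t. fourier (u t))"
  unfolding voigt_flow_def
proof (intro conjI allI)
  note fl = vflow_fourier[OF u r(2)]
  show "vflow r T (\<lambda>t. fourier (u t))" by (rule fl)
  let ?a = "\<lambda>t. fourier (u t)"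
  have V: "u t \<in> V r" if "t \<in> {0..T}" for t using u that by (auto simp: C_time_def)
  have S: "?a t \<in> sob r" "solenoidal (?a t)" "real_coeffs (?a t)" "?a t 0 = 0" if "t \<in> {0..T}" for t
    using fl that by (auto simp: vflow_def)
  fix m :: "int^3"
  define \<mu> where "\<mu> = 1 + \<alpha> powr (2 * r) * stokes_eigenvalue m powr r"
  have \<mu>: "\<mu> > 0" unfolding \<mu>_def by (simp add: add_pos_nonneg)
  define G where "G = (\<lambda>t. nlin (?a t) (?a t) m + (\<nu> * stokes_eigenvalue m) *\<^sub>R ?a t m)"
  have Gc: "continuous_on {0..T} G"
    unfolding G_def by (intro continuous_intros nlin_continuous[OF r(1) fl] vflow_continuous[OF fl])
  show "\<exists>D. continuous_on {0..T} D \<and> (\<forall>t\<in>{0..T}. ((\<lambda>\<tau>. ?a \<tau> m) has_vector_derivative D t) (at t within {0..T}) \<and>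
       (\<forall>w. cdot w m = 0 \<longrightarrow> (1 + \<alpha> powr (2 * r) * stokes_eigenvalue m powr r) * (D t \<bullet> w)
          = - ((nlin (?a t) (?a t) m + (\<nu> * stokes_eigenvalue m) *\<^sub>R ?a t m) \<bullet> w)))"
    unfolding \<mu>_def[symmetric]
  proof (cases "m = 0")
    case True
    have "((\<lambda>\<tau>. ?a \<tau> m) has_vector_derivative 0) (at t within {0..T})" if "t \<in> {0..T}" for t
    proof (rule has_vector_derivative_transform[OF that _ has_vector_derivative_const[of 0]])
      show "\<And>\<tau>. \<tau> \<in> {0..T} \<Longrightarrow> ?a \<tau> m = 0" using S(4) True by simp
    qed
    then show "\<exists>D. continuous_on {0..T} D \<and> (\<forall>t\<in>{0..T}. ((\<lambda>\<tau>. ?a \<tau> m) has_vector_derivative D t) (at t within {0..T}) \<and>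
       (\<forall>w. cdot w m = 0 \<longrightarrow> \<mu> * (D t \<bullet> w)
          = - ((nlin (?a t) (?a t) m + (\<nu> * stokes_eigenvalue m) *\<^sub>R ?a t m) \<bullet> w)))"
      using S True by (intro exI[of _ "\<lambda>_. 0"]) (simp add: nlin_0)
  next
    case False
    have test: "\<mu> * ((?a t m - ?a 0 m) \<bullet> a) + integral {0..t} G \<bullet> a = 0" if t: "t \<in> {0..T}" and a: "cdot a m = 0" for t a
    proof -
      let ?v = "mode m a"
      have T0: "0 \<in> {0..T}" using t by auto
      have sm: "?v \<in> smooth_solenoidal" by (rule mode_smooth[OF False a])
      have v: "?v \<in> V 1 \<inter> V r" using smooth_in_V[OF sm] r by auto
      note L2 = V_basic(1)[OF V[OF t]] V_basic(1)[OF V[OF T0]]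
      have d: "fourier (u t - u 0) = (\<lambda>k. ?a t k - ?a 0 k)" by (rule fourier_diff_fun[OF L2])
      have "((\<lambda>k. 1 * (fourier (u t - u 0) k \<bullet> fourier ?v k)) has_sum (1 * (fourier (u t - u 0) m \<bullet> a))) UNIV"
        by (rule mode_pairing[OF real_coeffs_fourier False]) simp
      with parseval_field[OF L2_field_diff[OF L2] smooth_L2(1)[OF sm]]
      have p1: "L2_inner (u t - u 0) ?v = fourier (u t - u 0) m \<bullet> a"
        using has_sum_unique by fastforce
      have even: "stokes_eigenvalue (- k) = stokes_eigenvalue k" for k by (simp add: stokes_eigenvalue_def)
      have p2: "stokes_pairing q f ?v = stokes_eigenvalue m powr q * (fourier f m \<bullet> a)" for q f
        unfolding stokes_pairing_def
        using mode_pairing[OF real_coeffs_fourier False, of "\<lambda>k. stokes_eigenvalue k powr q"] even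
        by (intro infsumI) simp
      have p: "voigt_pairing \<alpha> r (u t - u 0) ?v = \<mu> * ((?a t m - ?a 0 m) \<bullet> a)"
        unfolding voigt_pairing_def p1 p2 \<mu>_def d by (simp add: ring_distribs)
      have B: "B_ext r (u \<tau>) (u \<tau>) ?v = nlin (?a \<tau>) (?a \<tau>) m \<bullet> a" if \<tau>: "\<tau> \<in> {0..T}" for \<tau>
      proof -
        have sum: "advect (?a \<tau>) (?a \<tau>) m summable_on UNIV" for m by (intro advect_summable[OF r(1)] S \<tau>)
        have "bsummable (?a \<tau>) (?a \<tau>) (fourier ?v)"
          by (rule bsummable_sob[OF r(1) S(2,1,1)[OF \<tau>] smooth_in_sob[OF sm r(2)]])
        then have "bform (?a \<tau>) (?a \<tau>) (fourier ?v) = (\<Sum>k\<in>{m, - m}. nlin (?a \<tau>) (?a \<tau>) k \<bullet> fourier ?v k)"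
          by (rule bform_finite_support[OF _ sum]) (auto simp: fourier_mode[OF False])
        moreover have "((\<lambda>k. 1 * (nlin (?a \<tau>) (?a \<tau>) k \<bullet> fourier ?v k)) has_sum (1 * (nlin (?a \<tau>) (?a \<tau>) m \<bullet> a))) UNIV"
          by (rule mode_pairing[OF real_coeffs_nlin[OF S(3)[OF \<tau>] S(3)[OF \<tau>] sum] False]) simp
        moreover have "((\<lambda>k. 1 * (nlin (?a \<tau>) (?a \<tau>) k \<bullet> fourier ?v k)) has_sum (\<Sum>k\<in>{m, - m}. nlin (?a \<tau>) (?a \<tau>) k \<bullet> fourier ?v k)) UNIV"
          by (rule has_sum_finite_neutralI) (auto simp: fourier_mode[OF False])
        ultimately have "bform (?a \<tau>) (?a \<tau>) (fourier ?v) = nlin (?a \<tau>) (?a \<tau>) m \<bullet> a"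
          using has_sum_unique by fastforce
        then show ?thesis using B_ext_eq_bform[OF r V[OF \<tau>] V[OF \<tau>]] v by simp
      qed
      have sub: "{0..t} \<subseteq> {0..T}" using t by auto
      note cn = continuous_on_subset[OF nlin_continuous[OF r(1) fl, of m] sub]
        and ca = continuous_on_subset[OF vflow_continuous[OF fl, of m] sub]
        and cG = continuous_on_subset[OF Gc sub]
      have I: "set_integrable lborel {0..t} f" "(LINT \<tau>:{0..t}|lborel. f \<tau>) = integral {0..t} f"
        if "continuous_on {0..t} f" for f :: "real \<Rightarrow> real"
      proof -
        show i: "set_integrable lborel {0..t} f"
          unfolding set_integrable_def by (rule borel_integrable_compact) (use that in auto)
        show "(LINT \<tau>:{0..t}|lborel. f \<tau>) = integral {0..t} f"
          by (rule set_borel_integral_eq_integral(2)[OF i])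
      qed
      have "(LINT \<tau>:{0..t}|lborel. B_ext r (u \<tau>) (u \<tau>) ?v) = (LINT \<tau>:{0..t}|lborel. nlin (?a \<tau>) (?a \<tau>) m \<bullet> a)"
        by (rule set_lebesgue_integral_cong) (use B sub in auto)
      also have "\<dots> = integral {0..t} (\<lambda>\<tau>. nlin (?a \<tau>) (?a \<tau>) m \<bullet> a)"
        by (rule I) (intro continuous_intros cn)
      finally have 1: "(LINT \<tau>:{0..t}|lborel. B_ext r (u \<tau>) (u \<tau>) ?v) = integral {0..t} (\<lambda>\<tau>. nlin (?a \<tau>) (?a \<tau>) m \<bullet> a)" .
      have 2: "(LINT \<tau>:{0..t}|lborel. stokes_pairing 1 (u \<tau>) ?v) = integral {0..t} (\<lambda>\<tau>. stokes_eigenvalue m * (?a \<tau> m \<bullet> a))"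
        unfolding p2 by (subst I) (auto intro!: continuous_intros ca simp: stokes_eigenvalue_def powr_one)
      have "integral {0..t} G \<bullet> a = integral {0..t} (\<lambda>\<tau>. G \<tau> \<bullet> a)"
        using integral_linear[OF integrable_continuous_interval[OF cG] bounded_linear_inner_left[of a]] by (simp add: o_def)
      also have "\<dots> = integral {0..t} (\<lambda>\<tau>. nlin (?a \<tau>) (?a \<tau>) m \<bullet> a + \<nu> * (stokes_eigenvalue m * (?a \<tau> m \<bullet> a)))"
        by (simp add: G_def inner_add_left mult.assoc)
      also have "\<dots> = integral {0..t} (\<lambda>\<tau>. nlin (?a \<tau>) (?a \<tau>) m \<bullet> a) + integral {0..t} (\<lambda>\<tau>. \<nu> * (stokes_eigenvalue m * (?a \<tau> m \<bullet> a)))"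
        by (intro Henstock_Kurzweil_Integration.integral_add integrable_continuous_interval continuous_intros cn ca)
      also have "integral {0..t} (\<lambda>\<tau>. \<nu> * (stokes_eigenvalue m * (?a \<tau> m \<bullet> a)))
         = \<nu> * integral {0..t} (\<lambda>\<tau>. stokes_eigenvalue m * (?a \<tau> m \<bullet> a))"
        by (rule integral_mult_right)
      finally show ?thesis using eq[OF v t] p 1 2 by simp
    qed
    have sol: "?a t m = ?a 0 m + (- 1 / \<mu>) *\<^sub>R leray m (integral {0..t} G)" if t: "t \<in> {0..T}" for t
    proof -
      have T0: "0 \<in> {0..T}" using t by auto
      \<comment> \<open>\<open>x\<close> satisfies \<open>cdot x m = 0\<close>, so the tested
        identity may be applied with \<open>x\<close> itself and yields
        \<open>x \<bullet> x = 0\<close>.\<close>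
      define x where "x = \<mu> *\<^sub>R (?a t m - ?a 0 m) + leray m (integral {0..t} G)"
      have "cdot (?a t m) m = 0" "cdot (?a 0 m) m = 0" using S(2)[OF t] S(2)[OF T0] by (auto simp: solenoidal_def)
      then have "cdot x m = 0" unfolding x_def
        using cdot_leray[OF False, of "integral {0..t} G"]
        by (simp add: cdot_def ring_distribs sum.distrib sum_subtractf scaleR_conv_of_real[of _ "_ :: complex"] flip: sum_distrib_left mult.assoc)
           (simp add: mult.assoc flip: sum_distrib_left)
      then have "x \<bullet> x = 0"
        using test[OF t, of x] inner_leray[of x m "integral {0..t} G"]
        by (subst x_def) (simp add: inner_add_left inner_diff_left)
      then have "leray m (integral {0..t} G) = - (\<mu> *\<^sub>R (?a t m - ?a 0 m))" by (simp add: x_def eq_neg_iff_add_eq_0 add.commute)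
      then show ?thesis using \<mu> by simp
    qed
    define D where "D = (\<lambda>t. (- 1 / \<mu>) *\<^sub>R leray m (G t))"
    have "((\<lambda>\<tau>. ?a \<tau> m) has_vector_derivative D t) (at t within {0..T})" if t: "t \<in> {0..T}" for t
    proof (rule has_vector_derivative_transform[OF t])
      show "\<And>\<tau>. \<tau> \<in> {0..T} \<Longrightarrow> ?a \<tau> m = ?a 0 m + (- 1 / \<mu>) *\<^sub>R leray m (integral {0..\<tau>} G)" by (rule sol)
      have "((\<lambda>\<tau>. integral {0..\<tau>} G) has_vector_derivative G t) (at t within {0..T})"
        by (rule integral_has_vector_derivative[OF Gc t])
      from bounded_linear.has_vector_derivative[OF bounded_linear_leray this]
      show "((\<lambda>\<tau>. ?a 0 m + (- 1 / \<mu>) *\<^sub>R leray m (integral {0..\<tau>} G)) has_vector_derivative D t) (at t within {0..T})"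
        unfolding D_def by (auto intro!: derivative_eq_intros)
    qed
    moreover have "\<mu> * (D t \<bullet> w) = - (G t \<bullet> w)" if "cdot w m = 0" for t w
      using \<mu> inner_leray[OF that] by (simp add: D_def)
    moreover have "continuous_on {0..T} D"
      unfolding D_def by (intro continuous_intros linear_continuous_on_compose[OF Gc] bounded_linear.linear[OF bounded_linear_leray])
    ultimately show "\<exists>D. continuous_on {0..T} D \<and> (\<forall>t\<in>{0..T}. ((\<lambda>\<tau>. ?a \<tau> m) has_vector_derivative D t) (at t within {0..T}) \<and>
       (\<forall>w. cdot w m = 0 \<longrightarrow> \<mu> * (D t \<bullet> w)
          = - ((nlin (?a t) (?a t) m + (\<nu> * stokes_eigenvalue m) *\<^sub>R ?a t m) \<bullet> w)))"
      unfolding G_def by blast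
  qed
qed

section \<open>Gronwall estimates and energy identities\<close>

lemma continuous_set_integrable:
  fixes f :: "real \<Rightarrow> real"
  assumes "continuous_on {a..b} f"
  shows "set_integrable lborel {a..b} f"
  unfolding set_integrable_def by (rule borel_integrable_compact) (use assms in auto)

lemma integral_le_AE:
  fixes f h :: "real \<Rightarrow> real"
  assumes "set_integrable lborel {a..b} f" "set_integrable lborel {a..b} h"
    "AE x in lborel. x \<in> {a..b} \<longrightarrow> f x \<le> h x"
  shows "integral {a..b} f \<le> integral {a..b} h"
  using set_integral_mono_AE[OF assms]
  by (simp add: set_borel_integral_eq_integral(2)[OF assms(1)] set_borel_integral_eq_integral(2)[OF assms(2)])

lemma set_integrable_times_continuous:
  fixes E h :: "real \<Rightarrow> real"
  assumes h: "set_integrable lborel {a..b} h" and cont: "continuous_on {a..b} E"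
  shows "set_integrable lborel {a..b} (\<lambda>\<tau>. h \<tau> * E \<tau>)"
proof -
  obtain B where B: "\<And>\<tau>. \<tau> \<in> {a..b} \<Longrightarrow> norm (E \<tau>) \<le> B"
    using compact_imp_bounded[OF compact_continuous_image[OF cont compact_Icc]] by (force simp: bounded_iff)
  show ?thesis
  proof (rule set_integrable_bound[OF set_integrable_mult_right])
    show "set_integrable lborel {a..b} h" by (rule h)
    have "set_borel_measurable lborel {a..b} h" "set_borel_measurable lborel {a..b} E"
      using h continuous_set_integrable[OF cont]
      by (auto simp: set_integrable_def set_borel_measurable_def)
    then have "(\<lambda>x. (indicator {a..b} x *\<^sub>R h x) * (indicator {a..b} x *\<^sub>R E x)) \<in> borel_measurable lborel"
      unfolding set_borel_measurable_def by measurable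
    moreover have "(\<lambda>x. (indicator {a..b} x *\<^sub>R h x) * (indicator {a..b} x *\<^sub>R E x)) = (\<lambda>x. indicator {a..b} x *\<^sub>R (h x * E x))"
      by (auto simp: indicator_def)
    ultimately show "set_borel_measurable lborel {a..b} (\<lambda>\<tau>. h \<tau> * E \<tau>)" unfolding set_borel_measurable_def by simp
    show "AE x in lborel. x \<in> {a..b} \<longrightarrow> norm (h x * E x) \<le> norm (B * h x)"
    proof (intro AE_I2 impI)
      fix x assume x: "x \<in> {a..b}"
      have "\<bar>h x\<bar> * \<bar>E x\<bar> \<le> \<bar>h x\<bar> * \<bar>B\<bar>" using B[OF x] by (intro mult_left_mono) auto
      then show "norm (h x * E x) \<le> norm (B * h x)" by (simp add: abs_mult mult.commute)
    qed
  qed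
qed

lemma set_integrable_of_square:
  fixes g :: "real \<Rightarrow> real"
  assumes g: "set_integrable lborel {a..b} (\<lambda>\<tau>. (g \<tau>)\<^sup>2)" and "\<And>\<tau>. g \<tau> \<ge> 0"
  shows "set_integrable lborel {a..b} g"
proof (rule set_integrable_bound)
  show "set_integrable lborel {a..b} (\<lambda>\<tau>. 1 + (g \<tau>)\<^sup>2)"
    by (rule set_integral_add(1)[OF continuous_set_integrable[OF continuous_on_const] g])
  \<comment> \<open>Measurability is recovered from that of the square by taking roots, as g is
    nonnegative.\<close>
  have "(\<lambda>\<tau>. sqrt (indicator {a..b} \<tau> *\<^sub>R (g \<tau>)\<^sup>2)) \<in> borel_measurable lborel"
    using g unfolding set_integrable_def by measurable
  moreover have "(\<lambda>\<tau>. sqrt (indicator {a..b} \<tau> *\<^sub>R (g \<tau>)\<^sup>2)) = (\<lambda>\<tau>. indicator {a..b} \<tau> *\<^sub>R g \<tau>)"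
    using assms(2) by (auto simp: indicator_def)
  ultimately show "set_borel_measurable lborel {a..b} g" by (simp add: set_borel_measurable_def)
  have "\<bar>g \<tau>\<bar> \<le> 1 + (g \<tau>)\<^sup>2" for \<tau>
    using sum_squares_bound[of 1 "g \<tau>"] assms(2)[of \<tau>] by (simp add: abs_of_nonneg)
  then show "AE \<tau> in lborel. \<tau> \<in> {a..b} \<longrightarrow> norm (g \<tau>) \<le> norm (1 + (g \<tau>)\<^sup>2)"
    by (intro AE_I2) simp
qed

text \<open>The right-hand side times the decaying exponential has a nonpositive derivative, by the
  hypothesis itself.\<close>

lemma gronwall_const:
  fixes E :: "real \<Rightarrow> real"
  assumes cont: "continuous_on {0..t} E" and t: "0 \<le> t" and K: "K \<ge> 0"
    and le: "\<And>\<sigma>. \<sigma> \<in> {0..t} \<Longrightarrow> E \<sigma> \<le> M + K * integral {0..\<sigma>} E"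
  shows "E t \<le> M * exp (K * t)"
proof (cases "t = 0")
  case True
  then show ?thesis using le[of 0] by simp
next
  case False
  define \<Phi> where "\<Phi> = (\<lambda>\<sigma>. (M + K * integral {0..\<sigma>} E) * exp (- K * \<sigma>))"
  have "\<Phi> t \<le> \<Phi> 0"
  proof (rule DERIV_nonpos_imp_decreasing_open[where f=\<Phi> and a=0 and b=t])
    show "0 \<le> t" using t .
    show "continuous_on {0..t} \<Phi>"
      unfolding \<Phi>_def
      by (intro continuous_intros indefinite_integral_continuous_1 integrable_continuous_interval cont)
    fix x assume x: "0 < x" "x < t"
    have "((\<lambda>u. integral {0..u} E) has_vector_derivative E x) (at x within {0..t})"
      by (rule integral_has_vector_derivative[OF cont]) (use x in auto)
    moreover have "at x within {0..t} = at x" using x by (intro at_within_interior) (auto simp: interior_atLeastAtMost_real)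
    ultimately have "((\<lambda>u. integral {0..u} E) has_real_derivative E x) (at x)"
      by (simp add: has_real_derivative_iff_has_vector_derivative)
    then have "(\<Phi> has_real_derivative (K * E x - K * (M + K * integral {0..x} E)) * exp (- K * x)) (at x)"
      unfolding \<Phi>_def by (auto intro!: derivative_eq_intros simp: algebra_simps)
    moreover have "(K * E x - K * (M + K * integral {0..x} E)) * exp (- K * x) \<le> 0"
      using mult_left_mono[OF le[of x] K] x by (intro mult_nonpos_nonneg) auto
    ultimately show "\<exists>y. (\<Phi> has_real_derivative y) (at x) \<and> y \<le> 0" by blast
  qed
  then have "(M + K * integral {0..t} E) * exp (- K * t) \<le> M" by (simp add: \<Phi>_def)
  then have "M + K * integral {0..t} E \<le> M * exp (K * t)"
    by (simp add: exp_minus divide_simps)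
  then show ?thesis using le[of t] t by simp
qed

text \<open>With an integrable rate \<open>h\<close>, the bound doubles whenever \<open>\<integral> h\<close> grows by at most \<open>1/2\<close>.\<close>

lemma gronwall_integrable:
  fixes E h :: "real \<Rightarrow> real"
  assumes cont: "continuous_on {0..T} E" and E0: "\<And>t. t \<in> {0..T} \<Longrightarrow> 0 \<le> E t"
    and h: "set_integrable lborel {0..T} h" "\<And>t. 0 \<le> h t" and M: "0 \<le> M"
    and le: "\<And>t. t \<in> {0..T} \<Longrightarrow> E t \<le> M + integral {0..t} (\<lambda>\<tau>. h \<tau> * E \<tau>)"
    and n: "integral {0..T} h \<le> real n / 2" and t: "t \<in> {0..T}"
  shows "E t \<le> 2 ^ n * M"
proof -
  have T: "0 \<le> T" using t by auto
  have hE: "set_integrable lborel {0..T} (\<lambda>\<tau>. h \<tau> * E \<tau>)"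
    by (rule set_integrable_times_continuous[OF h(1) cont])
  have hi: "h integrable_on {x..y}" "(\<lambda>\<tau>. h \<tau> * E \<tau>) integrable_on {x..y}" if "0 \<le> x" "y \<le> T" for x y
  proof -
    have "{x..y} \<subseteq> {0..T}" using that by auto
    then show "h integrable_on {x..y}" "(\<lambda>\<tau>. h \<tau> * E \<tau>) integrable_on {x..y}"
      using set_borel_integral_eq_integral(1)[OF h(1)] set_borel_integral_eq_integral(1)[OF hE]
      by (auto intro: integrable_on_subinterval)
  qed
  define G where "G = (\<lambda>t. integral {0..t} h)"
  define \<phi> where "\<phi> = (\<lambda>t. M + integral {0..t} (\<lambda>\<tau>. h \<tau> * E \<tau>))"
  have G_diff: "integral {x..y} h = G y - G x" if "0 \<le> x" "x \<le> y" "y \<le> T" for x y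
    using Henstock_Kurzweil_Integration.integral_combine[of 0 x y h] that hi[of 0 y] by (simp add: G_def)
  have \<phi>_diff: "integral {x..y} (\<lambda>\<tau>. h \<tau> * E \<tau>) = \<phi> y - \<phi> x" if "0 \<le> x" "x \<le> y" "y \<le> T" for x y
    using Henstock_Kurzweil_Integration.integral_combine[of 0 x y "\<lambda>\<tau>. h \<tau> * E \<tau>"] that hi[of 0 y] by (simp add: \<phi>_def)
  have \<phi>_mono: "\<phi> x \<le> \<phi> y" if "0 \<le> x" "x \<le> y" "y \<le> T" for x y
  proof -
    have "0 \<le> integral {x..y} (\<lambda>\<tau>. h \<tau> * E \<tau>)"
      using that h(2) E0 by (intro Henstock_Kurzweil_Integration.integral_nonneg hi) auto
    then show ?thesis using \<phi>_diff[OF that] by simp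
  qed
  have \<phi>0: "\<phi> 0 = M" by (simp add: \<phi>_def)
  have G0: "G 0 = 0" by (simp add: G_def)
  \<comment> \<open>\<open>\<phi>\<close> is a nondecreasing majorant of \<open>E\<close>, so on
    [x, y] the function \<open>E\<close> may be replaced by the value of \<open>\<phi>\<close> at
    the right end. If \<open>G y - G x\<close> is at most 1/2, half of \<open>\<phi> y\<close> can
    then be absorbed on the left.\<close>
  have step: "\<phi> y - \<phi> x \<le> \<phi> y * (G y - G x)" if "0 \<le> x" "x \<le> y" "y \<le> T" for x y
  proof -
    have "integral {x..y} (\<lambda>\<tau>. h \<tau> * E \<tau>) \<le> integral {x..y} (\<lambda>\<tau>. h \<tau> * \<phi> y)"
    proof (rule integral_le)
      show "(\<lambda>\<tau>. h \<tau> * \<phi> y) integrable_on {x..y}" by (intro integrable_on_mult_left hi that)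
      fix \<tau> assume \<tau>: "\<tau> \<in> {x..y}"
      then have "E \<tau> \<le> \<phi> \<tau>" unfolding \<phi>_def using that by (intro le) auto
      also have "\<dots> \<le> \<phi> y" using \<tau> that by (intro \<phi>_mono) auto
      finally show "h \<tau> * E \<tau> \<le> h \<tau> * \<phi> y" using h(2) by (intro mult_left_mono)
    qed (use that in \<open>auto intro: hi\<close>)
    also have "\<dots> = \<phi> y * (G y - G x)" using G_diff[OF that] by (simp add: mult.commute)
    finally show ?thesis using \<phi>_diff[OF that] by simp
  qed
  have Gcont: "continuous_on {0..T} G"
    unfolding G_def using hi[of 0 T] by (intro indefinite_integral_continuous_1) auto
  have "\<phi> t \<le> 2 ^ n * M" if "t \<in> {0..T}" "G t \<le> real n / 2" for t
    using that
  proof (induction n arbitrary: t)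
    case 0
    have "\<phi> t \<ge> 0" using \<phi>_mono[of 0 t] \<phi>0 M 0 by auto
    moreover have "G t * \<phi> t \<le> 0" using 0 \<open>\<phi> t \<ge> 0\<close> by (intro mult_nonpos_nonneg) auto
    ultimately show ?case using step[of 0 t] 0 \<phi>0 G0 by (simp add: mult.commute)
  next
    case (Suc n)
    show ?case
    proof (cases "G t \<le> real n / 2")
      case True
      then have "\<phi> t \<le> 2 ^ n * M" using Suc by blast
      also have "\<dots> \<le> 2 ^ Suc n * M" using M by simp
      finally show ?thesis .
    next
      case False
      \<comment> \<open>An earlier time at which the induction hypothesis applies exactly at its
        threshold; the integral of \<open>h\<close> from there to \<open>t\<close> is at most
        1/2.\<close>
      then obtain x where x: "0 \<le> x" "x \<le> t" "G x = real n / 2"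
        using IVT'[of G 0 "real n / 2" t] Suc.prems(1) G0 continuous_on_subset[OF Gcont, of "{0..t}"] by auto
      have "\<phi> x \<le> 2 ^ n * M" using Suc x by auto
      moreover have "\<phi> t \<ge> 0" using \<phi>_mono[of 0 t] \<phi>0 M Suc.prems by auto
      moreover have "\<phi> t - \<phi> x \<le> \<phi> t * (1 / 2)"
      proof -
        have "\<phi> t * (G t - G x) \<le> \<phi> t * (1 / 2)"
          using Suc.prems x \<open>\<phi> t \<ge> 0\<close> by (intro mult_left_mono) (auto simp: field_simps)
        then show ?thesis using step[of x t] x Suc.prems by auto
      qed
      ultimately show ?thesis by simp
    qed
  qed
  moreover have "G t \<le> real n / 2"
  proof -
    have "0 \<le> integral {t..T} h" using t h(2) by (intro Henstock_Kurzweil_Integration.integral_nonneg hi) auto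
    then show ?thesis using G_diff[of t T] t n by (auto simp: G_def)
  qed
  ultimately show ?thesis using le[OF t] t by (fastforce simp: \<phi>_def)
qed

section \<open>The Voigt symbol and energy identities on finitely many modes\<close>

definition voigt_weight :: "real \<Rightarrow> real \<Rightarrow> int^3 \<Rightarrow> real" where
  "voigt_weight \<alpha> r k = 1 + \<alpha> powr (2 * r) * stokes_eigenvalue k powr r"

lemma jw_eq: "jw k = 1 + stokes_eigenvalue k"
  by (simp add: jw_def stokes_eigenvalue_def)

lemma stokes_eigenvalue_nonneg [simp]: "stokes_eigenvalue k \<ge> 0"
  by (simp add: stokes_eigenvalue_def)

lemma voigt_weight_pos [simp]: "voigt_weight \<alpha> r k > 0" "voigt_weight \<alpha> r k \<ge> 0"
proof -
  show "voigt_weight \<alpha> r k > 0" unfolding voigt_weight_def by (simp add: add_pos_nonneg)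
  then show "voigt_weight \<alpha> r k \<ge> 0" by simp
qed

text \<open>At the level of symbols, the equivalence of the Voigt energy with the squared norm of
  H^r.\<close>

lemma voigt_weight_bounds:
  assumes "\<alpha> > 0" "0 < r" "r \<le> 1"
  obtains c where "c \<ge> 1" "\<And>k. jw k powr r \<le> c * voigt_weight \<alpha> r k" "\<And>k. voigt_weight \<alpha> r k \<le> c * jw k powr r"
proof -
  define A where "A = \<alpha> powr (2 * r)"
  have A: "A > 0" using assms by (simp add: A_def)
  \<comment> \<open>The first summand serves the lower bound and the second the upper one, so that a
    single constant is enough.\<close>
  define c where "c = 2 * (1 + 1 / A) + (1 + A)"
  have lower: "jw k powr r \<le> c * voigt_weight \<alpha> r k" for k
  proof -
    let ?l = "stokes_eigenvalue k"
    \<comment> \<open>With l the eigenvalue, 1 + l is at most 2 if l is at most 1, and at most 2l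
      otherwise.\<close>
    have "jw k powr r \<le> 2 * (1 + ?l powr r)"
    proof (cases "?l \<le> 1")
      case True
      have "jw k powr r \<le> 2 powr r" using True assms jw_pos[of k] by (intro powr_mono2) (auto simp: jw_eq)
      also have "\<dots> \<le> 2 powr 1" using assms by (intro powr_mono) auto
      finally show ?thesis by (simp add: add_increasing2)
    next
      case False
      have "jw k powr r \<le> (2 * ?l) powr r" using False assms jw_pos[of k] by (intro powr_mono2) (auto simp: jw_eq)
      also have "\<dots> = 2 powr r * ?l powr r" by (simp add: powr_mult)
      also have "\<dots> \<le> 2 powr 1 * ?l powr r" using assms by (intro mult_right_mono powr_mono) auto
      finally show ?thesis by simp
    qed
    also have "\<dots> \<le> 2 * ((1 + 1 / A) * (1 + A * ?l powr r))"
    proof -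
      have "(1 + 1 / A) * (1 + A * ?l powr r) = 1 + ?l powr r + (A * ?l powr r + 1 / A)"
        using A by (simp add: field_simps)
      then show ?thesis using A by simp
    qed
    also have "\<dots> = (2 * (1 + 1 / A)) * voigt_weight \<alpha> r k" by (simp add: voigt_weight_def A_def)
    also have "\<dots> \<le> c * voigt_weight \<alpha> r k" using A by (intro mult_right_mono) (auto simp: c_def)
    finally show ?thesis .
  qed
  have upper: "voigt_weight \<alpha> r k \<le> c * jw k powr r" for k
  proof -
    have 1: "1 \<le> jw k powr r" using jw_ge1[of k] assms by (simp add: ge_one_powr_ge_zero)
    have 2: "stokes_eigenvalue k powr r \<le> jw k powr r" using assms by (intro powr_mono2) (auto simp: jw_eq)
    have "voigt_weight \<alpha> r k \<le> 1 * jw k powr r + A * jw k powr r"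
      unfolding voigt_weight_def A_def[symmetric] using 1 2 A by (intro add_mono mult_left_mono) auto
    also have "\<dots> = (1 + A) * jw k powr r" by (simp add: ring_distribs)
    also have "\<dots> \<le> c * jw k powr r" using A by (intro mult_right_mono) (auto simp: c_def)
    finally show ?thesis .
  qed
  show thesis using A by (intro that[of c] lower upper) (simp add: c_def)
qed

lemma wnorm_finite_sum:
  assumes "finite F" "\<And>k. k \<notin> F \<Longrightarrow> z k = 0" "\<And>k. \<mu> k \<ge> 0"
  shows "z \<in> wsp \<mu>" "(wnorm \<mu> z)\<^sup>2 = (\<Sum>k\<in>F. \<mu> k * (norm (z k))\<^sup>2)"
proof -
  have "((\<lambda>k. \<mu> k * (norm (z k))\<^sup>2) has_sum (\<Sum>k\<in>F. \<mu> k * (norm (z k))\<^sup>2)) UNIV"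
    by (rule has_sum_finite_neutralI) (use assms in auto)
  then show "z \<in> wsp \<mu>" "(wnorm \<mu> z)\<^sup>2 = (\<Sum>k\<in>F. \<mu> k * (norm (z k))\<^sup>2)"
    using wnorm_sq[of \<mu> z, OF assms(3)] by (auto simp: wsp_def has_sum_iff)
qed

text \<open>Cauchy--Schwarz after splitting the weight between the two sequences; smaller exponents
  \<open>\<rho>\<close> are allowed because \<open>jw k \<ge> 1\<close>.\<close>

lemma sum_weights_inner_le:
  fixes x y :: "int^3 \<Rightarrow> complex^3"
  assumes "finite F" "x \<in> sob \<sigma>" "y \<in> sob \<tau>" "\<rho> \<le> (\<sigma> + \<tau>) / 2"
  shows "(\<Sum>k\<in>F. jw k powr \<rho> * (norm (x k) * norm (y k))) \<le> sobn \<sigma> x * sobn \<tau> y"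
proof -
  have "(\<Sum>k\<in>F. jw k powr \<rho> * (norm (x k) * norm (y k)))
    \<le> (\<Sum>k\<in>F. (jw k powr (\<sigma> / 2) * norm (x k)) * (jw k powr (\<tau> / 2) * norm (y k)))"
  proof (intro sum_mono)
    fix k
    have "jw k powr \<rho> \<le> jw k powr (\<sigma> / 2 + \<tau> / 2)" using assms jw_ge1 by (intro powr_mono) auto
    then have "jw k powr \<rho> * (norm (x k) * norm (y k)) \<le> (jw k powr (\<sigma> / 2) * jw k powr (\<tau> / 2)) * (norm (x k) * norm (y k))"
      unfolding powr_add by (intro mult_right_mono) auto
    then show "jw k powr \<rho> * (norm (x k) * norm (y k)) \<le> (jw k powr (\<sigma> / 2) * norm (x k)) * (jw k powr (\<tau> / 2) * norm (y k))"
      by (simp add: mult_ac)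
  qed
  also have "\<dots> \<le> sobn \<sigma> x * sobn \<tau> y"
    using l2_bounded_sum_mult[OF l2_bounded_weighted[OF assms(2)] l2_bounded_weighted[OF assms(3)], of "\<lambda>k. k" "\<lambda>k. k" F] assms(1)
    by simp
  finally show ?thesis .
qed

lemma vflowD:
  assumes "vflow r T a" "t \<in> {0..T}"
  shows "a t \<in> sob r" "solenoidal (a t)" "real_coeffs (a t)" "a t 0 = 0"
    "((\<lambda>\<tau>. sobn r (\<lambda>k. a \<tau> k - a t k)) \<longlongrightarrow> 0) (at t within {0..T})"
  using assms by (auto simp: vflow_def)

definition flux :: "real \<Rightarrow> (int^3 \<Rightarrow> complex^3) \<Rightarrow> int^3 \<Rightarrow> complex^3" where
  "flux \<nu> a m = nlin a a m + (\<nu> * stokes_eigenvalue m) *\<^sub>R a m"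

lemma voigt_flow_deriv:
  assumes "voigt_flow \<alpha> \<nu> r T a"
  obtains D where "\<And>m. continuous_on {0..T} (D m)"
    "\<And>m t. t \<in> {0..T} \<Longrightarrow> ((\<lambda>\<tau>. a \<tau> m) has_vector_derivative D m t) (at t within {0..T})"
    "\<And>m t w. t \<in> {0..T} \<Longrightarrow> cdot w m = 0 \<Longrightarrow> voigt_weight \<alpha> r m * (D m t \<bullet> w) = - (flux \<nu> (a t) m \<bullet> w)"
  using assms unfolding voigt_flow_def voigt_weight_def flux_def by metis

lemma flux_continuous:
  assumes "5/6 < r" "vflow r T a"
  shows "continuous_on {0..T} (\<lambda>t. flux \<nu> (a t) m)"
  unfolding flux_def by (intro continuous_intros nlin_continuous[OF assms] vflow_continuous[OF assms(2)])

lemma flow_increment: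
  assumes r: "5/6 < r" and a: "voigt_flow \<alpha> \<nu> r T a" and t: "0 \<le> t0" "t0 \<le> t1" "t1 \<le> T" and d: "cdot d m = 0"
  shows "voigt_weight \<alpha> r m * ((a t1 m - a t0 m) \<bullet> d) = integral {t0..t1} (\<lambda>\<tau>. - (flux \<nu> (a \<tau>) m \<bullet> d))"
proof -
  obtain D where D: "\<And>m. continuous_on {0..T} (D m)"
    "\<And>m t. t \<in> {0..T} \<Longrightarrow> ((\<lambda>\<tau>. a \<tau> m) has_vector_derivative D m t) (at t within {0..T})"
    "\<And>m t w. t \<in> {0..T} \<Longrightarrow> cdot w m = 0 \<Longrightarrow> voigt_weight \<alpha> r m * (D m t \<bullet> w) = - (flux \<nu> (a t) m \<bullet> w)"
    using voigt_flow_deriv[OF a] by blast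
  have "(D m has_integral (a t1 m - a t0 m)) {t0..t1}"
    using t by (intro fundamental_theorem_of_calculus has_vector_derivative_within_subset[OF D(2)]) auto
  then have "((\<lambda>\<tau>. D m \<tau> \<bullet> d) has_integral ((a t1 m - a t0 m) \<bullet> d)) {t0..t1}"
    by (rule has_integral_linear[OF _ bounded_linear_inner_left, unfolded o_def])
  then have "((\<lambda>\<tau>. voigt_weight \<alpha> r m * (D m \<tau> \<bullet> d)) has_integral (voigt_weight \<alpha> r m * ((a t1 m - a t0 m) \<bullet> d))) {t0..t1}"
    by (rule has_integral_mult_right)
  then have "((\<lambda>\<tau>. - (flux \<nu> (a \<tau>) m \<bullet> d)) has_integral (voigt_weight \<alpha> r m * ((a t1 m - a t0 m) \<bullet> d))) {t0..t1}"
    by (rule has_integral_eq[rotated]) (use t d in \<open>auto intro!: D(3)\<close>)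
  then show ?thesis by (rule integral_unique[symmetric])
qed

text \<open>The weights \<open>\<theta>\<close> are left open because the identity is used twice:
  with 1 for the energy, and with a power of \<open>jw\<close> for H^1. At each mode the difference
  is divergence-free, hence admissible as a test vector in both equations.\<close>

lemma flow_energy_identity:
  assumes r: "5/6 < r" and a: "voigt_flow \<alpha> \<nu>1 r T a" and b: "voigt_flow \<alpha> \<nu>2 r T b" and t: "t \<in> {0..T}"
    and F: "finite F"
  defines "w \<equiv> \<lambda>\<tau> k. a \<tau> k - b \<tau> k"
  shows "(\<Sum>k\<in>F. \<theta> k * voigt_weight \<alpha> r k * (norm (w t k))\<^sup>2) = (\<Sum>k\<in>F. \<theta> k * voigt_weight \<alpha> r k * (norm (w 0 k))\<^sup>2)
     + integral {0..t} (\<lambda>\<tau>. \<Sum>k\<in>F. 2 * \<theta> k * ((flux \<nu>2 (b \<tau>) k - flux \<nu>1 (a \<tau>) k) \<bullet> w \<tau> k))"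
proof -
  obtain D where D: "\<And>m. continuous_on {0..T} (D m)"
    "\<And>m t. t \<in> {0..T} \<Longrightarrow> ((\<lambda>\<tau>. a \<tau> m) has_vector_derivative D m t) (at t within {0..T})"
    "\<And>m t w. t \<in> {0..T} \<Longrightarrow> cdot w m = 0 \<Longrightarrow> voigt_weight \<alpha> r m * (D m t \<bullet> w) = - (flux \<nu>1 (a t) m \<bullet> w)"
    using voigt_flow_deriv[OF a] by blast
  obtain D' where D': "\<And>m. continuous_on {0..T} (D' m)"
    "\<And>m t. t \<in> {0..T} \<Longrightarrow> ((\<lambda>\<tau>. b \<tau> m) has_vector_derivative D' m t) (at t within {0..T})"
    "\<And>m t w. t \<in> {0..T} \<Longrightarrow> cdot w m = 0 \<Longrightarrow> voigt_weight \<alpha> r m * (D' m t \<bullet> w) = - (flux \<nu>2 (b t) m \<bullet> w)"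
    using voigt_flow_deriv[OF b] by blast
  have va: "vflow r T a" and vb: "vflow r T b" using a b by (auto simp: voigt_flow_def)
  let ?S = "\<lambda>\<tau>. \<Sum>k\<in>F. \<theta> k * voigt_weight \<alpha> r k * (norm (w \<tau> k))\<^sup>2"
  have "((\<lambda>\<tau>. \<Sum>k\<in>F. 2 * \<theta> k * ((flux \<nu>2 (b \<tau>) k - flux \<nu>1 (a \<tau>) k) \<bullet> w \<tau> k)) has_integral (?S t - ?S 0)) {0..t}"
  proof (rule fundamental_theorem_of_calculus)
    fix \<tau> assume "\<tau> \<in> {0..t}"
    then have \<tau>: "\<tau> \<in> {0..T}" using t by auto
    have sub: "{0..t} \<subseteq> {0..T}" using t by auto
    have wd: "((\<lambda>\<tau>. w \<tau> k) has_vector_derivative (D k \<tau> - D' k \<tau>)) (at \<tau> within {0..t})" for k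
      unfolding w_def
      by (intro has_vector_derivative_diff has_vector_derivative_within_subset[OF D(2)[OF \<tau>] sub]
            has_vector_derivative_within_subset[OF D'(2)[OF \<tau>] sub])
    have sol: "cdot (w \<tau> k) k = 0" for k
      using vflowD(2)[OF va \<tau>] vflowD(2)[OF vb \<tau>] by (simp add: w_def cdot_diff_left solenoidal_def)
    have "((\<lambda>\<tau>. \<theta> k * voigt_weight \<alpha> r k * (norm (w \<tau> k))\<^sup>2) has_vector_derivative
      (2 * \<theta> k * ((flux \<nu>2 (b \<tau>) k - flux \<nu>1 (a \<tau>) k) \<bullet> w \<tau> k))) (at \<tau> within {0..t})" for k
    proof -
      have "((\<lambda>\<tau>. w \<tau> k \<bullet> w \<tau> k) has_vector_derivative (w \<tau> k \<bullet> (D k \<tau> - D' k \<tau>) + (D k \<tau> - D' k \<tau>) \<bullet> w \<tau> k)) (at \<tau> within {0..t})"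
        by (rule bounded_bilinear.has_vector_derivative[OF bounded_bilinear_inner wd wd])
      from has_vector_derivative_mult_right[OF this, of "\<theta> k * voigt_weight \<alpha> r k"]
      have "((\<lambda>\<tau>. \<theta> k * voigt_weight \<alpha> r k * (norm (w \<tau> k))\<^sup>2) has_vector_derivative
          (2 * \<theta> k * (voigt_weight \<alpha> r k * (D k \<tau> \<bullet> w \<tau> k) - voigt_weight \<alpha> r k * (D' k \<tau> \<bullet> w \<tau> k)))) (at \<tau> within {0..t})"
        by (simp add: power2_norm_eq_inner inner_commute inner_diff_left inner_diff_right algebra_simps)
      then show ?thesis unfolding D(3)[OF \<tau> sol] D'(3)[OF \<tau> sol] by (simp add: inner_diff_left)
    qed
    then show "(?S has_vector_derivative (\<Sum>k\<in>F. 2 * \<theta> k * ((flux \<nu>2 (b \<tau>) k - flux \<nu>1 (a \<tau>) k) \<bullet> w \<tau> k))) (at \<tau> within {0..t})"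
      by (intro has_vector_derivative_sum) auto
  qed (use t in auto)
  then show ?thesis by (simp add: integral_unique)
qed

lemma sum_nlin_eq_bform:
  assumes r: "5/6 < r" and a: "solenoidal a" "a \<in> sob r" and b: "b \<in> sob r" and F: "finite F"
  shows "(\<Sum>k\<in>F. nlin a b k \<bullet> c k) = bform a b (\<lambda>k. if k \<in> F then c k else 0)"
proof -
  let ?c = "\<lambda>k. if k \<in> F then c k else 0"
  have c: "?c \<in> sob r" by (rule wnorm_finite_sum[OF F]) auto
  have "bsummable a b ?c" by (rule bsummable_sob[OF r a b c])
  from bform_finite_support[OF this advect_summable[OF r a b] F]
  show ?thesis by simp
qed

section \<open>Regularity in H1\<close>

definition L2_flow :: "real \<Rightarrow> real \<Rightarrow> (real \<Rightarrow> int^3 \<Rightarrow> complex^3) \<Rightarrow> bool" where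
  "L2_flow T s a \<longleftrightarrow> (AE t in lborel. t \<in> {0..T} \<longrightarrow> a t \<in> sob s) \<and>
     set_integrable lborel {0..T} (\<lambda>t. (sobn s (a t))\<^sup>2)"

lemma abs_jw [simp]: "\<bar>jw k\<bar> = jw k" and jw_nonneg [simp]: "0 \<le> jw k"
  by (simp_all add: less_imp_le)

lemma ex_AE_interval:
  assumes "AE t in lborel. t \<in> {0..T} \<longrightarrow> P t" "0 < (T::real)"
  obtains t where "t \<in> {0..T}" "P t"
proof -
  have "\<not> (AE t in lborel. t \<notin> {0..T})"
  proof
    assume "AE t in lborel. t \<notin> {0..T}"
    then have "emeasure lborel {0..T} = 0"
      by (subst (asm) AE_iff_measurable[where N="{0..T}"]) auto
    then show False using assms(2) by simp
  qed
  moreover have "AE t in lborel. t \<notin> {0..T}" if "\<forall>t\<in>{0..T}. \<not> P t"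
    using assms(1) by eventually_elim (use that in auto)
  ultimately show thesis using that by blast
qed

lemma sum_flux_inner:
  assumes r: "5/6 < r" and a: "solenoidal a" "a \<in> sob r" and F: "finite F"
  shows "(\<Sum>k\<in>F. flux \<nu> a k \<bullet> c k) = bform a a (\<lambda>k. if k \<in> F then c k else 0)
    + \<nu> * (\<Sum>k\<in>F. stokes_eigenvalue k * (a k \<bullet> c k))"
  unfolding sum_nlin_eq_bform[OF r a a(2) F, symmetric]
  by (simp add: flux_def inner_add_left sum.distrib sum_distrib_left mult_ac)

lemma inner_le_norms: "\<bar>x \<bullet> y\<bar> \<le> norm x * norm y" for x y :: "complex^3"
  using Cauchy_Schwarz_ineq2 by blast

lemma stokes_le_jw: "stokes_eigenvalue k \<le> jw k"
  by (simp add: jw_eq)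

text \<open>A solution gains \<open>2r\<close> derivatives over \<open>B(a, a)\<close>; the estimate is by duality, tested on
  finitely many modes.\<close>

lemma flow_H1_increment:
  assumes r: "5/6 < r" "r \<le> 1" and \<alpha>: "\<alpha> > 0" and s: "s > 3/2" and \<nu>: "\<nu> \<ge> 0"
  obtains K where "K \<ge> 0"
    "\<And>T a t0 t1. voigt_flow \<alpha> \<nu> r T a \<Longrightarrow> L2_flow T s a \<Longrightarrow> 0 \<le> t0 \<Longrightarrow> t0 \<le> t1 \<Longrightarrow> t1 \<le> T \<Longrightarrow>
      (\<lambda>k. a t1 k - a t0 k) \<in> sob 1 \<and>
      sobn 1 (\<lambda>k. a t1 k - a t0 k) \<le> K * integral {t0..t1} (\<lambda>\<tau>. 1 + (sobn s (a \<tau>))\<^sup>2)"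
proof -
  \<comment> \<open>The exponent 2r - 1 belongs to the test sequence \<open>z\<close> below, which
    is a sequence in \<open>sob 1\<close> times a multiplier of size
    \<open>jw k powr (1 - r)\<close>: indeed (2r - 1) + 2(1 - r) = 1. It exceeds 1/2 because r >
    5/6.\<close>
  obtain C where C: "C \<ge> 0"
    "\<And>a b c. solenoidal a \<Longrightarrow> a \<in> sob s \<Longrightarrow> b \<in> sob s \<Longrightarrow> c \<in> sob (2 * r - 1) \<Longrightarrow>
       bsummable a b c \<and> \<bar>bform a b c\<bar> \<le> C * (sobn s a * sobn s b * sobn (2 * r - 1) c)"
    by (rule bform_bound[of s s "2 * r - 1"]) (use r s in auto)
  obtain c where c: "c \<ge> 1" "\<And>k. jw k powr r \<le> c * voigt_weight \<alpha> r k"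
    using voigt_weight_bounds[OF \<alpha>, of r] r by (metis less_trans zero_less_divide_iff zero_less_numeral)
  define K where "K = C * c + \<nu> * c"
  have K0: "K \<ge> 0" using C c \<nu> by (simp add: K_def)
  show thesis
  proof (rule that[OF K0])
    fix T a t0 t1
    assume a: "voigt_flow \<alpha> \<nu> r T a" and L: "L2_flow T s a" and t: "0 \<le> t0" "t0 \<le> t1" "t1 \<le> T"
    define d where "d = (\<lambda>k. a t1 k - a t0 k)"
    let ?h = "\<lambda>\<tau>. 1 + (sobn s (a \<tau>))\<^sup>2"
    let ?I = "integral {t0..t1} ?h"
    have va: "vflow r T a" using a by (simp add: voigt_flow_def)
    have T: "t0 \<in> {0..T}" "t1 \<in> {0..T}" using t by auto
    have sub: "{t0..t1} \<subseteq> {0..T}" using t by auto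
    have hint: "set_integrable lborel {t0..t1} ?h"
    proof (rule set_integral_add(1)[OF continuous_set_integrable[OF continuous_on_const]])
      show "set_integrable lborel {t0..t1} (\<lambda>\<tau>. (sobn s (a \<tau>))\<^sup>2)"
        using L sub by (auto simp: L2_flow_def intro: set_integrable_subset)
    qed
    have I0: "?I \<ge> 0"
      by (intro Henstock_Kurzweil_Integration.integral_nonneg set_borel_integral_eq_integral(1)[OF hint]) auto
    have dsol: "cdot (d k) k = 0" for k
      using vflowD(2)[OF va T(1)] vflowD(2)[OF va T(2)] by (simp add: d_def cdot_diff_left solenoidal_def)
    have fin: "(\<Sum>k\<in>F. jw k powr 1 * (norm (d k))\<^sup>2) \<le> (K * ?I)\<^sup>2" if F: "finite F" for F
    proof -
      \<comment> \<open>Chosen so that the Voigt symbol times \<open>m k\<close> is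
        \<open>jw k\<close>: the equation tested with \<open>z\<close> produces the squared H^1 norm
        of the truncated increment.\<close>
      define m where "m = (\<lambda>k. jw k / voigt_weight \<alpha> r k)"
      define z where "z = (\<lambda>k. m k *\<^sub>R d k)"
      let ?z = "\<lambda>k. if k \<in> F then z k else 0"
      let ?d = "\<lambda>k. if k \<in> F then d k else 0"
      define N where "N = sobn 1 ?d"
      have N2: "N\<^sup>2 = (\<Sum>k\<in>F. jw k powr 1 * (norm (d k))\<^sup>2)"
        unfolding N_def by (subst wnorm_finite_sum(2)[OF F]) auto
      have N0: "N \<ge> 0" by (simp add: N_def)
      have m0: "m k \<ge> 0" for k using jw_pos[of k] voigt_weight_pos(1)[of \<alpha> r k] unfolding m_def by (intro divide_nonneg_nonneg) (auto simp: less_imp_le)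
      have mle: "m k \<le> c * jw k powr (1 - r)" for k
      proof -
        have "jw k = jw k powr (1 - r) * jw k powr r" using jw_pos[of k] by (simp flip: powr_add)
        also have "\<dots> \<le> jw k powr (1 - r) * (c * voigt_weight \<alpha> r k)" by (intro mult_left_mono c) auto
        finally show ?thesis unfolding m_def by (simp add: pos_divide_le_eq mult_ac)
      qed
      have zle: "norm (z k) \<le> c * jw k powr (1 - r) * norm (d k)" for k
        unfolding z_def using mle[of k] m0[of k] by (auto intro: mult_right_mono)
      have ds: "?d \<in> sob 1" by (rule wnorm_finite_sum[OF F]) auto
      have zs: "?z \<in> sob (2 * r - 1)" "sobn (2 * r - 1) ?z \<le> c * N"
      proof -
        have "jw k powr (2 * r - 1) * (norm (?z k))\<^sup>2 \<le> c\<^sup>2 * (jw k powr 1 * (norm (?d k))\<^sup>2)" for k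
        proof (cases "k \<in> F")
          case True
          have "jw k powr (2 * r - 1) * (norm (z k))\<^sup>2 \<le> jw k powr (2 * r - 1) * (c * jw k powr (1 - r) * norm (d k))\<^sup>2"
            by (intro mult_left_mono power_mono zle) auto
          also have "\<dots> = c\<^sup>2 * ((jw k powr (2 * r - 1) * jw k powr (1 - r) * jw k powr (1 - r)) * (norm (d k))\<^sup>2)"
            by (simp add: power2_eq_square mult_ac)
          also have "jw k powr (2 * r - 1) * jw k powr (1 - r) * jw k powr (1 - r) = jw k powr 1"
            by (simp flip: powr_add)
          finally show ?thesis using True by simp
        qed simp
        then show "?z \<in> sob (2 * r - 1)" "sobn (2 * r - 1) ?z \<le> c * N"
          unfolding N_def using wnorm_mono[of "\<lambda>k. jw k powr (2 * r - 1)" "\<lambda>k. jw k powr 1" c ?z ?d] c(1) ds by auto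
      qed
      define \<Phi> where "\<Phi> = (\<lambda>\<tau>. \<Sum>k\<in>F. - (flux \<nu> (a \<tau>) k \<bullet> z k))"
      have zsol: "cdot (z k) k = 0" for k
        using dsol[of k] unfolding z_def cdot_def
        by (simp add: scaleR_conv_of_real[of _ "_ :: complex"] mult.assoc flip: sum_distrib_left)
      have \<Phi>c: "continuous_on {t0..t1} \<Phi>"
        unfolding \<Phi>_def by (intro continuous_intros continuous_on_subset[OF flux_continuous[OF r(1) va] sub])
      have "N\<^sup>2 = (\<Sum>k\<in>F. voigt_weight \<alpha> r k * (d k \<bullet> z k))"
        unfolding N2 z_def m_def using jw_pos voigt_weight_pos(1)[of \<alpha> r]
        by (intro sum.cong refl) (simp add: power2_norm_eq_inner less_imp_le order_less_imp_not_eq2)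
      also have "\<dots> = (\<Sum>k\<in>F. integral {t0..t1} (\<lambda>\<tau>. - (flux \<nu> (a \<tau>) k \<bullet> z k)))"
        unfolding d_def by (intro sum.cong refl flow_increment[OF r(1) a t zsol])
      also have "\<dots> = integral {t0..t1} \<Phi>"
        unfolding \<Phi>_def
        by (intro Henstock_Kurzweil_Integration.integral_sum[symmetric] F integrable_continuous_interval continuous_intros continuous_on_subset[OF flux_continuous[OF r(1) va] sub])
      also have "\<dots> \<le> integral {t0..t1} (\<lambda>\<tau>. (K * N) * ?h \<tau>)"
      proof (rule integral_le_AE[OF continuous_set_integrable[OF \<Phi>c] set_integrable_mult_right[OF hint]])
        have "AE \<tau> in lborel. \<tau> \<in> {0..T} \<longrightarrow> a \<tau> \<in> sob s" using L by (simp add: L2_flow_def)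
        then show "AE \<tau> in lborel. \<tau> \<in> {t0..t1} \<longrightarrow> \<Phi> \<tau> \<le> (K * N) * ?h \<tau>"
        proof eventually_elim
          case (elim \<tau>)
          show ?case
          proof
            assume "\<tau> \<in> {t0..t1}"
            then have \<tau>: "\<tau> \<in> {0..T}" "a \<tau> \<in> sob s" using sub elim by auto
            note v = vflowD[OF va \<tau>(1)]
            let ?g = "sobn s (a \<tau>)"
            have g0: "?g \<ge> 0" by simp
            have "\<Phi> \<tau> = - bform (a \<tau>) (a \<tau>) ?z - \<nu> * (\<Sum>k\<in>F. stokes_eigenvalue k * (a \<tau> k \<bullet> z k))"
              unfolding \<Phi>_def sum_negf sum_flux_inner[OF r(1) v(2,1) F] by simp
            moreover have "\<bar>bform (a \<tau>) (a \<tau>) ?z\<bar> \<le> C * c * ?g\<^sup>2 * N"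
            proof -
              have "\<bar>bform (a \<tau>) (a \<tau>) ?z\<bar> \<le> C * (?g * ?g * sobn (2 * r - 1) ?z)" using C(2) v(2) \<tau>(2) zs(1) by blast
              also have "\<dots> \<le> C * (?g * ?g * (c * N))" using C(1) by (intro mult_left_mono zs(2)) auto
              finally show ?thesis by (simp add: power2_eq_square mult_ac)
            qed
            \<comment> \<open>The exponent 2 - r is below 7/6 and hence below (s + 1)/2, so the
              viscous term costs one factor in \<open>sob s\<close> and one in
              \<open>sob 1\<close>.\<close>
            moreover have "\<bar>\<Sum>k\<in>F. stokes_eigenvalue k * (a \<tau> k \<bullet> z k)\<bar> \<le> c * (?g * N)"
            proof -
              have "\<bar>\<Sum>k\<in>F. stokes_eigenvalue k * (a \<tau> k \<bullet> z k)\<bar> \<le> (\<Sum>k\<in>F. c * (jw k powr (2 - r) * (norm (a \<tau> k) * norm (?d k))))"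
              proof (rule order_trans[OF sum_abs], rule sum_mono)
                fix k assume k: "k \<in> F"
                have "\<bar>stokes_eigenvalue k * (a \<tau> k \<bullet> z k)\<bar> \<le> jw k powr 1 * (norm (a \<tau> k) * (c * jw k powr (1 - r) * norm (d k)))"
                  unfolding abs_mult using stokes_le_jw[of k] jw_pos[of k]
                  by (intro mult_mono order_trans[OF inner_le_norms] mult_left_mono zle) (auto simp: less_imp_le)
                also have "\<dots> = c * ((jw k powr 1 * jw k powr (1 - r)) * (norm (a \<tau> k) * norm (?d k)))"
                  using k by (simp add: mult_ac)
                also have "jw k powr 1 * jw k powr (1 - r) = jw k powr (2 - r)"
                  unfolding powr_add[symmetric] by simp
                finally show "\<bar>stokes_eigenvalue k * (a \<tau> k \<bullet> z k)\<bar> \<le> c * (jw k powr (2 - r) * (norm (a \<tau> k) * norm (?d k)))" .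
              qed
              also have "\<dots> \<le> c * (?g * N)"
                unfolding sum_distrib_left[symmetric] N_def using c(1) r s \<tau>(2)
                by (intro mult_left_mono sum_weights_inner_le F ds) auto
              finally show ?thesis .
            qed
            then have "\<bar>\<nu> * (\<Sum>k\<in>F. stokes_eigenvalue k * (a \<tau> k \<bullet> z k))\<bar> \<le> \<nu> * (c * (?g * N))"
              unfolding abs_mult using \<nu> by (intro mult_mono) auto
            ultimately have "\<Phi> \<tau> \<le> C * c * ?g\<^sup>2 * N + \<nu> * (c * (?g * N))" by linarith
            also have "\<dots> = (C * c * ?g\<^sup>2 + \<nu> * c * ?g) * N" by (simp add: algebra_simps)
            also have "\<dots> \<le> (C * c * (1 + ?g\<^sup>2) + \<nu> * c * (1 + ?g\<^sup>2)) * N"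
            proof -
              have "2 * ?g \<le> 1 + ?g\<^sup>2" using sum_squares_bound[of 1 ?g] by simp
              with g0 have "?g \<le> 1 + ?g\<^sup>2" by linarith
              then show ?thesis using C(1) c(1) \<nu> N0 by (intro mult_right_mono add_mono mult_left_mono) auto
            qed
            also have "\<dots> = (K * N) * ?h \<tau>" by (simp add: K_def algebra_simps)
            finally show "\<Phi> \<tau> \<le> (K * N) * ?h \<tau>" .
          qed
        qed
      qed
      also have "\<dots> = (K * N) * ?I" by (rule integral_mult_right)
      finally have "N * N \<le> (K * ?I) * N" by (simp add: power2_eq_square mult_ac)
      then have "N \<le> K * ?I" using N0 K0 I0 by (cases "N = 0") auto
      then have "N\<^sup>2 \<le> (K * ?I)\<^sup>2" using N0 by (intro power_mono)
      then show ?thesis unfolding N2 .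
    qed
    show "(\<lambda>k. a t1 k - a t0 k) \<in> sob 1 \<and> sobn 1 (\<lambda>k. a t1 k - a t0 k) \<le> K * ?I"
      using wspI[of "\<lambda>k. jw k powr 1" "K * ?I" d] fin K0 I0 by (simp add: d_def)
  qed
qed

text \<open>At some time the coefficients lie in \<open>sob s\<close>, as they do at almost every
  time. Increments lie in \<open>sob 1\<close>, so the coefficients are in \<open>sob 1\<close> at
  all times, including 0. Continuity holds since increments are bounded by those of a continuous
  integral.\<close>

lemma flow_H1:
  assumes r: "5/6 < r" "r \<le> 1" and \<alpha>: "\<alpha> > 0" and s: "s > 3/2" and \<nu>: "\<nu> \<ge> 0" and T: "T > 0"
    and a: "voigt_flow \<alpha> \<nu> r T a" and L: "L2_flow T s a"
  shows "\<And>t. t \<in> {0..T} \<Longrightarrow> a t \<in> sob 1"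
    "\<And>t. t \<in> {0..T} \<Longrightarrow> ((\<lambda>\<tau>. sobn 1 (\<lambda>k. a \<tau> k - a t k)) \<longlongrightarrow> 0) (at t within {0..T})"
proof -
  obtain K where K: "K \<ge> 0"
    "\<And>t0 t1. 0 \<le> t0 \<Longrightarrow> t0 \<le> t1 \<Longrightarrow> t1 \<le> T \<Longrightarrow>
      (\<lambda>k. a t1 k - a t0 k) \<in> sob 1 \<and>
      sobn 1 (\<lambda>k. a t1 k - a t0 k) \<le> K * integral {t0..t1} (\<lambda>\<tau>. 1 + (sobn s (a \<tau>))\<^sup>2)"
    by (rule flow_H1_increment[OF r \<alpha> s \<nu>]) (use a L in blast)
  let ?h = "\<lambda>\<tau>. 1 + (sobn s (a \<tau>))\<^sup>2"
  have "set_integrable lborel {0..T} ?h"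
    using L by (intro set_integral_add(1)[OF continuous_set_integrable[OF continuous_on_const]]) (simp add: L2_flow_def)
  then have hint: "?h integrable_on {0..T}" by (rule set_borel_integral_eq_integral(1))
  define G where "G = (\<lambda>t. integral {0..t} ?h)"
  have Gcont: "continuous_on {0..T} G"
    unfolding G_def by (rule indefinite_integral_continuous_1[OF hint])
  have Gd: "integral {x..y} ?h = G y - G x" if "0 \<le> x" "x \<le> y" "y \<le> T" for x y
    using Henstock_Kurzweil_Integration.integral_combine[of 0 x y ?h] that integrable_on_subinterval[OF hint, of 0 y]
    by (simp add: G_def)
  have diff: "(\<lambda>k. a y k - a x k) \<in> sob 1 \<and> sobn 1 (\<lambda>k. a y k - a x k) \<le> K * \<bar>G y - G x\<bar>"
    if "x \<in> {0..T}" "y \<in> {0..T}" for x y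
  proof (cases "x \<le> y")
    case True
    have *: "(\<lambda>k. a y k - a x k) \<in> sob 1 \<and> sobn 1 (\<lambda>k. a y k - a x k) \<le> K * (G y - G x)"
      using K(2)[of x y] Gd[of x y] True that by auto
    moreover have "K * (G y - G x) \<le> K * \<bar>G y - G x\<bar>" using K(1) by (intro mult_left_mono) auto
    ultimately show ?thesis by linarith
  next
    case False
    have *: "(\<lambda>k. a x k - a y k) \<in> sob 1 \<and> sobn 1 (\<lambda>k. a x k - a y k) \<le> K * (G x - G y)"
      using K(2)[of y x] Gd[of y x] False that by auto
    moreover have "K * (G x - G y) \<le> K * \<bar>G y - G x\<bar>" using K(1) by (intro mult_left_mono) auto
    moreover have "(\<lambda>k. a y k - a x k) \<in> sob 1" using * wsp_uminus[of "\<lambda>k. a x k - a y k"] by simp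
    ultimately show ?thesis using wnorm_minus_commute[of "\<lambda>k. jw k powr 1" "a x" "a y"] by linarith
  qed
  obtain t0 where t0: "t0 \<in> {0..T}" "a t0 \<in> sob s"
    using ex_AE_interval[of T "\<lambda>t. a t \<in> sob s"] L T unfolding L2_flow_def by blast
  then have "a t0 \<in> sob 1" using s by (intro sob_mono(1)[of 1 s]) auto
  then show "a t \<in> sob 1" if "t \<in> {0..T}" for t
    using wnorm_triangle(1)[of "\<lambda>k. jw k powr 1", OF _ diff[OF t0(1) that, THEN conjunct1] \<open>a t0 \<in> sob 1\<close>] by simp
  show "((\<lambda>\<tau>. sobn 1 (\<lambda>k. a \<tau> k - a t k)) \<longlongrightarrow> 0) (at t within {0..T})" if t: "t \<in> {0..T}" for t
  proof (rule Lim_null_comparison)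
    show "\<forall>\<^sub>F \<tau> in at t within {0..T}. norm (sobn 1 (\<lambda>k. a \<tau> k - a t k)) \<le> K * \<bar>G \<tau> - G t\<bar>"
      using diff[OF t] by (auto simp: eventually_at_filter)
    have "(G \<longlongrightarrow> G t) (at t within {0..T})" using Gcont t by (simp add: continuous_on_def)
    then have "((\<lambda>\<tau>. K * \<bar>G \<tau> - G t\<bar>) \<longlongrightarrow> K * \<bar>G t - G t\<bar>) (at t within {0..T})" by (intro tendsto_intros)
    then show "((\<lambda>\<tau>. K * \<bar>G \<tau> - G t\<bar>) \<longlongrightarrow> 0) (at t within {0..T})" by simp
  qed
qed

section \<open>Estimates for the difference of two flows\<close>

lemma wnorm_continuous_on:
  fixes X :: "real \<Rightarrow> 'i \<Rightarrow> 'b::real_normed_vector"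
  assumes \<mu>: "\<And>k. \<mu> k \<ge> 0" and X: "\<And>t. t \<in> S \<Longrightarrow> X t \<in> wsp \<mu>"
    and lim: "\<And>t. t \<in> S \<Longrightarrow> ((\<lambda>\<tau>. wnorm \<mu> (\<lambda>k. X \<tau> k - X t k)) \<longlongrightarrow> 0) (at t within S)"
  shows "continuous_on S (\<lambda>t. wnorm \<mu> (X t))"
  unfolding continuous_on_def
proof
  fix t assume t: "t \<in> S"
  have "\<forall>\<^sub>F \<tau> in at t within S. norm (wnorm \<mu> (X \<tau>) - wnorm \<mu> (X t)) \<le> wnorm \<mu> (\<lambda>k. X \<tau> k - X t k)"
    using wnorm_diff(3)[OF \<mu> X X[OF t]] by (auto simp: eventually_at_filter)
  then have "((\<lambda>\<tau>. wnorm \<mu> (X \<tau>) - wnorm \<mu> (X t)) \<longlongrightarrow> 0) (at t within S)"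
    by (rule Lim_null_comparison[OF _ lim[OF t]])
  then show "((\<lambda>\<tau>. wnorm \<mu> (X \<tau>)) \<longlongrightarrow> wnorm \<mu> (X t)) (at t within S)" by (rule LIM_zero_cancel)
qed

text \<open>Continuity in a stronger weighted norm passes to every dominated weight; this yields
  continuity in time of the energies and of the dissipation.\<close>

lemma wnorm_continuous_on_mono:
  fixes X :: "real \<Rightarrow> 'i \<Rightarrow> 'b::real_normed_vector"
  assumes \<mu>: "\<And>k. \<mu> k \<ge> 0" "\<And>k. \<nu> k \<ge> 0" "C \<ge> 0" "\<And>k. \<mu> k \<le> C\<^sup>2 * \<nu> k"
    and X: "\<And>t. t \<in> S \<Longrightarrow> X t \<in> wsp \<nu>"
    and lim: "\<And>t. t \<in> S \<Longrightarrow> ((\<lambda>\<tau>. wnorm \<nu> (\<lambda>k. X \<tau> k - X t k)) \<longlongrightarrow> 0) (at t within S)"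
  shows "continuous_on S (\<lambda>t. wnorm \<mu> (X t))"
proof (rule wnorm_continuous_on[OF \<mu>(1)])
  have mono: "a \<in> wsp \<mu> \<and> wnorm \<mu> a \<le> C * wnorm \<nu> a" if "a \<in> wsp \<nu>" for a :: "'i \<Rightarrow> 'b"
  proof -
    have "\<mu> k * (norm (a k))\<^sup>2 \<le> C\<^sup>2 * (\<nu> k * (norm (a k))\<^sup>2)" for k
      using mult_right_mono[OF \<mu>(4)[of k], of "(norm (a k))\<^sup>2"] by (simp add: mult.assoc)
    from wnorm_mono[OF \<mu>(1-3) this that] show ?thesis by blast
  qed
  show "X t \<in> wsp \<mu>" if "t \<in> S" for t using mono[OF X[OF that]] by blast
  show "((\<lambda>\<tau>. wnorm \<mu> (\<lambda>k. X \<tau> k - X t k)) \<longlongrightarrow> 0) (at t within S)" if t: "t \<in> S" for t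
  proof (rule Lim_null_comparison)
    show "\<forall>\<^sub>F \<tau> in at t within S. norm (wnorm \<mu> (\<lambda>k. X \<tau> k - X t k)) \<le> C * wnorm \<nu> (\<lambda>k. X \<tau> k - X t k)"
      using mono[OF wnorm_diff(1)[OF \<mu>(2) X X[OF t]]] \<mu>(1) by (auto simp: eventually_at_filter)
    have "((\<lambda>\<tau>. C * wnorm \<nu> (\<lambda>k. X \<tau> k - X t k)) \<longlongrightarrow> C * 0) (at t within S)"
      by (intro tendsto_intros lim t)
    then show "((\<lambda>\<tau>. C * wnorm \<nu> (\<lambda>k. X \<tau> k - X t k)) \<longlongrightarrow> 0) (at t within S)" by simp
  qed
qed

lemma tendsto_wnorm_diff:
  fixes X Y :: "real \<Rightarrow> 'i \<Rightarrow> 'b::real_normed_vector"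
  assumes \<mu>: "\<And>k. \<mu> k \<ge> 0" and X: "\<And>t. t \<in> S \<Longrightarrow> X t \<in> wsp \<mu>" and Y: "\<And>t. t \<in> S \<Longrightarrow> Y t \<in> wsp \<mu>"
    and limX: "((\<lambda>\<tau>. wnorm \<mu> (\<lambda>k. X \<tau> k - X t k)) \<longlongrightarrow> 0) (at t within S)"
    and limY: "((\<lambda>\<tau>. wnorm \<mu> (\<lambda>k. Y \<tau> k - Y t k)) \<longlongrightarrow> 0) (at t within S)" and t: "t \<in> S"
  shows "((\<lambda>\<tau>. wnorm \<mu> (\<lambda>k. (X \<tau> k - Y \<tau> k) - (X t k - Y t k))) \<longlongrightarrow> 0) (at t within S)"
proof (rule Lim_null_comparison)
  have "wnorm \<mu> (\<lambda>k. (X \<tau> k - Y \<tau> k) - (X t k - Y t k)) \<le> wnorm \<mu> (\<lambda>k. X \<tau> k - X t k) + wnorm \<mu> (\<lambda>k. Y \<tau> k - Y t k)"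
    if "\<tau> \<in> S" for \<tau>
    using wnorm_diff(2)[OF \<mu> wnorm_diff(1)[OF \<mu> X[OF that] X[OF t]] wnorm_diff(1)[OF \<mu> Y[OF that] Y[OF t]]]
    by (simp add: algebra_simps)
  then show "\<forall>\<^sub>F \<tau> in at t within S. norm (wnorm \<mu> (\<lambda>k. (X \<tau> k - Y \<tau> k) - (X t k - Y t k)))
      \<le> wnorm \<mu> (\<lambda>k. X \<tau> k - X t k) + wnorm \<mu> (\<lambda>k. Y \<tau> k - Y t k)"
    using \<mu> by (auto simp: eventually_at_filter)
  show "((\<lambda>\<tau>. wnorm \<mu> (\<lambda>k. X \<tau> k - X t k) + wnorm \<mu> (\<lambda>k. Y \<tau> k - Y t k)) \<longlongrightarrow> 0) (at t within S)"
    using tendsto_add[OF limX limY] by simp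
qed

lemma vflow_diff:
  assumes a: "vflow r T a" and b: "vflow r T b"
  shows "vflow r T (\<lambda>\<tau> k. a \<tau> k - b \<tau> k)"
  unfolding vflow_def
proof (intro conjI ballI)
  fix t assume t: "t \<in> {0..T}"
  note A = vflowD[OF a] and B = vflowD[OF b]
  show "(\<lambda>k. a t k - b t k) \<in> sob r" using A(1)[OF t] B(1)[OF t] by (intro wnorm_diff) auto
  show "solenoidal (\<lambda>k. a t k - b t k)" "real_coeffs (\<lambda>k. a t k - b t k)" "a t 0 - b t 0 = 0"
    using A(2-4)[OF t] B(2-4)[OF t] by (auto simp: solenoidal_def real_coeffs_def cdot_diff_left)
  show "((\<lambda>\<tau>. sobn r (\<lambda>k. (a \<tau> k - b \<tau> k) - (a t k - b t k))) \<longlongrightarrow> 0) (at t within {0..T})"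
    using A(1,5) B(1,5) t by (intro tendsto_wnorm_diff) auto
qed

text \<open>An exhausting sequence of finite sets: dominated convergence in time needs a sequence,
  not the filter of all finite sets.\<close>

definition lbox :: "nat \<Rightarrow> (int^3) set" where
  "lbox n = {k. \<forall>i. \<bar>k $ i\<bar> \<le> int n}"

lemma finite_lbox: "finite (lbox n)"
proof -
  have "lbox n \<subseteq> vec_lambda ` (PiE UNIV (\<lambda>_::3. {- int n..int n}))"
  proof
    fix k assume "k \<in> lbox n"
    then have "vec_nth k \<in> PiE UNIV (\<lambda>_. {- int n..int n})" by (auto simp: lbox_def abs_le_iff minus_le_iff)
    then have "vec_lambda (vec_nth k) \<in> vec_lambda ` (PiE UNIV (\<lambda>_::3. {- int n..int n}))" by (rule imageI)
    then show "k \<in> vec_lambda ` (PiE UNIV (\<lambda>_::3. {- int n..int n}))" by simp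
  qed
  then show ?thesis by (rule finite_subset) (intro finite_imageI finite_PiE, auto)
qed

lemma filterlim_lbox: "filterlim lbox (finite_subsets_at_top UNIV) sequentially"
  unfolding filterlim_finite_subsets_at_top
proof (intro allI impI)
  fix X :: "(int^3) set" assume "finite X \<and> X \<subseteq> UNIV"
  then have X: "finite X" by simp
  \<comment> \<open>The inserted 0 keeps the maximum meaningful when \<open>X\<close> is
    empty.\<close>
  define N where "N = Max (insert 0 ((\<lambda>(k, i). nat \<bar>k $ i\<bar>) ` (X \<times> (UNIV :: 3 set))))"
  have "nat \<bar>k $ i\<bar> \<le> N" if "k \<in> X" for k i
    unfolding N_def using X that by (intro Max_ge) auto
  then have "X \<subseteq> lbox N" by (auto simp: lbox_def nat_le_iff)
  moreover have "lbox N \<subseteq> lbox n" if "N \<le> n" for n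
    using that by (auto simp: lbox_def intro: order_trans)
  ultimately show "\<forall>\<^sub>F n in sequentially. finite (lbox n) \<and> X \<subseteq> lbox n \<and> lbox n \<subseteq> UNIV"
    by (intro eventually_sequentiallyI[of N]) (use finite_lbox in blast)
qed

lemma lbox_sums:
  assumes "\<And>k. \<mu> k \<ge> 0" "x \<in> wsp \<mu>"
  shows "(\<lambda>n. \<Sum>k\<in>lbox n. \<mu> k * (norm (x k))\<^sup>2) \<longlonglongrightarrow> (wnorm \<mu> x)\<^sup>2"
proof -
  have "((\<lambda>k. \<mu> k * (norm (x k))\<^sup>2) has_sum (wnorm \<mu> x)\<^sup>2) UNIV"
    unfolding wnorm_sq[of \<mu> x, OF assms(1)] using assms(2) by (simp add: wsp_def)
  then show ?thesis unfolding has_sum_def by (rule filterlim_compose[OF _ filterlim_lbox])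
qed

text \<open>The truncation and the tail live on disjoint frequencies. Written as a difference, the
  tail norm is visibly continuous in time and tends to zero along the boxes.\<close>

lemma wnorm_tail_sq:
  assumes \<mu>: "\<And>k. \<mu> k \<ge> 0" and x: "x \<in> wsp \<mu>" and F: "finite F"
  shows "(wnorm \<mu> (\<lambda>k. x k - (if k \<in> F then x k else 0)))\<^sup>2 = (wnorm \<mu> x)\<^sup>2 - (\<Sum>k\<in>F. \<mu> k * (norm (x k))\<^sup>2)"
proof -
  let ?z = "\<lambda>k. if k \<in> F then x k else 0"
  have z: "?z \<in> wsp \<mu>" "(wnorm \<mu> ?z)\<^sup>2 = (\<Sum>k\<in>F. \<mu> k * (norm (x k))\<^sup>2)"
    using wnorm_finite_sum[OF F, of ?z \<mu>] \<mu> by simp_all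
  have "(wnorm \<mu> (\<lambda>k. x k - ?z k))\<^sup>2 = (\<Sum>\<^sub>\<infinity>k. \<mu> k * (norm (x k))\<^sup>2 - \<mu> k * (norm (?z k))\<^sup>2)"
    unfolding wnorm_sq[of \<mu>, OF \<mu>] by (intro infsum_cong) auto
  also have "\<dots> = (wnorm \<mu> x)\<^sup>2 - (wnorm \<mu> ?z)\<^sup>2"
    unfolding wnorm_sq[of \<mu>, OF \<mu>] using x z(1) by (intro infsum_diff_real) (auto simp: wsp_def)
  finally show ?thesis using z(2) by simp
qed

text \<open>With x the coefficient of a and y that of the difference, x - y is the coefficient of b.
  The identity |x|^2 - 2 (x - y) . y = |x - y|^2 + |y|^2 gives the constant 1, hence the bare factor
  \<nu> in the energy estimate.\<close>

lemma young_weighted_inner: "2 * (l * ((x - y) \<bullet> y)) \<le> l * (norm x)\<^sup>2" if "l \<ge> 0" for x y :: "complex^3" and l :: real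
proof -
  have "0 \<le> (norm (x - y))\<^sup>2 + (norm y)\<^sup>2" by simp
  then have "2 * ((x - y) \<bullet> y) \<le> (norm x)\<^sup>2"
    by (simp add: power2_norm_eq_inner inner_diff_left inner_diff_right inner_commute)
  from mult_left_mono[OF this that] show ?thesis by simp
qed

lemma sob_restrict:
  fixes x :: "int^3 \<Rightarrow> complex^3"
  assumes "x \<in> sob \<tau>" "\<And>k. jw k powr \<sigma> * (norm (z k))\<^sup>2 \<le> jw k powr \<tau> * (norm (x k))\<^sup>2"
  shows "(\<lambda>k. if k \<in> F then z k else 0) \<in> sob \<sigma>" "sobn \<sigma> (\<lambda>k. if k \<in> F then z k else 0) \<le> sobn \<tau> x"
proof -
  have "jw k powr \<sigma> * (norm (if k \<in> F then z k else 0))\<^sup>2 \<le> 1\<^sup>2 * (jw k powr \<tau> * (norm (x k))\<^sup>2)" for k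
    using assms(2)[of k] by auto
  from wnorm_mono[OF _ _ _ this assms(1)] show "(\<lambda>k. if k \<in> F then z k else 0) \<in> sob \<sigma>"
    "sobn \<sigma> (\<lambda>k. if k \<in> F then z k else 0) \<le> sobn \<tau> x" by simp_all
qed

text \<open>The inequality is first proved on boxes of modes, with an error that vanishes as the
  boxes grow; Gronwall follows. The constant is chosen before \<nu> and b, since after the limit
  only the bound \<open>A\<close> on the inviscid flow enters the rate.\<close>

theorem flow_energy_estimate:
  assumes r: "5/6 < r" "r \<le> 1" and \<alpha>: "\<alpha> > 0" and a: "voigt_flow \<alpha> 0 r T a" and T: "T > 0"
    and a1: "\<And>t. t \<in> {0..T} \<Longrightarrow> a t \<in> sob 1"
      "\<And>t. t \<in> {0..T} \<Longrightarrow> ((\<lambda>\<tau>. sobn 1 (\<lambda>k. a \<tau> k - a t k)) \<longlongrightarrow> 0) (at t within {0..T})"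
  obtains K where "K > 0"
    "\<And>\<nu> b t. \<nu> > 0 \<Longrightarrow> voigt_flow \<alpha> \<nu> r T b \<Longrightarrow> t \<in> {0..T} \<Longrightarrow>
      (wnorm (voigt_weight \<alpha> r) (\<lambda>k. a t k - b t k))\<^sup>2 \<le>
       ((wnorm (voigt_weight \<alpha> r) (\<lambda>k. a 0 k - b 0 k))\<^sup>2
         + \<nu> * integral {0..t} (\<lambda>\<tau>. (wnorm stokes_eigenvalue (a \<tau>))\<^sup>2)) * exp (K * t)"
proof -
  obtain C where C: "C \<ge> 0"
    "\<And>a b c. solenoidal a \<Longrightarrow> a \<in> sob r \<Longrightarrow> b \<in> sob r \<Longrightarrow> c \<in> sob r \<Longrightarrow>
       bsummable a b c \<and> \<bar>bform a b c\<bar> \<le> C * (sobn r a * sobn r b * sobn r c)"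
    by (rule bform_bound[of r r r]) (use r in auto)
  obtain c where c: "c \<ge> 1" "\<And>k. jw k powr r \<le> c * voigt_weight \<alpha> r k" "\<And>k. voigt_weight \<alpha> r k \<le> c * jw k powr r"
    using voigt_weight_bounds[OF \<alpha>, of r] r by (metis less_trans zero_less_divide_iff zero_less_numeral)
  have va: "vflow r T a" using a by (simp add: voigt_flow_def)
  obtain A where A: "\<And>\<tau>. \<tau> \<in> {0..T} \<Longrightarrow> sobn r (a \<tau>) \<le> A"
    using compact_imp_bounded[OF compact_continuous_image[OF vflow_norm_continuous[OF va] compact_Icc]]
    by (force simp: bounded_iff)
  have A0: "A \<ge> 0" using A[of 0] T order_trans[OF wnorm_nonneg A[of 0]] by force
  let ?\<mu> = "voigt_weight \<alpha> r"
  define S where "S = (\<lambda>\<tau>. (wnorm stokes_eigenvalue (a \<tau>))\<^sup>2)"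
  have Sc: "continuous_on {0..T} S"
    unfolding S_def
    by (intro continuous_intros wnorm_continuous_on_mono[where C=1 and \<nu>="\<lambda>k. jw k powr 1"])
       (use a1 stokes_le_jw in auto)
  \<comment> \<open>The factor \<open>c\<close> converts the squared norm in \<open>sob r\<close>
    into the energy; the summand 1 keeps \<open>K\<close> positive when the rest vanishes.\<close>
  define K where "K = 2 * C * A * c + 1"
  have K: "K > 0" using C A0 c by (simp add: K_def add_nonneg_pos)
  show thesis
  proof (rule that[OF K])
    fix \<nu> b t assume \<nu>: "\<nu> > (0 :: real)" and b: "voigt_flow \<alpha> \<nu> r T b" and t: "t \<in> {0..T}"
    have vb: "vflow r T b" using b by (simp add: voigt_flow_def)
    define w where "w = (\<lambda>\<tau> k. a \<tau> k - b \<tau> k)"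
    have vw: "vflow r T w" unfolding w_def by (rule vflow_diff[OF va vb])
    note A' = vflowD[OF va] and B' = vflowD[OF vb] and W' = vflowD[OF vw]
    define E where "E = (\<lambda>\<tau>. (wnorm ?\<mu> (w \<tau>))\<^sup>2)"
    have cc: "(sqrt c)\<^sup>2 = c" using c by simp
    have Ec: "continuous_on {0..T} E"
      unfolding E_def
      by (intro continuous_intros wnorm_continuous_on_mono[where C="sqrt c" and \<nu>="\<lambda>k. jw k powr r"])
         (use W' c cc in auto)
    have w\<mu>: "w \<tau> \<in> wsp ?\<mu>" if "\<tau> \<in> {0..T}" for \<tau>
      using wnorm_mono(1)[of ?\<mu> "\<lambda>k. jw k powr r" "sqrt c" "w \<tau>" "w \<tau>"] W'(1)[OF that] c cc
      by (simp add: mult_right_mono flip: mult.assoc)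
    have wE: "(sobn r (w \<tau>))\<^sup>2 \<le> c * E \<tau>" if "\<tau> \<in> {0..T}" for \<tau>
    proof -
      have "sobn r (w \<tau>) \<le> sqrt c * wnorm ?\<mu> (w \<tau>)"
        using wnorm_mono(2)[of "\<lambda>k. jw k powr r" ?\<mu> "sqrt c" "w \<tau>" "w \<tau>"] w\<mu>[OF that] c cc
        by (simp add: mult_right_mono flip: mult.assoc)
      from power_mono[OF this, of 2] show ?thesis using cc by (simp add: E_def power_mult_distrib)
    qed
    \<comment> \<open>The norm of the part of w outside the box, to which the truncation error is
      proportional.\<close>
    define \<rho> where "\<rho> = (\<lambda>n \<tau>. sobn r (\<lambda>k. w \<tau> k - (if k \<in> lbox n then w \<tau> k else 0)))"
    have \<rho>_eq: "\<rho> n \<tau> = sqrt ((sobn r (w \<tau>))\<^sup>2 - (\<Sum>k\<in>lbox n. jw k powr r * (norm (w \<tau> k))\<^sup>2))"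
      if "\<tau> \<in> {0..T}" for n \<tau>
    proof -
      have "(\<rho> n \<tau>)\<^sup>2 = (sobn r (w \<tau>))\<^sup>2 - (\<Sum>k\<in>lbox n. jw k powr r * (norm (w \<tau> k))\<^sup>2)"
        unfolding \<rho>_def using W'(1)[OF that] by (intro wnorm_tail_sq finite_lbox) auto
      moreover have "\<rho> n \<tau> \<ge> 0" by (simp add: \<rho>_def)
      ultimately show ?thesis by (metis real_sqrt_unique)
    qed
    have \<rho>c: "continuous_on {0..T} (\<rho> n)" for n
    proof -
      have "continuous_on {0..T} (\<lambda>\<tau>. sqrt ((sobn r (w \<tau>))\<^sup>2 - (\<Sum>k\<in>lbox n. jw k powr r * (norm (w \<tau> k))\<^sup>2)))"
        by (intro continuous_intros vflow_norm_continuous[OF vw] vflow_continuous[OF vw])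
      then show ?thesis by (rule continuous_on_eq) (simp add: \<rho>_eq)
    qed
    have \<rho>0: "0 \<le> \<rho> n \<tau>" for n \<tau> by (simp add: \<rho>_def)
    have \<rho>le: "\<rho> n \<tau> \<le> sobn r (w \<tau>)" if "\<tau> \<in> {0..T}" for n \<tau>
    proof -
      have "(\<Sum>k\<in>lbox n. jw k powr r * (norm (w \<tau> k))\<^sup>2) \<ge> 0" by (intro sum_nonneg) auto
      then show ?thesis unfolding \<rho>_eq[OF that] by (intro real_le_lsqrt) auto
    qed
    have \<rho>lim: "(\<lambda>n. \<rho> n \<tau>) \<longlonglongrightarrow> 0" if "\<tau> \<in> {0..T}" for \<tau>
    proof -
      have "(\<lambda>n. sqrt ((sobn r (w \<tau>))\<^sup>2 - (\<Sum>k\<in>lbox n. jw k powr r * (norm (w \<tau> k))\<^sup>2)))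
        \<longlonglongrightarrow> sqrt ((sobn r (w \<tau>))\<^sup>2 - (sobn r (w \<tau>))\<^sup>2)"
        using W'(1)[OF that] by (intro tendsto_intros lbox_sums) auto
      then show ?thesis using \<rho>_eq[OF that] by simp
    qed
    define err where "err = (\<lambda>n \<tau>. 2 * C * (sobn r (b \<tau>) * \<rho> n \<tau> * sobn r (w \<tau>)))"
    define base where "base = (\<lambda>\<tau>. 2 * C * A * c * E \<tau> + \<nu> * S \<tau>)"
    have point: "(\<Sum>k\<in>lbox n. 2 * 1 * ((flux \<nu> (b \<tau>) k - flux 0 (a \<tau>) k) \<bullet> w \<tau> k)) \<le> base \<tau> + err n \<tau>"
      if \<tau>: "\<tau> \<in> {0..T}" for n \<tau>
    proof -
      let ?F = "lbox n"
      let ?z = "\<lambda>k. if k \<in> ?F then w \<tau> k else 0"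
      note aa = A'[OF \<tau>] and bb = B'[OF \<tau>] and ww = W'[OF \<tau>]
      have z: "?z \<in> sob r" "sobn r ?z \<le> sobn r (w \<tau>)"
        by (rule sob_restrict[OF ww(1)], simp)+
      have z': "(\<lambda>k. w \<tau> k - ?z k) \<in> sob r" using ww(1) z(1) by (intro wnorm_diff) auto
      note bs = bsummable_sob[OF r(1)]
      have "bform (w \<tau>) (a \<tau>) ?z = bform (a \<tau>) (a \<tau>) ?z - bform (b \<tau>) (a \<tau>) ?z"
        unfolding w_def by (intro bform_diff1 bs aa bb z[unfolded w_def])
      moreover have "bform (b \<tau>) (w \<tau>) ?z = bform (b \<tau>) (a \<tau>) ?z - bform (b \<tau>) (b \<tau>) ?z"
        unfolding w_def by (intro bform_diff2 bs aa bb z[unfolded w_def])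
      moreover have "bform (b \<tau>) (\<lambda>k. w \<tau> k - ?z k) ?z = bform (b \<tau>) (w \<tau>) ?z - bform (b \<tau>) ?z ?z"
        by (intro bform_diff2 bs bb ww z)
      moreover have "bform (b \<tau>) ?z ?z = 0" using bform_antisym[OF bb(2,3), of ?z ?z] by simp
      \<comment> \<open>The difference of the nonlinear terms is grouped as B(w,a) + B(b,w).
        Antisymmetry removes the truncated part of w in B(b,w), and the tail remains.\<close>
      ultimately have e: "bform (b \<tau>) (b \<tau>) ?z - bform (a \<tau>) (a \<tau>) ?z
        = - bform (w \<tau>) (a \<tau>) ?z - bform (b \<tau>) (\<lambda>k. w \<tau> k - ?z k) ?z" by linarith
      have "\<bar>bform (w \<tau>) (a \<tau>) ?z\<bar> \<le> C * (sobn r (w \<tau>) * sobn r (a \<tau>) * sobn r ?z)"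
        using C(2) ww aa z by blast
      also have "\<dots> \<le> C * (sobn r (w \<tau>) * A * sobn r (w \<tau>))"
        using C(1) A0 A[OF \<tau>] z(2) by (intro mult_left_mono mult_mono) auto
      also have "\<dots> = C * A * (sobn r (w \<tau>))\<^sup>2" by (simp add: power2_eq_square mult_ac)
      also have "\<dots> \<le> C * A * (c * E \<tau>)" using C(1) A0 wE[OF \<tau>] by (intro mult_left_mono) auto
      finally have 1: "\<bar>bform (w \<tau>) (a \<tau>) ?z\<bar> \<le> C * A * (c * E \<tau>)" .
      have "\<bar>bform (b \<tau>) (\<lambda>k. w \<tau> k - ?z k) ?z\<bar> \<le> C * (sobn r (b \<tau>) * \<rho> n \<tau> * sobn r ?z)"
        unfolding \<rho>_def using C(2) bb z' z by blast
      also have "\<dots> \<le> C * (sobn r (b \<tau>) * \<rho> n \<tau> * sobn r (w \<tau>))"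
        using C(1) z(2) \<rho>0 by (intro mult_left_mono) auto
      finally have 2: "\<bar>bform (b \<tau>) (\<lambda>k. w \<tau> k - ?z k) ?z\<bar> \<le> C * (sobn r (b \<tau>) * \<rho> n \<tau> * sobn r (w \<tau>))" .
      have "2 * (\<Sum>k\<in>?F. stokes_eigenvalue k * (b \<tau> k \<bullet> w \<tau> k)) = (\<Sum>k\<in>?F. 2 * (stokes_eigenvalue k * ((a \<tau> k - w \<tau> k) \<bullet> w \<tau> k)))"
        by (simp add: w_def sum_distrib_left)
      also have "\<dots> \<le> (\<Sum>k\<in>?F. stokes_eigenvalue k * (norm (a \<tau> k))\<^sup>2)"
        by (intro sum_mono young_weighted_inner) simp
      also have "\<dots> \<le> S \<tau>"
      proof -
        have "a \<tau> \<in> wsp stokes_eigenvalue"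
          using wnorm_mono(1)[of stokes_eigenvalue "\<lambda>k. jw k powr 1" 1 "a \<tau>" "a \<tau>"] a1(1)[OF \<tau>] stokes_le_jw
          by (simp add: mult_right_mono)
        then show ?thesis unfolding S_def by (intro wnorm_finite_le finite_lbox) auto
      qed
      finally have 3: "\<nu> * (2 * (\<Sum>k\<in>?F. stokes_eigenvalue k * (b \<tau> k \<bullet> w \<tau> k))) \<le> \<nu> * S \<tau>"
        using \<nu> by (intro mult_left_mono) auto
      have "(\<Sum>k\<in>?F. 2 * 1 * ((flux \<nu> (b \<tau>) k - flux 0 (a \<tau>) k) \<bullet> w \<tau> k))
        = 2 * ((\<Sum>k\<in>?F. flux \<nu> (b \<tau>) k \<bullet> w \<tau> k) - (\<Sum>k\<in>?F. flux 0 (a \<tau>) k \<bullet> w \<tau> k))"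
        by (simp add: inner_diff_left sum_subtractf sum_distrib_left)
      also have "\<dots> = 2 * (bform (b \<tau>) (b \<tau>) ?z - bform (a \<tau>) (a \<tau>) ?z) + \<nu> * (2 * (\<Sum>k\<in>?F. stokes_eigenvalue k * (b \<tau> k \<bullet> w \<tau> k)))"
        unfolding sum_flux_inner[OF r(1) aa(2,1) finite_lbox] sum_flux_inner[OF r(1) bb(2,1) finite_lbox] by simp
      also have "\<dots> \<le> base \<tau> + err n \<tau>"
      proof -
        have "2 * (C * A * (c * E \<tau>)) = 2 * C * A * c * E \<tau>"
          "2 * (C * (sobn r (b \<tau>) * \<rho> n \<tau> * sobn r (w \<tau>))) = 2 * C * (sobn r (b \<tau>) * \<rho> n \<tau> * sobn r (w \<tau>))"
          by simp_all
        moreover have "2 * (bform (b \<tau>) (b \<tau>) ?z - bform (a \<tau>) (a \<tau>) ?z)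
          \<le> 2 * (C * A * (c * E \<tau>)) + 2 * (C * (sobn r (b \<tau>) * \<rho> n \<tau> * sobn r (w \<tau>)))"
        proof -
          have "2 * (- x - y) \<le> 2 * p + 2 * q" if "- x \<le> p" "- y \<le> q" for x y p q :: real
          proof -
            have "- x - y \<le> p + q" using that by linarith
            from mult_left_mono[OF this, of 2] show ?thesis by (simp only: distrib_left)
          qed
          then show ?thesis unfolding e using abs_le_D2[OF 1] abs_le_D2[OF 2] .
        qed
        moreover have "x + y \<le> p' + s + q'" if "p = p'" "q = q'" "x \<le> p + q" "y \<le> s" for x y p q p' q' s :: real
          using that by linarith
        ultimately show ?thesis unfolding base_def err_def using 3 by blast
      qed
      finally show ?thesis .
    qed
    have est: "E t \<le> E 0 + integral {0..t} base" if t: "t \<in> {0..T}" for t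
    proof -
      have sub: "{0..t} \<subseteq> {0..T}" using t by auto
      have bc: "continuous_on {0..t} base"
        unfolding base_def by (intro continuous_intros continuous_on_subset[OF Ec sub] continuous_on_subset[OF Sc sub])
      have ec: "continuous_on {0..t} (err n)" for n
        unfolding err_def
        by (intro continuous_intros continuous_on_subset[OF \<rho>c sub] continuous_on_subset[OF vflow_norm_continuous[OF vb] sub]
           continuous_on_subset[OF vflow_norm_continuous[OF vw] sub])
      have n: "(\<Sum>k\<in>lbox n. ?\<mu> k * (norm (w t k))\<^sup>2) \<le> E 0 + (integral {0..t} base + integral {0..t} (err n))" for n
      proof -
        have "(\<Sum>k\<in>lbox n. 1 * ?\<mu> k * (norm (w t k))\<^sup>2) = (\<Sum>k\<in>lbox n. 1 * ?\<mu> k * (norm (w 0 k))\<^sup>2)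
          + integral {0..t} (\<lambda>\<tau>. \<Sum>k\<in>lbox n. 2 * 1 * ((flux \<nu> (b \<tau>) k - flux 0 (a \<tau>) k) \<bullet> w \<tau> k))"
          unfolding w_def by (rule flow_energy_identity[OF r(1) a b t finite_lbox])
        also have "(\<Sum>k\<in>lbox n. 1 * ?\<mu> k * (norm (w 0 k))\<^sup>2) \<le> E 0"
          unfolding E_def using wnorm_finite_le[OF _ w\<mu> finite_lbox, of 0 n] T by simp
        also have "integral {0..t} (\<lambda>\<tau>. \<Sum>k\<in>lbox n. 2 * 1 * ((flux \<nu> (b \<tau>) k - flux 0 (a \<tau>) k) \<bullet> w \<tau> k))
          \<le> integral {0..t} (\<lambda>\<tau>. base \<tau> + err n \<tau>)"
          by (intro integral_le integrable_continuous_interval continuous_intros bc ec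
             continuous_on_subset[OF flux_continuous[OF r(1) va] sub] continuous_on_subset[OF flux_continuous[OF r(1) vb] sub]
             continuous_on_subset[OF vflow_continuous[OF vw] sub] point)
             (use t in auto)
        also have "\<dots> = integral {0..t} base + integral {0..t} (err n)"
          by (intro Henstock_Kurzweil_Integration.integral_add integrable_continuous_interval bc ec)
        finally show ?thesis by simp
      qed
      \<comment> \<open>The dominating function is the error with the whole of w in place of its
        tail, which is continuous in time.\<close>
      have "(\<lambda>n. integral {0..t} (err n)) \<longlonglongrightarrow> integral {0..t} (\<lambda>_. 0)"
      proof (rule dominated_convergence)
        show "err n integrable_on {0..t}" for n by (intro integrable_continuous_interval ec)
        show "(\<lambda>\<tau>. 2 * C * (sobn r (b \<tau>) * sobn r (w \<tau>) * sobn r (w \<tau>))) integrable_on {0..t}"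
          by (intro integrable_continuous_interval continuous_intros continuous_on_subset[OF vflow_norm_continuous[OF vb] sub]
           continuous_on_subset[OF vflow_norm_continuous[OF vw] sub])
        fix n \<tau> assume "\<tau> \<in> {0..t}"
        then have \<tau>: "\<tau> \<in> {0..T}" using sub by auto
        have "err n \<tau> \<ge> 0" unfolding err_def using C(1) \<rho>0[of n \<tau>] by simp
        moreover have "err n \<tau> \<le> 2 * C * (sobn r (b \<tau>) * sobn r (w \<tau>) * sobn r (w \<tau>))"
          unfolding err_def using C(1) \<rho>le[OF \<tau>, of n] by (intro mult_left_mono mult_right_mono) auto
        ultimately show "norm (err n \<tau>) \<le> 2 * C * (sobn r (b \<tau>) * sobn r (w \<tau>) * sobn r (w \<tau>))" by simp
      next
        fix \<tau> assume "\<tau> \<in> {0..t}"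
        then have \<tau>: "\<tau> \<in> {0..T}" using sub by auto
        have "(\<lambda>n. err n \<tau>) \<longlonglongrightarrow> 2 * C * (sobn r (b \<tau>) * 0 * sobn r (w \<tau>))"
          unfolding err_def by (intro tendsto_intros \<rho>lim[OF \<tau>])
        then show "(\<lambda>n. err n \<tau>) \<longlonglongrightarrow> 0" by simp
      qed
      then have "(\<lambda>n. E 0 + (integral {0..t} base + integral {0..t} (err n))) \<longlonglongrightarrow> E 0 + (integral {0..t} base + 0)"
        by (intro tendsto_intros) simp
      moreover have "(\<lambda>n. \<Sum>k\<in>lbox n. ?\<mu> k * (norm (w t k))\<^sup>2) \<longlonglongrightarrow> E t"
        unfolding E_def using w\<mu>[OF t] by (intro lbox_sums) auto
      ultimately have "E t \<le> E 0 + (integral {0..t} base + 0)" using n by (intro LIMSEQ_le) auto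
      then show ?thesis by simp
    qed
    have S0: "S \<tau> \<ge> 0" and E0: "E \<tau> \<ge> 0" for \<tau> by (simp_all add: S_def E_def)
    have "E t \<le> (E 0 + \<nu> * integral {0..t} S) * exp (K * t)"
    proof (rule gronwall_const)
      have sub: "{0..t} \<subseteq> {0..T}" using t by auto
      show "continuous_on {0..t} E" by (rule continuous_on_subset[OF Ec sub])
      fix \<sigma> assume \<sigma>: "\<sigma> \<in> {0..t}"
      have sub': "{0..\<sigma>} \<subseteq> {0..T}" using t \<sigma> by auto
      note iE = integrable_continuous_interval[OF continuous_on_subset[OF Ec sub']]
        and iS = integrable_continuous_interval[OF continuous_on_subset[OF Sc sub']]
      have "E \<sigma> \<le> E 0 + integral {0..\<sigma>} base" using est \<sigma> t by auto
      also have "integral {0..\<sigma>} base = integral {0..\<sigma>} (\<lambda>\<tau>. 2 * C * A * c * E \<tau>) + integral {0..\<sigma>} (\<lambda>\<tau>. \<nu> * S \<tau>)"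
        unfolding base_def by (intro Henstock_Kurzweil_Integration.integral_add integrable_on_mult_right iE iS)
      also have "\<dots> = 2 * C * A * c * integral {0..\<sigma>} E + \<nu> * integral {0..\<sigma>} S" by simp
      finally have "E \<sigma> \<le> E 0 + (2 * C * A * c * integral {0..\<sigma>} E + \<nu> * integral {0..\<sigma>} S)" .
      moreover have "2 * C * A * c * integral {0..\<sigma>} E \<le> K * integral {0..\<sigma>} E"
        unfolding K_def using Henstock_Kurzweil_Integration.integral_nonneg[OF iE E0] by (intro mult_right_mono) auto
      \<comment> \<open>The dissipation is enlarged to the final time t, which makes it a constant
        for Gronwall on [0, t].\<close>
      moreover have "\<nu> * integral {0..\<sigma>} S \<le> \<nu> * integral {0..t} S"
        using \<nu> \<sigma> S0 iS integrable_continuous_interval[OF continuous_on_subset[OF Sc sub]]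
        by (intro mult_left_mono integral_subset_le) auto
      ultimately show "E \<sigma> \<le> E 0 + \<nu> * integral {0..t} S + K * integral {0..\<sigma>} E" by linarith
    qed (use t K in auto)
    then show "(wnorm ?\<mu> (\<lambda>k. a t k - b t k))\<^sup>2 \<le>
       ((wnorm ?\<mu> (\<lambda>k. a 0 k - b 0 k))\<^sup>2 + \<nu> * integral {0..t} (\<lambda>\<tau>. (wnorm stokes_eigenvalue (a \<tau>))\<^sup>2)) * exp (K * t)"
      unfolding E_def w_def S_def .
  qed
qed

text \<open>The weight \<open>jw k powr (1 - r)\<close> raises the Voigt symbol from the order of
  \<open>jw k powr r\<close> to that of \<open>jw k\<close>. Smallness in \<open>sob r\<close> turns
  the contribution quadratic in w into a linear one. The remaining rate grows with the
  \<open>sob s\<close> norm of a, which is square integrable and hence integrable in time.\<close>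

theorem flow_H1_estimate:
  assumes r: "5/6 < r" "r \<le> 1" and \<alpha>: "\<alpha> > 0" and s: "s > 3/2" and T: "T > 0"
    and a: "voigt_flow \<alpha> 0 r T a" and La: "L2_flow T s a"
  obtains K where "K \<ge> 0"
    "\<And>\<nu> b t. \<nu> > 0 \<Longrightarrow> voigt_flow \<alpha> \<nu> r T b \<Longrightarrow> L2_flow T s b \<Longrightarrow>
      (\<And>\<tau>. \<tau> \<in> {0..T} \<Longrightarrow> sobn r (\<lambda>k. a \<tau> k - b \<tau> k) \<le> 1) \<Longrightarrow> t \<in> {0..T} \<Longrightarrow>
      (sobn 1 (\<lambda>k. a t k - b t k))\<^sup>2 \<le> K * ((sobn 1 (\<lambda>k. a 0 k - b 0 k))\<^sup>2 + \<nu>\<^sup>2)"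
proof -
  obtain C1 where C1: "C1 \<ge> 0"
    "\<And>a b c. solenoidal a \<Longrightarrow> a \<in> sob 1 \<Longrightarrow> b \<in> sob s \<Longrightarrow> c \<in> sob (2 * r - 1) \<Longrightarrow>
       bsummable a b c \<and> \<bar>bform a b c\<bar> \<le> C1 * (sobn 1 a * sobn s b * sobn (2 * r - 1) c)"
    by (rule bform_bound[of 1 s "2 * r - 1"]) (use r s in auto)
  obtain C2 where C2: "C2 \<ge> 0"
    "\<And>a b c. solenoidal a \<Longrightarrow> a \<in> sob s \<Longrightarrow> b \<in> sob 1 \<Longrightarrow> c \<in> sob (2 * r - 1) \<Longrightarrow>
       bsummable a b c \<and> \<bar>bform a b c\<bar> \<le> C2 * (sobn s a * sobn 1 b * sobn (2 * r - 1) c)"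
    by (rule bform_bound[of s 1 "2 * r - 1"]) (use r s in auto)
  \<comment> \<open>For B(w,w) the test sequence is measured with the exponent 3r - 2, because (3r -
    2) + 2(1 - r) = r reduces its norm to that of w in \<open>sob r\<close>. Both requirements, 3r -
    2 at least 1/2 and the total 3r above 5/2, follow from r > 5/6.\<close>
  obtain C3 where C3: "C3 \<ge> 0"
    "\<And>a b c. solenoidal a \<Longrightarrow> a \<in> sob 1 \<Longrightarrow> b \<in> sob 1 \<Longrightarrow> c \<in> sob (3 * r - 2) \<Longrightarrow>
       bsummable a b c \<and> \<bar>bform a b c\<bar> \<le> C3 * (sobn 1 a * sobn 1 b * sobn (3 * r - 2) c)"
    by (rule bform_bound[of 1 1 "3 * r - 2"]) (use r s in auto)
  obtain c where c: "c \<ge> 1" "\<And>k. jw k powr r \<le> c * voigt_weight \<alpha> r k" "\<And>k. voigt_weight \<alpha> r k \<le> c * jw k powr r"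
    using voigt_weight_bounds[OF \<alpha>, of r] r by (metis less_trans zero_less_divide_iff zero_less_numeral)
  have cc: "(sqrt c)\<^sup>2 = c" using c by simp
  have va: "vflow r T a" using a by (simp add: voigt_flow_def)
  note a1 = flow_H1[OF r \<alpha> s order_refl T a La]
  define g where "g = (\<lambda>\<tau>. sobn s (a \<tau>))"
  have g0: "g \<tau> \<ge> 0" for \<tau> by (simp add: g_def)
  have g2: "set_integrable lborel {0..T} (\<lambda>\<tau>. (g \<tau>)\<^sup>2)" using La by (simp add: L2_flow_def g_def)
  have gi: "set_integrable lborel {0..T} g" by (rule set_integrable_of_square[OF g2 g0])
  \<comment> \<open>The factor \<open>c\<close> replaces the squared \<open>sob 1\<close> norm by
    \<open>E\<close>. The final 1 comes from Young's inequality in the viscous term.\<close>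
  define h where "h = (\<lambda>\<tau>. c * (2 * (C1 + C2)) * g \<tau> + c * (2 * C3 + 1))"
  have hi: "set_integrable lborel {0..T} h"
    unfolding h_def
    by (rule set_integral_add(1)[OF set_integrable_mult_right[OF gi] continuous_set_integrable[OF continuous_on_const]])
  have h0: "h \<tau> \<ge> 0" for \<tau> unfolding h_def using C1(1) C2(1) C3(1) c(1) g0[of \<tau>] by simp
  \<comment> \<open>The number of doublings in Gronwall is determined by the inviscid flow, so it is
    the same for all \<nu>.\<close>
  obtain n :: nat where "2 * integral {0..T} h \<le> real n"
    using real_arch_simple by blast
  then have n: "integral {0..T} h \<le> real n / 2" by simp
  define G2 where "G2 = integral {0..T} (\<lambda>\<tau>. (g \<tau>)\<^sup>2)"
  have G20: "G2 \<ge> 0"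
    unfolding G2_def by (intro Henstock_Kurzweil_Integration.integral_nonneg set_borel_integral_eq_integral(1)[OF g2]) auto
  define \<theta> where "\<theta> = (\<lambda>k. jw k powr (1 - r))"
  define \<gamma> where "\<gamma> = (\<lambda>k. \<theta> k * voigt_weight \<alpha> r k)"
  have \<theta>0: "\<theta> k \<ge> 0" and \<gamma>0: "\<gamma> k \<ge> 0" for k by (simp_all add: \<theta>_def \<gamma>_def)
  have \<theta>J: "\<theta> k * jw k powr r = jw k powr 1" for k unfolding \<theta>_def powr_add[symmetric] by simp
  have \<gamma>1: "\<gamma> k \<le> c * jw k powr 1" for k
    using mult_left_mono[OF c(3)[of k] \<theta>0[of k]] unfolding \<gamma>_def \<theta>J[symmetric] by (simp add: mult_ac)
  have \<gamma>2: "jw k powr 1 \<le> c * \<gamma> k" for k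
    using mult_left_mono[OF c(2)[of k] \<theta>0[of k]] unfolding \<gamma>_def \<theta>J[symmetric] by (simp add: mult_ac)
  \<comment> \<open>The factor \<open>c\<close> leads from \<open>E\<close> back to the
    \<open>sob 1\<close> norm, the power of 2 is from Gronwall, and \<open>c + G2\<close> covers the
    initial value and the viscous forcing.\<close>
  define K where "K = c * 2 ^ n * (c + G2)"
  have K0: "K \<ge> 0" using c G20 by (simp add: K_def)
  show thesis
  proof (rule that[OF K0])
    fix \<nu> b t
    assume \<nu>: "\<nu> > (0 :: real)" and b: "voigt_flow \<alpha> \<nu> r T b" and Lb: "L2_flow T s b"
      and small: "\<And>\<tau>. \<tau> \<in> {0..T} \<Longrightarrow> sobn r (\<lambda>k. a \<tau> k - b \<tau> k) \<le> 1" and t: "t \<in> {0..T}"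
    have vb: "vflow r T b" using b by (simp add: voigt_flow_def)
    note b1 = flow_H1[OF r \<alpha> s less_imp_le[OF \<nu>] T b Lb]
    define w where "w = (\<lambda>\<tau> k. a \<tau> k - b \<tau> k)"
    have vw: "vflow r T w" unfolding w_def by (rule vflow_diff[OF va vb])
    note A' = vflowD[OF va] and B' = vflowD[OF vb] and W' = vflowD[OF vw]
    have w1: "w \<tau> \<in> sob 1" if "\<tau> \<in> {0..T}" for \<tau>
      unfolding w_def using a1(1)[OF that] b1(1)[OF that] by (intro wnorm_diff) auto
    have w1c: "((\<lambda>\<tau>. sobn 1 (\<lambda>k. w \<tau> k - w t k)) \<longlongrightarrow> 0) (at t within {0..T})" if "t \<in> {0..T}" for t
      unfolding w_def using a1 b1 that by (intro tendsto_wnorm_diff) auto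
    define E where "E = (\<lambda>\<tau>. (wnorm \<gamma> (w \<tau>))\<^sup>2)"
    have Ec: "continuous_on {0..T} E"
      unfolding E_def
      by (intro continuous_intros wnorm_continuous_on_mono[where C="sqrt c" and \<nu>="\<lambda>k. jw k powr 1"] \<gamma>0 w1 w1c)
         (use \<gamma>1 cc c(1) in auto)
    have E0: "E \<tau> \<ge> 0" for \<tau> by (simp add: E_def)
    have w\<gamma>: "w \<tau> \<in> wsp \<gamma> \<and> E \<tau> \<le> c * (sobn 1 (w \<tau>))\<^sup>2 \<and> (sobn 1 (w \<tau>))\<^sup>2 \<le> c * E \<tau>" if "\<tau> \<in> {0..T}" for \<tau>
    proof -
      have "\<gamma> k * (norm (w \<tau> k))\<^sup>2 \<le> (sqrt c)\<^sup>2 * (jw k powr 1 * (norm (w \<tau> k))\<^sup>2)" for k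
        unfolding cc mult.assoc[symmetric] by (intro mult_right_mono \<gamma>1) auto
      note up = wnorm_mono[OF \<gamma>0 powr_ge_zero _ this w1[OF that]]
      have "jw k powr 1 * (norm (w \<tau> k))\<^sup>2 \<le> (sqrt c)\<^sup>2 * (\<gamma> k * (norm (w \<tau> k))\<^sup>2)" for k
        unfolding cc mult.assoc[symmetric] by (intro mult_right_mono \<gamma>2) auto
      note lo = wnorm_mono[OF powr_ge_zero \<gamma>0 _ this]
      have wg: "w \<tau> \<in> wsp \<gamma>" "wnorm \<gamma> (w \<tau>) \<le> sqrt c * sobn 1 (w \<tau>)" using up c(1) by auto
      have "sobn 1 (w \<tau>) \<le> sqrt c * wnorm \<gamma> (w \<tau>)" using lo(2)[OF _ wg(1)] c(1) by auto
      from power_mono[OF this wnorm_nonneg, of 2] power_mono[OF wg(2) wnorm_nonneg[OF \<gamma>0], of 2] wg(1)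
      show ?thesis unfolding E_def power_mult_distrib cc by simp
    qed
    have point: "(\<Sum>k\<in>F. 2 * \<theta> k * ((flux \<nu> (b \<tau>) k - flux 0 (a \<tau>) k) \<bullet> w \<tau> k)) \<le> h \<tau> * E \<tau> + \<nu>\<^sup>2 * (g \<tau>)\<^sup>2"
      if \<tau>: "\<tau> \<in> {0..T}" and as: "a \<tau> \<in> sob s" and F: "finite F" for F \<tau>
    proof -
      define z where "z = (\<lambda>k. \<theta> k *\<^sub>R w \<tau> k)"
      define Z where "Z = (\<lambda>k. if k \<in> F then z k else 0)"
      define W where "W = sobn 1 (w \<tau>)"
      have W0: "W \<ge> 0" by (simp add: W_def)
      note aa = A'[OF \<tau>] and bb = B'[OF \<tau>] and ww = W'[OF \<tau>]
      have z2: "jw k powr \<sigma> * (norm (z k))\<^sup>2 \<le> jw k powr \<rho> * (norm (w \<tau> k))\<^sup>2" if "\<rho> = \<sigma> + (1 - r) + (1 - r)" for k \<sigma> \<rho>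
      proof -
        have "jw k powr \<sigma> * (\<theta> k)\<^sup>2 = jw k powr \<rho>"
          unfolding \<theta>_def power2_eq_square that powr_add by simp
        then show ?thesis by (simp add: z_def power_mult_distrib flip: mult.assoc)
      qed
      have Zr: "Z \<in> sob r" unfolding Z_def by (rule wnorm_finite_sum[OF F]) auto
      have Z1: "Z \<in> sob (2 * r - 1)" "sobn (2 * r - 1) Z \<le> W"
        unfolding Z_def W_def by (intro sob_restrict[OF w1[OF \<tau>]] z2; simp)+
      have Z2: "Z \<in> sob (3 * r - 2)" "sobn (3 * r - 2) Z \<le> sobn r (w \<tau>)"
        unfolding Z_def by (intro sob_restrict[OF ww(1)] z2; simp)+
      have Z3: "sobn (3 * r - 2) Z \<le> 1" using Z2(2) small[OF \<tau>] by (simp add: w_def)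
      note bs = bsummable_sob[OF r(1)]
      have "bform (w \<tau>) (a \<tau>) Z = bform (a \<tau>) (a \<tau>) Z - bform (b \<tau>) (a \<tau>) Z"
        unfolding w_def by (intro bform_diff1 bs aa bb Zr)
      moreover have "bform (b \<tau>) (w \<tau>) Z = bform (b \<tau>) (a \<tau>) Z - bform (b \<tau>) (b \<tau>) Z"
        unfolding w_def by (intro bform_diff2 bs aa bb Zr)
      moreover have "bform (w \<tau>) (w \<tau>) Z = bform (a \<tau>) (w \<tau>) Z - bform (b \<tau>) (w \<tau>) Z"
      proof -
        have "bform (\<lambda>k. a \<tau> k - b \<tau> k) (w \<tau>) Z = bform (a \<tau>) (w \<tau>) Z - bform (b \<tau>) (w \<tau>) Z"
          by (intro bform_diff1 bs aa bb ww Zr)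
        then show ?thesis by (simp add: w_def)
      qed
      \<comment> \<open>An expansion around a with b = a - w, so that no norm of b enters. As Z
        carries weights, antisymmetry does not cancel B(a,w); that term is paid for with the
        \<open>sob s\<close> norm of a.\<close>
      ultimately have e: "bform (b \<tau>) (b \<tau>) Z - bform (a \<tau>) (a \<tau>) Z
        = bform (w \<tau>) (w \<tau>) Z - bform (w \<tau>) (a \<tau>) Z - bform (a \<tau>) (w \<tau>) Z" by linarith
      have "\<bar>bform (w \<tau>) (a \<tau>) Z\<bar> \<le> C1 * (W * g \<tau> * sobn (2 * r - 1) Z)"
        unfolding W_def g_def using C1(2) ww w1[OF \<tau>] as Z1 by blast
      also have "\<dots> \<le> C1 * (W * g \<tau> * W)" using C1(1) W0 g0 Z1(2) by (intro mult_left_mono) auto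
      finally have 1: "\<bar>bform (w \<tau>) (a \<tau>) Z\<bar> \<le> C1 * g \<tau> * W\<^sup>2" by (simp add: power2_eq_square mult_ac)
      have "\<bar>bform (a \<tau>) (w \<tau>) Z\<bar> \<le> C2 * (g \<tau> * W * sobn (2 * r - 1) Z)"
        unfolding W_def g_def using C2(2) aa w1[OF \<tau>] as Z1 by blast
      also have "\<dots> \<le> C2 * (g \<tau> * W * W)" using C2(1) W0 g0 Z1(2) by (intro mult_left_mono) auto
      finally have 2: "\<bar>bform (a \<tau>) (w \<tau>) Z\<bar> \<le> C2 * g \<tau> * W\<^sup>2" by (simp add: power2_eq_square mult_ac)
      have "\<bar>bform (w \<tau>) (w \<tau>) Z\<bar> \<le> C3 * (W * W * sobn (3 * r - 2) Z)"
        unfolding W_def using C3(2) ww w1[OF \<tau>] Z2 by blast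
      also have "\<dots> \<le> C3 * (W * W * 1)" using C3(1) W0 Z3 by (intro mult_left_mono) auto
      finally have 3: "\<bar>bform (w \<tau>) (w \<tau>) Z\<bar> \<le> C3 * W\<^sup>2" by (simp add: power2_eq_square mult_ac)
      have "(\<Sum>k\<in>F. stokes_eigenvalue k * (b \<tau> k \<bullet> z k)) \<le> (\<Sum>k\<in>F. jw k powr (2 - r) * (norm (a \<tau> k) * norm (w \<tau> k)))"
      proof (rule sum_mono)
        fix k
        have "b \<tau> k \<bullet> w \<tau> k = a \<tau> k \<bullet> w \<tau> k - (norm (w \<tau> k))\<^sup>2"
          by (simp add: w_def power2_norm_eq_inner inner_diff_left)
        also have "\<dots> \<le> norm (a \<tau> k) * norm (w \<tau> k)"
          using norm_cauchy_schwarz[of "a \<tau> k" "w \<tau> k"] zero_le_power2[of "norm (w \<tau> k)"] by linarith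
        finally have "stokes_eigenvalue k * \<theta> k * (b \<tau> k \<bullet> w \<tau> k) \<le> stokes_eigenvalue k * \<theta> k * (norm (a \<tau> k) * norm (w \<tau> k))"
          using \<theta>0[of k] by (intro mult_left_mono) auto
        also have "\<dots> \<le> (jw k powr 1 * \<theta> k) * (norm (a \<tau> k) * norm (w \<tau> k))"
          using \<theta>0[of k] stokes_le_jw[of k] by (intro mult_right_mono) auto
        also have "jw k powr 1 * \<theta> k = jw k powr (2 - r)" unfolding \<theta>_def powr_add[symmetric] by simp
        finally show "stokes_eigenvalue k * (b \<tau> k \<bullet> z k) \<le> jw k powr (2 - r) * (norm (a \<tau> k) * norm (w \<tau> k))"
          by (simp add: z_def mult.assoc)
      qed
      also have "\<dots> \<le> g \<tau> * W"
        unfolding g_def W_def using r s by (intro sum_weights_inner_le F as w1[OF \<tau>]) auto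
      finally have "\<nu> * (2 * (\<Sum>k\<in>F. stokes_eigenvalue k * (b \<tau> k \<bullet> z k))) \<le> \<nu> * (2 * (g \<tau> * W))"
        using \<nu> by (intro mult_left_mono) auto
      \<comment> \<open>Young's inequality separates a forcing of size \<nu>^2 from a multiple of
        W^2 that Gronwall can take.\<close>
      also have "\<dots> \<le> (\<nu> * g \<tau>)\<^sup>2 + W\<^sup>2" using sum_squares_bound[of "\<nu> * g \<tau>" W] by (simp add: mult_ac)
      finally have 4: "\<nu> * (2 * (\<Sum>k\<in>F. stokes_eigenvalue k * (b \<tau> k \<bullet> z k))) \<le> \<nu>\<^sup>2 * (g \<tau>)\<^sup>2 + W\<^sup>2"
        by (simp add: power_mult_distrib)
      have "(\<Sum>k\<in>F. 2 * \<theta> k * ((flux \<nu> (b \<tau>) k - flux 0 (a \<tau>) k) \<bullet> w \<tau> k))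
        = 2 * ((\<Sum>k\<in>F. flux \<nu> (b \<tau>) k \<bullet> z k) - (\<Sum>k\<in>F. flux 0 (a \<tau>) k \<bullet> z k))"
        by (simp add: z_def inner_diff_left sum_subtractf sum_distrib_left right_diff_distrib mult.assoc)
      also have "\<dots> = 2 * (bform (b \<tau>) (b \<tau>) Z - bform (a \<tau>) (a \<tau>) Z) + \<nu> * (2 * (\<Sum>k\<in>F. stokes_eigenvalue k * (b \<tau> k \<bullet> z k)))"
        unfolding sum_flux_inner[OF r(1) aa(2,1) F] sum_flux_inner[OF r(1) bb(2,1) F] Z_def by simp
      also have "\<dots> \<le> 2 * (C3 * W\<^sup>2 + C1 * g \<tau> * W\<^sup>2 + C2 * g \<tau> * W\<^sup>2) + (\<nu>\<^sup>2 * (g \<tau>)\<^sup>2 + W\<^sup>2)"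
      proof (rule add_mono[OF mult_left_mono 4])
        show "bform (b \<tau>) (b \<tau>) Z - bform (a \<tau>) (a \<tau>) Z \<le> C3 * W\<^sup>2 + C1 * g \<tau> * W\<^sup>2 + C2 * g \<tau> * W\<^sup>2"
          unfolding e using abs_le_D2[OF 1] abs_le_D2[OF 2] abs_le_D1[OF 3] by linarith
      qed simp
      also have "\<dots> = (2 * (C1 + C2) * g \<tau> + (2 * C3 + 1)) * W\<^sup>2 + \<nu>\<^sup>2 * (g \<tau>)\<^sup>2"
        by (simp add: algebra_simps)
      also have "\<dots> \<le> (2 * (C1 + C2) * g \<tau> + (2 * C3 + 1)) * (c * E \<tau>) + \<nu>\<^sup>2 * (g \<tau>)\<^sup>2"
        unfolding W_def using w\<gamma>[OF \<tau>] C1(1) C2(1) C3(1) g0[of \<tau>] by (intro add_mono mult_left_mono) auto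
      also have "\<dots> = h \<tau> * E \<tau> + \<nu>\<^sup>2 * (g \<tau>)\<^sup>2" unfolding h_def by (simp add: algebra_simps)
      finally show ?thesis .
    qed
    define M where "M = E 0 + \<nu>\<^sup>2 * G2"
    have M0: "M \<ge> 0" using E0[of 0] G20 by (simp add: M_def)
    \<comment> \<open>The pointwise bound has no truncation error and is the same for all finite F,
      so the supremum over F suffices and no limit of integrals is taken. It holds where a lies in
      \<open>sob s\<close>, that is at almost every time.\<close>
    have est: "E t \<le> M + integral {0..t} (\<lambda>\<tau>. h \<tau> * E \<tau>)" if t: "t \<in> {0..T}" for t
    proof -
      have sub: "{0..t} \<subseteq> {0..T}" using t by auto
      have hE: "set_integrable lborel {0..t} (\<lambda>\<tau>. h \<tau> * E \<tau>)"
        by (rule set_integrable_subset[OF set_integrable_times_continuous[OF hi Ec]]) (use sub in auto)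
      have g2t: "set_integrable lborel {0..t} (\<lambda>\<tau>. (g \<tau>)\<^sup>2)"
        by (rule set_integrable_subset[OF g2]) (use sub in auto)
      have "sum (\<lambda>k. \<gamma> k * (norm (w t k))\<^sup>2) F \<le> M + integral {0..t} (\<lambda>\<tau>. h \<tau> * E \<tau>)" if F: "finite F" for F
      proof -
        have "(\<Sum>k\<in>F. \<theta> k * voigt_weight \<alpha> r k * (norm (w t k))\<^sup>2) = (\<Sum>k\<in>F. \<theta> k * voigt_weight \<alpha> r k * (norm (w 0 k))\<^sup>2)
          + integral {0..t} (\<lambda>\<tau>. \<Sum>k\<in>F. 2 * \<theta> k * ((flux \<nu> (b \<tau>) k - flux 0 (a \<tau>) k) \<bullet> w \<tau> k))"
          unfolding w_def by (rule flow_energy_identity[OF r(1) a b t F])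
        also have "(\<Sum>k\<in>F. \<theta> k * voigt_weight \<alpha> r k * (norm (w 0 k))\<^sup>2) \<le> E 0"
          unfolding E_def \<gamma>_def[symmetric] using wnorm_finite_le[OF \<gamma>0 _ F, of "w 0"] w\<gamma>[of 0] T
          by (simp add: \<gamma>_def)
        also have "integral {0..t} (\<lambda>\<tau>. \<Sum>k\<in>F. 2 * \<theta> k * ((flux \<nu> (b \<tau>) k - flux 0 (a \<tau>) k) \<bullet> w \<tau> k))
          \<le> integral {0..t} (\<lambda>\<tau>. h \<tau> * E \<tau> + \<nu>\<^sup>2 * (g \<tau>)\<^sup>2)"
        proof (rule integral_le_AE)
          show "set_integrable lborel {0..t} (\<lambda>\<tau>. \<Sum>k\<in>F. 2 * \<theta> k * ((flux \<nu> (b \<tau>) k - flux 0 (a \<tau>) k) \<bullet> w \<tau> k))"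
            by (intro continuous_set_integrable continuous_intros
             continuous_on_subset[OF flux_continuous[OF r(1) va] sub] continuous_on_subset[OF flux_continuous[OF r(1) vb] sub]
             continuous_on_subset[OF vflow_continuous[OF vw] sub])
          show "set_integrable lborel {0..t} (\<lambda>\<tau>. h \<tau> * E \<tau> + \<nu>\<^sup>2 * (g \<tau>)\<^sup>2)"
            by (rule set_integral_add(1)[OF hE set_integrable_mult_right[OF g2t]])
          have "AE \<tau> in lborel. \<tau> \<in> {0..T} \<longrightarrow> a \<tau> \<in> sob s" using La by (simp add: L2_flow_def)
          then show "AE \<tau> in lborel. \<tau> \<in> {0..t} \<longrightarrow>
            (\<Sum>k\<in>F. 2 * \<theta> k * ((flux \<nu> (b \<tau>) k - flux 0 (a \<tau>) k) \<bullet> w \<tau> k)) \<le> h \<tau> * E \<tau> + \<nu>\<^sup>2 * (g \<tau>)\<^sup>2"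
            by eventually_elim (use sub point[OF _ _ F] in blast)
        qed
        also have "\<dots> = integral {0..t} (\<lambda>\<tau>. h \<tau> * E \<tau>) + integral {0..t} (\<lambda>\<tau>. \<nu>\<^sup>2 * (g \<tau>)\<^sup>2)"
          by (intro Henstock_Kurzweil_Integration.integral_add integrable_on_mult_right
             set_borel_integral_eq_integral(1)[OF hE] set_borel_integral_eq_integral(1)[OF g2t])
        also have "integral {0..t} (\<lambda>\<tau>. \<nu>\<^sup>2 * (g \<tau>)\<^sup>2) = \<nu>\<^sup>2 * integral {0..t} (\<lambda>\<tau>. (g \<tau>)\<^sup>2)"
          by (rule integral_mult_right)
        also have "\<dots> \<le> \<nu>\<^sup>2 * G2"
          unfolding G2_def using sub set_borel_integral_eq_integral(1)[OF g2t] set_borel_integral_eq_integral(1)[OF g2]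
          by (intro mult_left_mono integral_subset_le) auto
        finally show ?thesis by (simp add: M_def \<gamma>_def)
      qed
      then show ?thesis
        unfolding E_def wnorm_sq[of \<gamma> "w t", OF \<gamma>0] using w\<gamma>[OF t]
        by (intro infsum_le_finite_sums) (auto simp: wsp_def)
    qed
    have "E t \<le> 2 ^ n * M"
      by (rule gronwall_integrable[OF Ec E0 hi h0 M0 est n t])
    moreover have "M \<le> (c + G2) * ((sobn 1 (w 0))\<^sup>2 + \<nu>\<^sup>2)"
    proof -
      have "E 0 \<le> c * (sobn 1 (w 0))\<^sup>2" using w\<gamma>[of 0] T by auto
      moreover have "0 \<le> G2 * (sobn 1 (w 0))\<^sup>2" "0 \<le> c * \<nu>\<^sup>2" using G20 c(1) by auto
      ultimately show ?thesis unfolding M_def by (simp add: algebra_simps)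
    qed
    ultimately have "E t \<le> 2 ^ n * ((c + G2) * ((sobn 1 (w 0))\<^sup>2 + \<nu>\<^sup>2))"
      by (meson mult_left_mono order_trans zero_le_numeral zero_le_power)
    then have "c * E t \<le> c * (2 ^ n * ((c + G2) * ((sobn 1 (w 0))\<^sup>2 + \<nu>\<^sup>2)))"
      using c(1) by (intro mult_left_mono) auto
    then have "(sobn 1 (w t))\<^sup>2 \<le> K * ((sobn 1 (w 0))\<^sup>2 + \<nu>\<^sup>2)"
      using w\<gamma>[OF t] unfolding K_def by (simp add: mult_ac)
    then show "(sobn 1 (\<lambda>k. a t k - b t k))\<^sup>2 \<le> K * ((sobn 1 (\<lambda>k. a 0 k - b 0 k))\<^sup>2 + \<nu>\<^sup>2)"
      unfolding w_def .
  qed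
qed

section \<open>The inviscid limit\<close>

text \<open>The initial conditions hold almost everywhere only; this carries them over to the
  coefficients at time 0.\<close>

lemma fourier_cong_AE:
  assumes "AE x in lborel. f x = g x" "L2_field f" "L2_field g"
  shows "fourier f = fourier g"
proof -
  have "cip (coord f j) (em k) = cip (coord g j) (em k)" for j k
    unfolding cip_def
  proof (rule integral_cong_AE)
    show "(\<lambda>x. coord f j x * cnj (em k x)) \<in> borel_measurable cubeM"
      "(\<lambda>x. coord g j x * cnj (em k x)) \<in> borel_measurable cubeM"
      by (intro borel_measurable_integrable sq_integrable_mult sq_integrable_em L2_field_comp assms)+
    show "AE x in cubeM. coord f j x * cnj (em k x) = coord g j x * cnj (em k x)"
      unfolding AE_cubeM_iff using assms(1) by eventually_elim simp
  qed
  then show ?thesis by (simp add: fun_eq_iff vec_eq_iff fourier_nth)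
qed

lemma voigt_energy_eq:
  assumes "L2_field f" "fourier f \<in> sob r" "r > 0"
  shows "voigt_energy \<alpha> r f = (wnorm (voigt_weight \<alpha> r) (fourier f))\<^sup>2"
proof -
  have s: "(\<lambda>k. stokes_eigenvalue k powr r * (norm (fourier f k))\<^sup>2) summable_on UNIV"
  proof (rule summable_on_comparison_test)
    show "(\<lambda>k. jw k powr r * (norm (fourier f k))\<^sup>2) summable_on UNIV" using assms(2) by (simp add: wsp_def)
    show "stokes_eigenvalue k powr r * (norm (fourier f k))\<^sup>2 \<le> jw k powr r * (norm (fourier f k))\<^sup>2" for k
      using assms(3) stokes_le_jw[of k] by (intro mult_right_mono powr_mono2) auto
  qed auto
  have "(stokes_norm (r / 2) f)\<^sup>2 = (\<Sum>\<^sub>\<infinity>k. stokes_eigenvalue k powr r * (norm (fourier f k))\<^sup>2)"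
    unfolding stokes_norm_def by (simp add: infsum_nonneg)
  then have "((\<lambda>k. stokes_eigenvalue k powr r * (norm (fourier f k))\<^sup>2) has_sum (stokes_norm (r / 2) f)\<^sup>2) UNIV"
    using s by simp
  from has_sum_add[OF L2_norm_has_sum[OF assms(1)] has_sum_cmult_right[OF this, of "\<alpha> powr (2 * r)"]]
  have "((\<lambda>k. voigt_weight \<alpha> r k * (norm (fourier f k))\<^sup>2) has_sum voigt_energy \<alpha> r f) UNIV"
    by (simp add: voigt_energy_def voigt_weight_def ring_distribs mult_ac)
  then show ?thesis by (simp add: wnorm_sq has_sum_iff)
qed

lemma stokes_norm_half: "(stokes_norm (1/2) f)\<^sup>2 = (wnorm stokes_eigenvalue (fourier f))\<^sup>2"
  unfolding stokes_norm_def wnorm_def by (simp add: infsum_nonneg)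

lemma L2_flow_fourier:
  assumes "L2_time T s u"
  shows "L2_flow T s (\<lambda>t. fourier (u t))"
proof -
  have "AE t in lborel. t \<in> {0..T} \<longrightarrow> u t \<in> Hs s" using assms by (simp add: L2_time_def)
  then have "AE t in lborel. t \<in> {0..T} \<longrightarrow> fourier (u t) \<in> sob s"
    by eventually_elim (simp add: Hs_iff)
  then show ?thesis using assms by (simp add: L2_flow_def L2_time_def Hs_norm_eq)
qed

lemma C_timeI:
  assumes "\<And>t. t \<in> {0..T'} \<Longrightarrow> L2_field (u t)" "\<And>t. t \<in> {0..T'} \<Longrightarrow> fourier (u t) \<in> sob \<sigma>"
    "\<And>t. t \<in> {0..T'} \<Longrightarrow> ((\<lambda>\<tau>. sobn \<sigma> (\<lambda>k. fourier (u \<tau>) k - fourier (u t) k)) \<longlongrightarrow> 0) (at t within {0..T'})"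
    and T: "T \<le> T'"
  shows "C_time T \<sigma> (Hs \<sigma>) u"
  unfolding C_time_def
proof (intro conjI ballI)
  fix t assume "t \<in> {0..T}"
  then have t: "t \<in> {0..T'}" using T by auto
  show "u t \<in> Hs \<sigma>" using assms(1,2) t by (simp add: Hs_iff)
  have "((\<lambda>\<tau>. sobn \<sigma> (\<lambda>k. fourier (u \<tau>) k - fourier (u t) k)) \<longlongrightarrow> 0) (at t within {0..T})"
    by (rule tendsto_within_subset[OF assms(3)[OF t]]) (use T in auto)
  moreover have "\<forall>\<^sub>F \<tau> in at t within {0..T}. sobn \<sigma> (\<lambda>k. fourier (u \<tau>) k - fourier (u t) k) = Hs_norm \<sigma> (u \<tau> - u t)"
    using fourier_diff_fun[OF assms(1) assms(1)[OF t]] T by (auto simp: eventually_at_filter Hs_norm_eq)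
  ultimately show "((\<lambda>\<tau>. Hs_norm \<sigma> (u \<tau> - u t)) \<longlongrightarrow> 0) (at t within {0..T})"
    by (rule Lim_transform_eventually)
qed

theorem theorem5p9:
  fixes r \<alpha> s Tstar T :: real
    and u0 :: field and u :: "real \<Rightarrow> field"
    and u0\<^sub>\<nu> :: "real \<Rightarrow> field" and u\<^sub>\<nu> :: "real \<Rightarrow> real \<Rightarrow> field"
  assumes "5/6 < r" and "r \<le> 1" and "\<alpha> > 0" and "s > 3/2" and "Tstar > 0"
    and "u0 \<in> V r"
    and "\<And>\<nu>. \<nu> > 0 \<Longrightarrow> u0\<^sub>\<nu> \<nu> \<in> V r"
    and "C_time Tstar r (V r) u" and "L2_time Tstar s u"
    and "euler_voigt_solution \<alpha> r Tstar u0 u"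
    and "\<And>\<nu>. \<nu> > 0 \<Longrightarrow> C_time Tstar r (V r) (u\<^sub>\<nu> \<nu>)"
    and "\<And>\<nu>. \<nu> > 0 \<Longrightarrow> L2_time Tstar s (u\<^sub>\<nu> \<nu>)"
    and "\<And>\<nu>. \<nu> > 0 \<Longrightarrow> navier_stokes_voigt_solution \<alpha> r \<nu> Tstar (u0\<^sub>\<nu> \<nu>) (u\<^sub>\<nu> \<nu>)"
    and "0 < T" and "T \<le> Tstar"
  shows "(\<exists>C>0. \<forall>\<nu>>0. \<forall>t\<in>{0..Tstar}.
            voigt_energy \<alpha> r (u t - u\<^sub>\<nu> \<nu> t)
              \<le> voigt_energy \<alpha> r (u0 - u0\<^sub>\<nu> \<nu>) * exp (C / T * t)
                + \<nu> * (LINT \<tau>:{0..t}|lborel. (stokes_norm (1/2) (u \<tau>))\<^sup>2) * exp (C / T * t))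
         \<and> (((\<lambda>\<nu>. voigt_energy \<alpha> r (u0 - u0\<^sub>\<nu> \<nu>)) \<longlongrightarrow> 0) (at_right 0) \<longrightarrow>
              converges_in_C T r u\<^sub>\<nu> u
              \<and> ((\<forall>\<nu>>0. u0 - u0\<^sub>\<nu> \<nu> \<in> Hs 1)
                  \<and> ((\<lambda>\<nu>. Hs_norm 1 (u0 - u0\<^sub>\<nu> \<nu>)) \<longlongrightarrow> 0) (at_right 0)
                  \<longrightarrow> converges_in_C T 1 u\<^sub>\<nu> u))"
proof -
  note r = assms(1,2) and \<alpha> = assms(3) and s = assms(4) and Ts = assms(5)
  have r0: "r > 0" using r by simp
  let ?\<mu> = "voigt_weight \<alpha> r"
  define a where "a = (\<lambda>t. fourier (u t))"
  define b where "b = (\<lambda>\<nu> t. fourier (u\<^sub>\<nu> \<nu> t))"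
  have uV: "u t \<in> V r" if "t \<in> {0..Tstar}" for t using assms(8) that by (auto simp: C_time_def)
  have vV: "u\<^sub>\<nu> \<nu> t \<in> V r" if "\<nu> > 0" "t \<in> {0..Tstar}" for \<nu> t using assms(11)[OF that(1)] that(2) by (auto simp: C_time_def)
  have T0: "0 \<in> {0..Tstar}" using Ts by simp
  have a: "voigt_flow \<alpha> 0 r Tstar a"
    unfolding a_def
    by (rule voigt_flow_fourier[OF r \<alpha> assms(8)]) (use assms(10) in \<open>auto simp: euler_voigt_solution_def\<close>)
  have b: "voigt_flow \<alpha> \<nu> r Tstar (b \<nu>)" if "\<nu> > 0" for \<nu>
    unfolding b_def
    by (rule voigt_flow_fourier[OF r \<alpha> assms(11)[OF that]])
       (use assms(13)[OF that] in \<open>auto simp: navier_stokes_voigt_solution_def\<close>)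
  have La: "L2_flow Tstar s a" unfolding a_def by (rule L2_flow_fourier[OF assms(9)])
  have Lb: "L2_flow Tstar s (b \<nu>)" if "\<nu> > 0" for \<nu> unfolding b_def by (rule L2_flow_fourier[OF assms(12)[OF that]])
  have va: "vflow r Tstar a" using a by (simp add: voigt_flow_def)
  have vb: "vflow r Tstar (b \<nu>)" if "\<nu> > 0" for \<nu> using b[OF that] by (simp add: voigt_flow_def)
  note a1 = flow_H1[OF r \<alpha> s order_refl Ts a La]
  have diff: "L2_field (f - g)" "fourier (f - g) = (\<lambda>k. fourier f k - fourier g k)" "fourier (f - g) \<in> sob r"
    if "f \<in> V r" "g \<in> V r" for f g
  proof -
    show "L2_field (f - g)" by (intro L2_field_diff V_basic[OF that(1)] V_basic[OF that(2)])
    show e: "fourier (f - g) = (\<lambda>k. fourier f k - fourier g k)"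
      by (intro fourier_diff_fun V_basic[OF that(1)] V_basic[OF that(2)])
    show "fourier (f - g) \<in> sob r"
      unfolding e by (intro wnorm_diff V_basic[OF that(1)] V_basic[OF that(2)]) auto
  qed
  have energy: "voigt_energy \<alpha> r (f - g) = (wnorm ?\<mu> (\<lambda>k. fourier f k - fourier g k))\<^sup>2"
    if "f \<in> V r" "g \<in> V r" for f g
    using voigt_energy_eq[OF diff(1)[OF that] diff(3)[OF that] r0] diff(2)[OF that] by simp
  have init: "fourier u0 = a 0" "\<nu> > 0 \<Longrightarrow> fourier (u0\<^sub>\<nu> \<nu>) = b \<nu> 0" for \<nu>
  proof -
    show "fourier u0 = a 0"
      unfolding a_def using assms(10) V_basic(1)[OF assms(6)] V_basic(1)[OF uV[OF T0]]
      by (intro fourier_cong_AE[symmetric]) (auto simp: euler_voigt_solution_def)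
    show "fourier (u0\<^sub>\<nu> \<nu>) = b \<nu> 0" if "\<nu> > 0"
      unfolding b_def using assms(13)[OF that] V_basic(1)[OF assms(7)[OF that]] V_basic(1)[OF vV[OF that T0]]
      by (intro fourier_cong_AE[symmetric]) (auto simp: navier_stokes_voigt_solution_def)
  qed
  define S where "S = (\<lambda>\<tau>. (wnorm stokes_eigenvalue (a \<tau>))\<^sup>2)"
  have Sc: "continuous_on {0..Tstar} S"
    unfolding S_def
    by (intro continuous_intros wnorm_continuous_on_mono[where C=1 and \<nu>="\<lambda>k. jw k powr 1"])
       (use a1 stokes_le_jw in auto)
  \<comment> \<open>The H^1 regularity makes \<open>S\<close> continuous, so the Lebesgue integral
    of the statement is the gauge integral of the estimates.\<close>
  have SI: "(LINT \<tau>:{0..t}|lborel. (stokes_norm (1/2) (u \<tau>))\<^sup>2) = integral {0..t} S" if "t \<in> {0..Tstar}" for t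
  proof -
    have "set_integrable lborel {0..t} S"
      by (rule continuous_set_integrable[OF continuous_on_subset[OF Sc]]) (use that in auto)
    then show ?thesis unfolding stokes_norm_half S_def a_def by (rule set_borel_integral_eq_integral(2))
  qed
  obtain K where K: "K > 0"
    "\<And>\<nu> b t. \<nu> > 0 \<Longrightarrow> voigt_flow \<alpha> \<nu> r Tstar b \<Longrightarrow> t \<in> {0..Tstar} \<Longrightarrow>
      (wnorm ?\<mu> (\<lambda>k. a t k - b t k))\<^sup>2 \<le> ((wnorm ?\<mu> (\<lambda>k. a 0 k - b 0 k))\<^sup>2 + \<nu> * integral {0..t} S) * exp (K * t)"
    using flow_energy_estimate[OF r \<alpha> a Ts a1] unfolding S_def by blast
  have est: "(wnorm ?\<mu> (\<lambda>k. a t k - b \<nu> t k))\<^sup>2 \<le> (voigt_energy \<alpha> r (u0 - u0\<^sub>\<nu> \<nu>) + \<nu> * integral {0..t} S) * exp (K * t)"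
    if "\<nu> > 0" "t \<in> {0..Tstar}" for \<nu> t
    using K(2)[OF that(1) b[OF that(1)] that(2)] energy[OF assms(6) assms(7)[OF that(1)]] init(1) init(2)[OF that(1)] by simp
  have part1: "\<exists>C>0. \<forall>\<nu>>0. \<forall>t\<in>{0..Tstar}.
            voigt_energy \<alpha> r (u t - u\<^sub>\<nu> \<nu> t)
              \<le> voigt_energy \<alpha> r (u0 - u0\<^sub>\<nu> \<nu>) * exp (C / T * t)
                + \<nu> * (LINT \<tau>:{0..t}|lborel. (stokes_norm (1/2) (u \<tau>))\<^sup>2) * exp (C / T * t)"
  \<comment> \<open>The rate \<open>K\<close> depends on \<open>Tstar\<close> and not on
    \<open>T\<close>; writing it as C / T gives this C.\<close>
  proof (intro exI[of _ "K * T"] conjI allI impI ballI)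
    show "K * T > 0" using K(1) assms(14) by simp
    fix \<nu> t assume *: "(\<nu> :: real) > 0" "t \<in> {0..Tstar}"
    have "K * T / T = K" using assms(14) by simp
    then show "voigt_energy \<alpha> r (u t - u\<^sub>\<nu> \<nu> t)
              \<le> voigt_energy \<alpha> r (u0 - u0\<^sub>\<nu> \<nu>) * exp (K * T / T * t)
                + \<nu> * (LINT \<tau>:{0..t}|lborel. (stokes_norm (1/2) (u \<tau>))\<^sup>2) * exp (K * T / T * t)"
      using est[OF *] energy[OF uV[OF *(2)] vV[OF *]] SI[OF *(2)] by (simp add: a_def b_def ring_distribs)
  qed
  have part2: "converges_in_C T r u\<^sub>\<nu> u \<and> ((\<forall>\<nu>>0. u0 - u0\<^sub>\<nu> \<nu> \<in> Hs 1)
      \<and> ((\<lambda>\<nu>. Hs_norm 1 (u0 - u0\<^sub>\<nu> \<nu>)) \<longlongrightarrow> 0) (at_right 0) \<longrightarrow> converges_in_C T 1 u\<^sub>\<nu> u)"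
    if lim: "((\<lambda>\<nu>. voigt_energy \<alpha> r (u0 - u0\<^sub>\<nu> \<nu>)) \<longlongrightarrow> 0) (at_right 0)"
  proof -
    obtain c where c: "c \<ge> 1" "\<And>k. jw k powr r \<le> c * ?\<mu> k" "\<And>k. ?\<mu> k \<le> c * jw k powr r"
      using voigt_weight_bounds[OF \<alpha> r0 r(2)] by blast
    have cc: "(sqrt c)\<^sup>2 = c" using c by simp
    \<comment> \<open>A bound for the distance in H^r that is uniform in time: the right-hand side
      of the energy estimate increases with t and is taken at \<open>Tstar\<close>.\<close>
    define D where "D = (\<lambda>\<nu>. sqrt c * sqrt ((voigt_energy \<alpha> r (u0 - u0\<^sub>\<nu> \<nu>) + \<nu> * integral {0..Tstar} S) * exp (K * Tstar)))"
    have D: "(D \<longlongrightarrow> 0) (at_right 0)"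
    proof -
      have "(D \<longlongrightarrow> sqrt c * sqrt ((0 + 0 * integral {0..Tstar} S) * exp (K * Tstar))) (at_right 0)"
        unfolding D_def by (intro tendsto_intros lim)
      then show ?thesis by simp
    qed
    have S0: "S \<tau> \<ge> 0" for \<tau> by (simp add: S_def)
    have diff_le: "sobn r (\<lambda>k. a t k - b \<nu> t k) \<le> D \<nu>" if *: "\<nu> > 0" "t \<in> {0..Tstar}" for \<nu> t
    proof -
      let ?w = "\<lambda>k. a t k - b \<nu> t k"
      have w: "?w \<in> sob r" using vflowD(1)[OF va *(2)] vflowD(1)[OF vb[OF *(1)] *(2)] by (intro wnorm_diff) auto
      have "?\<mu> k * (norm (?w k))\<^sup>2 \<le> (sqrt c)\<^sup>2 * (jw k powr r * (norm (?w k))\<^sup>2)" for k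
        unfolding cc mult.assoc[symmetric] by (intro mult_right_mono c) auto
      note up = wnorm_mono(1)[OF _ _ _ this w]
      have "jw k powr r * (norm (?w k))\<^sup>2 \<le> (sqrt c)\<^sup>2 * (?\<mu> k * (norm (?w k))\<^sup>2)" for k
        unfolding cc mult.assoc[symmetric] by (intro mult_right_mono c) auto
      from wnorm_mono(2)[OF _ _ _ this up] have "sobn r ?w \<le> sqrt c * wnorm ?\<mu> ?w" using c(1) by simp
      also have "wnorm ?\<mu> ?w \<le> sqrt ((voigt_energy \<alpha> r (u0 - u0\<^sub>\<nu> \<nu>) + \<nu> * integral {0..t} S) * exp (K * t))"
        by (rule real_le_rsqrt[OF est[OF *]])
      also have "\<dots> \<le> sqrt ((voigt_energy \<alpha> r (u0 - u0\<^sub>\<nu> \<nu>) + \<nu> * integral {0..Tstar} S) * exp (K * Tstar))"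
      proof -
        have sub: "{0..t} \<subseteq> {0..Tstar}" using * by auto
        have i: "S integrable_on {0..t}" "S integrable_on {0..Tstar}"
          by (intro integrable_continuous_interval continuous_on_subset[OF Sc] sub order_refl)+
        have "integral {0..t} S \<le> integral {0..Tstar} S" using sub i S0 by (intro integral_subset_le) auto
        moreover have "0 \<le> integral {0..Tstar} S" by (rule Henstock_Kurzweil_Integration.integral_nonneg[OF i(2) S0])
        moreover have "0 \<le> voigt_energy \<alpha> r (u0 - u0\<^sub>\<nu> \<nu>)" by (simp add: voigt_energy_def)
        ultimately show ?thesis
          using * K(1) by (intro real_sqrt_le_mono mult_mono add_mono mult_left_mono) auto
      qed
      finally show ?thesis unfolding D_def using c(1) by (simp add: mult_left_mono)
    qed
    have L2u: "L2_field (u t)" if "t \<in> {0..Tstar}" for t by (rule V_basic(1)[OF uV[OF that]])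
    have L2v: "L2_field (u\<^sub>\<nu> \<nu> t)" if "\<nu> > 0" "t \<in> {0..Tstar}" for t \<nu> by (rule V_basic(1)[OF vV[OF that]])
    have Hs_diff: "Hs_norm \<sigma> (u\<^sub>\<nu> \<nu> t - u t) = sobn \<sigma> (\<lambda>k. a t k - b \<nu> t k)" if "\<nu> > 0" "t \<in> {0..Tstar}" for \<nu> t \<sigma>
      unfolding Hs_norm_eq diff(2)[OF vV[OF that] uV[OF that(2)]] a_def b_def by (rule wnorm_minus_commute)
    have pos: "\<forall>\<^sub>F \<nu> in at_right (0 :: real). \<nu> > 0" by (rule eventually_at_right_less)
    have sub: "t \<in> {0..Tstar}" if "t \<in> {0..T}" for t using that assms(15) by auto
    have "converges_in_C T r u\<^sub>\<nu> u"
      unfolding converges_in_C_def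
    proof (intro conjI allI impI)
      show "C_time T r (Hs r) u"
        using L2u vflowD(1,5)[OF va] assms(15) unfolding a_def by (intro C_timeI[of Tstar]) auto
      show "C_time T r (Hs r) (u\<^sub>\<nu> \<nu>)" if "\<nu> > 0" for \<nu>
        using L2v[OF that] vflowD(1,5)[OF vb[OF that]] assms(15) unfolding b_def by (intro C_timeI[of Tstar]) auto
      fix \<epsilon> :: real assume "\<epsilon> > 0"
      from order_tendstoD(2)[OF D this] pos
      show "\<forall>\<^sub>F \<nu> in at_right 0. \<forall>t\<in>{0..T}. Hs_norm r (u\<^sub>\<nu> \<nu> t - u t) < \<epsilon>"
      proof eventually_elim
        case (elim \<nu>)
        show ?case
        proof
          fix t assume "t \<in> {0..T}"
          then show "Hs_norm r (u\<^sub>\<nu> \<nu> t - u t) < \<epsilon>"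
            using diff_le[OF elim(2) sub] Hs_diff[OF elim(2) sub] elim(1) by fastforce
        qed
      qed
    qed
    moreover have "converges_in_C T 1 u\<^sub>\<nu> u"
      if H1lim: "((\<lambda>\<nu>. Hs_norm 1 (u0 - u0\<^sub>\<nu> \<nu>)) \<longlongrightarrow> 0) (at_right 0)"
      unfolding converges_in_C_def
    proof (intro conjI allI impI)
      note b1 = flow_H1[OF r \<alpha> s less_imp_le Ts b Lb]
      show "C_time T 1 (Hs 1) u"
        using L2u a1 assms(15) unfolding a_def by (intro C_timeI[of Tstar]) auto
      show "C_time T 1 (Hs 1) (u\<^sub>\<nu> \<nu>)" if "\<nu> > 0" for \<nu>
        using L2v[OF that] b1[OF that that that] assms(15) unfolding b_def by (intro C_timeI[of Tstar]) auto
      obtain K1 where K1: "K1 \<ge> 0"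
        "\<And>\<nu> b t. \<nu> > 0 \<Longrightarrow> voigt_flow \<alpha> \<nu> r Tstar b \<Longrightarrow> L2_flow Tstar s b \<Longrightarrow>
          (\<And>\<tau>. \<tau> \<in> {0..Tstar} \<Longrightarrow> sobn r (\<lambda>k. a \<tau> k - b \<tau> k) \<le> 1) \<Longrightarrow> t \<in> {0..Tstar} \<Longrightarrow>
          (sobn 1 (\<lambda>k. a t k - b t k))\<^sup>2 \<le> K1 * ((sobn 1 (\<lambda>k. a 0 k - b 0 k))\<^sup>2 + \<nu>\<^sup>2)"
        using flow_H1_estimate[OF r \<alpha> s Ts a La] by blast
      fix \<epsilon> :: real assume \<epsilon>: "\<epsilon> > 0"
      have "((\<lambda>\<nu>. K1 * ((Hs_norm 1 (u0 - u0\<^sub>\<nu> \<nu>))\<^sup>2 + \<nu>\<^sup>2)) \<longlongrightarrow> K1 * (0\<^sup>2 + 0\<^sup>2)) (at_right 0)"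
        by (intro tendsto_intros H1lim)
      then have "((\<lambda>\<nu>. K1 * ((Hs_norm 1 (u0 - u0\<^sub>\<nu> \<nu>))\<^sup>2 + \<nu>\<^sup>2)) \<longlongrightarrow> 0) (at_right 0)" by simp
      from order_tendstoD(2)[OF this, of "\<epsilon>\<^sup>2"] \<epsilon>
      have "\<forall>\<^sub>F \<nu> in at_right 0. K1 * ((Hs_norm 1 (u0 - u0\<^sub>\<nu> \<nu>))\<^sup>2 + \<nu>\<^sup>2) < \<epsilon>\<^sup>2" by simp
      \<comment> \<open>A value of \<open>D\<close> below 1 supplies the smallness in
        \<open>sob r\<close> under which the H^1 estimate holds.\<close>
      from this order_tendstoD(2)[OF D zero_less_one] pos
      show "\<forall>\<^sub>F \<nu> in at_right 0. \<forall>t\<in>{0..T}. Hs_norm 1 (u\<^sub>\<nu> \<nu> t - u t) < \<epsilon>"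
      proof eventually_elim
        case (elim \<nu>)
        have small: "sobn r (\<lambda>k. a \<tau> k - b \<nu> \<tau> k) \<le> 1" if "\<tau> \<in> {0..Tstar}" for \<tau>
          using diff_le[OF elim(3) that] elim(2) by linarith
        have w0: "Hs_norm 1 (u0 - u0\<^sub>\<nu> \<nu>) = sobn 1 (\<lambda>k. a 0 k - b \<nu> 0 k)"
          unfolding Hs_norm_eq diff(2)[OF assms(6) assms(7)[OF elim(3)]] init(1) init(2)[OF elim(3)] ..
        show ?case
        proof
          fix t assume "t \<in> {0..T}"
          then have t: "t \<in> {0..Tstar}" by (rule sub)
          have "(Hs_norm 1 (u\<^sub>\<nu> \<nu> t - u t))\<^sup>2 < \<epsilon>\<^sup>2"
            using K1(2)[OF elim(3) b[OF elim(3)] Lb[OF elim(3)] small t] elim(1)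
            unfolding Hs_diff[OF elim(3) t] w0 by linarith
          then show "Hs_norm 1 (u\<^sub>\<nu> \<nu> t - u t) < \<epsilon>" using \<epsilon> by (auto intro: power2_less_imp_less)
        qed
      qed
    qed
    ultimately show ?thesis by blast
  qed
  from part1 part2 show ?thesis by blast
qed

end
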